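(* Let $k\ge 1$ be an integer. The $(k+1)$-dimensional helicoid $H_k\subset\mathbb{R}^{2k+1}$ is stable if and only if $k\ge 3$. That is, $H_k$ is unstable for $k\le 2$ and stable for $k\ge 3$.
   Context: For an integer $k\ge1$, $H_k$ is the image of the proper embedding $\mathbb{R}^k\times\mathbb{R}\to\mathbb{C}^k\times\mathbb{R}\cong\mathbb{R}^{2k+1}$, $(u_1,\dots,u_k,s)\mapsto(u_1e^{is},\dots,u_ke^{is},s)$. It is a $(k+1)$-dimensional properly embedded minimal submanifold of Euclidean space $\mathbb{R}^{2k+1}$. The second variation of area in the direction of a smooth compactly supported normal vector field $V$ on a minimal submanifold $M$ of Euclidean space is $$Q(V,V)=\int_{M}\Big(\sum_{a}|\nabla^\perp_{E_a}V|^2-\sum_{a,b}\langle \mathrm{II}(E_a,E_b),V\rangle^2\Big)\,d\mu_M,$$ where $\{E_a\}$ is any local orthonormal tangent frame, $\nabla^\perp$ is the normal connection, and $\mathrm{II}$ is the second fundamental form. $M$ is stable if $Q(V,V)\ge0$ for every smooth compactly supported normal vector field $V$, and unstable otherwise. *)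

theory Defs
  imports "HOL-Analysis.Analysis" "HOL-Combinatorics.Permutations"
begin

primrec C_diff :: "nat \<Rightarrow> ('a::euclidean_space \<Rightarrow> 'b::euclidean_space) \<Rightarrow> bool" where
  "C_diff 0 f \<longleftrightarrow> continuous_on UNIV f"
| "C_diff (Suc n) f \<longleftrightarrow> (\<forall>x. f differentiable (at x)) \<and>
     (\<forall>v. C_diff n (\<lambda>x. frechet_derivative f (at x) v))"

definition smooth :: "('a::euclidean_space \<Rightarrow> 'b::euclidean_space) \<Rightarrow> bool" where
  "smooth f \<longleftrightarrow> (\<forall>n. C_diff n f)"

text \<open>
  Below, \<open>X\<close> is a global smooth parametrization (an injective proper immersion) of the
  submanifold \<open>M = range X\<close>, whose dimension is \<open>DIM('a)\<close>.  Points of \<open>M\<close> are represented by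
  their parameters \<open>x\<close>, tangent vectors of \<open>M\<close> at \<open>X x\<close> by their coordinate vectors \<open>v\<close>, the
  tangent vector itself being \<open>dX X x v\<close>, and a vector field on \<open>M\<close> with values in the ambient
  space by its composition with \<open>X\<close>.
\<close>

definition dX :: "('a::euclidean_space \<Rightarrow> 'b::euclidean_space) \<Rightarrow> 'a \<Rightarrow> 'a \<Rightarrow> 'b" where
  "dX X x v = frechet_derivative X (at x) v"

definition tangent_space :: "('a::euclidean_space \<Rightarrow> 'b::euclidean_space) \<Rightarrow> 'a \<Rightarrow> 'b set" where
  "tangent_space X x = range (dX X x)"

definition normal_part :: "('a::euclidean_space \<Rightarrow> 'b::euclidean_space) \<Rightarrow> 'a \<Rightarrow> 'b \<Rightarrow> 'b" where
  "normal_part X x w = (THE n. n \<in> (tangent_space X x)\<^sup>\<bottom> \<and> w - n \<in> tangent_space X x)"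

definition normal_conn ::
    "('a::euclidean_space \<Rightarrow> 'b::euclidean_space) \<Rightarrow> ('a \<Rightarrow> 'b) \<Rightarrow> 'a \<Rightarrow> 'a \<Rightarrow> 'b" where
  "normal_conn X V x v = normal_part X x (frechet_derivative V (at x) v)"

text \<open>
  The second fundamental form is the normal part of the ambient derivative, in the direction
  \<open>dX X x v\<close>, of a tangent field extending \<open>dX X x w\<close>; it does not depend on the extension, and
  the field with constant coordinates \<open>w\<close> is used.
\<close>

definition second_fund_form ::
    "('a::euclidean_space \<Rightarrow> 'b::euclidean_space) \<Rightarrow> 'a \<Rightarrow> 'a \<Rightarrow> 'a \<Rightarrow> 'b" where
  "second_fund_form X x v w = normal_part X x (frechet_derivative (\<lambda>y. dX X y w) (at x) v)"

text \<open>
  The coordinate vectors \<open>e\<close> of an orthonormal basis \<open>dX X x e\<close> of the tangent space.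
  The integrand of the second variation involves the frame only pointwise and is independent of
  its choice, so no regularity in \<open>x\<close> is needed.
\<close>

definition orthonormal_frame ::
    "('a::euclidean_space \<Rightarrow> 'b::euclidean_space) \<Rightarrow> 'a \<Rightarrow> 'a set \<Rightarrow> bool" where
  "orthonormal_frame X x B \<longleftrightarrow> finite B \<and> card B = DIM('a) \<and>
     (\<forall>a\<in>B. \<forall>b\<in>B. dX X x a \<bullet> dX X x b = (if a = b then 1 else 0))"

definition frame :: "('a::euclidean_space \<Rightarrow> 'b::euclidean_space) \<Rightarrow> 'a \<Rightarrow> 'a set" where
  "frame X x = (SOME B. orthonormal_frame X x B)"

text \<open>
  The Leibniz formula for the determinant of the matrix of the induced metric in the standard
  basis of the parameter space; the induced measure is
  \<open>d\<mu> = sqrt (gram_det X x) dx\<close>.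
\<close>

definition gram_det :: "('a::euclidean_space \<Rightarrow> 'b::euclidean_space) \<Rightarrow> 'a \<Rightarrow> real" where
  "gram_det X x = (\<Sum>p | p permutes (Basis :: 'a set).
     of_int (sign p) * (\<Prod>b\<in>Basis. dX X x b \<bullet> dX X x (p b)))"

definition second_variation ::
    "('a::euclidean_space \<Rightarrow> 'b::euclidean_space) \<Rightarrow> ('a \<Rightarrow> 'b) \<Rightarrow> real" where
  "second_variation X V = (LINT x|lborel.
     ((\<Sum>a\<in>frame X x. (norm (normal_conn X V x a))\<^sup>2)
      - (\<Sum>a\<in>frame X x. \<Sum>b\<in>frame X x. (second_fund_form X x a b \<bullet> V x)\<^sup>2))
     * sqrt (gram_det X x))"

definition compactly_supported_normal_field ::
    "('a::euclidean_space \<Rightarrow> 'b::euclidean_space) \<Rightarrow> ('a \<Rightarrow> 'b) \<Rightarrow> bool" where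
  "compactly_supported_normal_field X V \<longleftrightarrow> smooth V \<and> compact (closure {x. V x \<noteq> 0}) \<and>
     (\<forall>x. V x \<in> (tangent_space X x)\<^sup>\<bottom>)"

definition stable :: "('a::euclidean_space \<Rightarrow> 'b::euclidean_space) \<Rightarrow> bool" where
  "stable X \<longleftrightarrow> (\<forall>V. compactly_supported_normal_field X V \<longrightarrow> second_variation X V \<ge> 0)"

text \<open>The submanifold \<open>H\<^sub>k\<close> is the range of this map, with \<open>k = CARD('k)\<close>.\<close>

definition helicoid :: "(real^'k::finite) \<times> real \<Rightarrow> (complex^'k) \<times> real" where
  "helicoid = (\<lambda>(u, s). (\<chi> j. of_real (u $ j) * exp (\<i> * of_real s), s))"

end

theory Submission
  imports Defs
begin

text \<open>
  Normal fields on the helicoid have the form \<open>V = (i y e\<^sup>i\<^sup>s, - y \<bullet> u)\<close> with \<open>y\<close> valued in \<open>\<real>\<^sup>k\<close>, and with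
  \<open>w\<^sup>2 = 1 + |u|\<^sup>2\<close> and \<open>h = y \<bullet> u\<close> the second variation is the integral of
  \<open>(|D\<^sub>u y|\<^sup>2 + |D\<^sub>u h|\<^sup>2 + (|y\<^sub>s|\<^sup>2 + h\<^sub>s\<^sup>2) / w\<^sup>2 - 3 |y|\<^sup>2 / w\<^sup>2) w\<close>.

  For \<open>k \<ge> 3\<close>, adding the divergence of a suitable compactly supported field, quadratic in \<open>y\<close> and
  its first derivatives, makes the integrand nonnegative at every point.  At infinity this is a Hardy
  inequality on tangential \<open>y\<close>, whose constant \<open>(k - 1)\<^sup>2 / 4\<close> and the least angular energy, \<open>2\<close> for
  \<open>k = 3\<close>, add up to exactly \<open>3\<close> for \<open>k = 3\<close>.

  For \<open>k = 1\<close> the field \<open>y = 1 / w\<close>, and for \<open>k = 2\<close> the field \<open>y = w\<^sup>-\<^sup>3\<^sup>/\<^sup>2 J u\<close> with \<open>J\<close> the rotation by a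
  right angle, have negative density near the axis and near infinity respectively; multiplying by
  a logarithmic cutoff in \<open>u\<close> and a long cutoff in \<open>s\<close> gives fields with negative second variation.
\<close>

section \<open>Smooth functions\<close>

text \<open>The angular energy is a spectral gap on spheres, which is no pointwise inequality
  between \<open>y\<close> and its derivatives. It becomes pointwise through a null Lagrangian: (div
  y)^2 - tr (Dy)^2, formed along the spheres, is a divergence up to terms bilinear in
  \<open>y\<close> and Dy. So the correcting field contains first derivatives of \<open>y\<close>,
  and its divergence is free of second derivatives only by their symmetry. Its weight 1 / (k - 2)
  exhausts the trace inequality on the (k - 1)-dimensional tangential block at infinity. The
  derivatives in s enter with the good sign and are dropped, so the divergence involves the
  directions of u alone. In the unstable cases the powers of w are forced: for k = 1, y = 1 / w
  makes V a unit normal field; for k = 2, |y| decays like |u|^(-1/2), the critical Hardy rate, and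
  1/4 plus angular energy 1 stays below 3. A cutoff in ln w with parameter 1 / N costs O(1 / N)
  against a fixed gain for k = 1, and a bounded amount against a gain growing like N for k =
  2.\<close>

lemma C_diff_SucI:
  assumes "\<And>x. (f has_derivative f' x) (at x)" "\<And>v. C_diff n (\<lambda>x. f' x v)"
  shows "C_diff (Suc n) f"
proof -
  have "frechet_derivative f (at x) = f' x" for x
    using frechet_derivative_at[OF assms(1)] by simp
  then show ?thesis
    using assms by (auto simp: differentiable_def)
qed

lemma C_diff_SucD:
  assumes "C_diff (Suc n) f"
  shows "(f has_derivative frechet_derivative f (at x)) (at x)"
    and "C_diff n (\<lambda>x. frechet_derivative f (at x) v)"
  using assms by (auto simp: frechet_derivative_works)

lemma C_diff_Suc_imp: "C_diff (Suc n) f \<Longrightarrow> C_diff n f"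
proof (induction n arbitrary: f)
  case 0
  then show ?case
    by (auto intro!: continuous_at_imp_continuous_on differentiable_imp_continuous_within)
next
  case (Suc n)
  from Suc.prems have "C_diff n (\<lambda>x. frechet_derivative f (at x) v)" for v
    by (intro Suc.IH) auto
  with Suc.prems show ?case by auto
qed

lemma C_diff_mono: "m \<le> n \<Longrightarrow> C_diff n f \<Longrightarrow> C_diff m f"
  by (induction rule: inc_induct) (blast intro: C_diff_Suc_imp)+

lemma C_diff_continuous: "C_diff n f \<Longrightarrow> continuous_on UNIV f"
  using C_diff_mono[of 0 n f] by simp

lemma C_diff_const [simp]: "C_diff n (\<lambda>x. c)"
proof (induction n arbitrary: c)
  case (Suc n)
  show ?case
    by (rule C_diff_SucI[where f' = "\<lambda>x v. 0"]) (auto intro: Suc)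
qed simp

lemma C_diff_bounded_linear:
  assumes "bounded_linear L"
  shows "C_diff n f \<Longrightarrow> C_diff n (\<lambda>x. L (f x))"
proof (induction n arbitrary: f)
  case 0
  then show ?case using bounded_linear.continuous_on[OF assms] by simp
next
  case (Suc n)
  note f = C_diff_SucD[OF Suc.prems]
  show ?case
    by (rule C_diff_SucI[where f' = "\<lambda>x v. L (frechet_derivative f (at x) v)"])
      (auto intro!: bounded_linear.has_derivative[OF assms] f(1) Suc.IH f(2))
qed

lemma C_diff_ident: "C_diff n (\<lambda>x. x)"
proof (cases n)
  case (Suc m)
  show ?thesis unfolding Suc
    by (rule C_diff_SucI[where f' = "\<lambda>x v. v"]) auto
qed simp

lemma C_diff_linear: "bounded_linear L \<Longrightarrow> C_diff n L"
  using C_diff_bounded_linear[OF _ C_diff_ident] by auto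

lemma C_diff_add: "C_diff n f \<Longrightarrow> C_diff n g \<Longrightarrow> C_diff n (\<lambda>x. f x + g x)"
proof (induction n arbitrary: f g)
  case 0
  then show ?case by (auto intro: continuous_on_add)
next
  case (Suc n)
  note f = C_diff_SucD[OF Suc.prems(1)] and g = C_diff_SucD[OF Suc.prems(2)]
  show ?case
    by (rule C_diff_SucI[OF has_derivative_add[OF f(1) g(1)]]) (intro Suc.IH f(2) g(2))
qed

lemma C_diff_sum: "(\<And>i. i \<in> I \<Longrightarrow> C_diff n (f i)) \<Longrightarrow> C_diff n (\<lambda>x. \<Sum>i\<in>I. f i x)"
  by (induction I rule: infinite_finite_induct) (auto intro: C_diff_add)

text \<open>One Leibniz rule serves scalar, vector, inner and matrix products. The undifferentiated
  factor has an order of smoothness to spare, given up by \<open>C_diff_Suc_imp\<close>.\<close>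

lemma C_diff_bilinear:
  fixes f :: "'a::euclidean_space \<Rightarrow> 'b::euclidean_space"
    and g :: "'a \<Rightarrow> 'c::euclidean_space" and B :: "'b \<Rightarrow> 'c \<Rightarrow> 'd::euclidean_space"
  assumes B: "bounded_bilinear B"
  shows "C_diff n f \<Longrightarrow> C_diff n g \<Longrightarrow> C_diff n (\<lambda>x. B (f x) (g x))"
proof (induction n arbitrary: f g)
  case 0
  then show ?case by (auto intro: bounded_bilinear.continuous_on[OF B])
next
  case (Suc n)
  note f = C_diff_SucD[OF Suc.prems(1)] and g = C_diff_SucD[OF Suc.prems(2)]
  show ?case
    by (rule C_diff_SucI[OF bounded_bilinear.FDERIV[OF B f(1) g(1)]])
      (intro C_diff_add Suc.IH f(2) g(2) C_diff_Suc_imp[OF Suc.prems(1)]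
        C_diff_Suc_imp[OF Suc.prems(2)])
qed

lemmas C_diff_mult = C_diff_bilinear[OF bounded_bilinear_mult]
lemmas C_diff_scaleR = C_diff_bilinear[OF bounded_bilinear_scaleR]
lemmas C_diff_inner = C_diff_bilinear[OF bounded_bilinear_inner]

lemma C_diff_minus: "C_diff n f \<Longrightarrow> C_diff n (\<lambda>x. - f x)"
  by (rule C_diff_bounded_linear[OF bounded_linear_minus[OF bounded_linear_ident]])

lemma C_diff_diff: "C_diff n f \<Longrightarrow> C_diff n g \<Longrightarrow> C_diff n (\<lambda>x. f x - g x)"
  using C_diff_add[OF _ C_diff_minus, of n f g] by simp

lemma C_diff_power:
  fixes f :: "'a::euclidean_space \<Rightarrow> real"
  shows "C_diff n f \<Longrightarrow> C_diff n (\<lambda>x. f x ^ m)"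
  by (induction m) (auto intro: C_diff_mult)

lemma C_diff_Pair: "C_diff n f \<Longrightarrow> C_diff n g \<Longrightarrow> C_diff n (\<lambda>x. (f x, g x))"
proof (induction n arbitrary: f g)
  case 0
  then show ?case by (auto intro: continuous_on_Pair)
next
  case (Suc n)
  note f = C_diff_SucD[OF Suc.prems(1)] and g = C_diff_SucD[OF Suc.prems(2)]
  show ?case
    by (rule C_diff_SucI[OF has_derivative_Pair[OF f(1) g(1)]]) (intro Suc.IH f(2) g(2))
qed

text \<open>Each derivative lowers the exponent by one, so the induction runs over all
  \<open>p\<close> at once.\<close>

lemma C_diff_powr:
  fixes g :: "'a::euclidean_space \<Rightarrow> real"
  assumes pos: "\<And>x. g x > 0"
  shows "C_diff n g \<Longrightarrow> C_diff n (\<lambda>x. g x powr p)"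
proof (induction n arbitrary: p)
  case 0
  then show ?case using pos by (auto intro!: continuous_intros simp: less_imp_neq[symmetric])
next
  case (Suc n)
  note g = C_diff_SucD[OF Suc.prems]
  show ?case
  proof (rule C_diff_SucI)
    show "((\<lambda>x. g x powr p) has_derivative
       (\<lambda>v. p * g x powr (p - 1) * frechet_derivative g (at x) v)) (at x)" for x
      using has_derivative_powr[OF g(1) has_derivative_const pos, of x p] pos[of x]
      by (auto simp: powr_diff field_simps intro: has_derivative_eq_rhs)
    show "C_diff n (\<lambda>x. p * g x powr (p - 1) * frechet_derivative g (at x) v)" for v
      by (intro C_diff_mult C_diff_const Suc.IH g(2) C_diff_Suc_imp[OF Suc.prems])
  qed
qed

text \<open>One differentiation leaves the power \<open>g powr (-1)\<close>, which
  \<open>C_diff_powr\<close> covers.\<close>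

lemma C_diff_ln:
  fixes g :: "'a::euclidean_space \<Rightarrow> real"
  assumes pos: "\<And>x. g x > 0" and g: "C_diff n g"
  shows "C_diff n (\<lambda>x. ln (g x))"
proof (cases n)
  case 0
  then show ?thesis using pos g by (auto intro!: continuous_intros simp: less_imp_neq[symmetric])
next
  case (Suc m)
  note g' = C_diff_SucD[OF g[unfolded Suc]]
  show ?thesis unfolding Suc
  proof (rule C_diff_SucI)
    show "((\<lambda>x. ln (g x)) has_derivative
       (\<lambda>v. g x powr (-1) * frechet_derivative g (at x) v)) (at x)" for x
      using has_derivative_ln[OF pos g'(1), of x] pos[of x]
      by (simp add: powr_minus mult.commute)
    show "C_diff m (\<lambda>x. g x powr (-1) * frechet_derivative g (at x) v)" for v
      by (intro C_diff_mult C_diff_powr[OF pos] g'(2) C_diff_Suc_imp[OF g[unfolded Suc]])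
  qed
qed

lemma C_diff_cis:
  fixes g :: "'a::euclidean_space \<Rightarrow> real"
  shows "C_diff n g \<Longrightarrow> C_diff n (\<lambda>x. cis (g x))"
proof (induction n)
  case 0
  then show ?case by (auto intro!: continuous_intros)
next
  case (Suc n)
  note g = C_diff_SucD[OF Suc.prems]
  show ?case
  proof (rule C_diff_SucI)
    show "((\<lambda>x. cis (g x)) has_derivative
       (\<lambda>v. frechet_derivative g (at x) v *\<^sub>R (\<i> * cis (g x)))) (at x)" for x
      by (auto intro!: derivative_eq_intros g(1))
    show "C_diff n (\<lambda>x. frechet_derivative g (at x) v *\<^sub>R (\<i> * cis (g x)))" for v
      by (intro C_diff_scaleR g(2) C_diff_mult C_diff_const Suc.IH
          C_diff_Suc_imp[OF Suc.prems])
  qed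
qed

text \<open>The case \<open>m = 0\<close> is the standard flat function; the factor \<open>t\<^sup>-\<^sup>m\<close> makes the family closed
  under differentiation.\<close>
definition flat_exp :: "nat \<Rightarrow> real \<Rightarrow> real" where
  "flat_exp m t = (if 0 < t then exp (- inverse t) * inverse t ^ m else 0)"

lemma has_real_derivative_flat_exp:
  "(flat_exp m has_real_derivative (flat_exp (m + 2) t - real m * flat_exp (m + 1) t)) (at t)"
proof -
  consider "t > 0" | "t < 0" | "t = 0" by linarith
  then show ?thesis
  proof cases
    case 1
    have "((\<lambda>t. exp (- inverse t) * inverse t ^ m) has_real_derivative
        (flat_exp (m + 2) t - real m * flat_exp (m + 1) t)) (at t)"
      unfolding flat_exp_def using 1
      by (auto intro!: derivative_eq_intros simp: field_simps power2_eq_square)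
        (cases m; simp)
    then show ?thesis
      by (rule has_field_derivative_transform_within_open[where S = "{0<..}"])
        (use 1 in \<open>auto simp: flat_exp_def\<close>)
  next
    case 2
    have "((\<lambda>t. 0) has_real_derivative (flat_exp (m + 2) t - real m * flat_exp (m + 1) t)) (at t)"
      unfolding flat_exp_def using 2 by auto
    then show ?thesis
      by (rule has_field_derivative_transform_within_open[where S = "{..<0}"])
        (use 2 in \<open>auto simp: flat_exp_def\<close>)
  next
    case 3
    \<comment> \<open>With x = 1 / h this is the right-hand difference quotient at 0: the
      exponential beats every power.\<close>
    have "((\<lambda>x::real. x ^ (m + 1) / exp x) \<longlongrightarrow> 0) at_top"
      by (rule tendsto_power_div_exp_0)
    then have "((\<lambda>h::real. inverse h ^ (m + 1) / exp (inverse h)) \<longlongrightarrow> 0) (at_right 0)"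
      by (rule filterlim_compose) (rule filterlim_inverse_at_top_right)
    then have "((\<lambda>h. (flat_exp m (0 + h) - flat_exp m 0) / h) \<longlongrightarrow> 0) (at_right 0)"
      by (rule Lim_transform_eventually)
        (auto simp: eventually_at_filter flat_exp_def exp_minus field_simps)
    moreover have "((\<lambda>h. (flat_exp m (0 + h) - flat_exp m 0) / h) \<longlongrightarrow> 0) (at_left 0)"
      by (rule Lim_transform_eventually[where f = "\<lambda>_. 0"])
        (auto simp: eventually_at_filter flat_exp_def)
    ultimately have "((\<lambda>h. (flat_exp m (0 + h) - flat_exp m 0) / h) \<longlongrightarrow> 0) (at 0)"
      by (simp add: filterlim_split_at)
    moreover have "flat_exp (m + 2) t - real m * flat_exp (m + 1) t = 0"
      using 3 by (simp add: flat_exp_def)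
    ultimately show ?thesis
      unfolding 3 DERIV_def by simp
  qed
qed

lemma C_diff_flat_exp:
  fixes g :: "'a::euclidean_space \<Rightarrow> real"
  shows "C_diff n g \<Longrightarrow> C_diff n (\<lambda>x. flat_exp m (g x))"
proof (induction n arbitrary: m)
  case 0
  have "continuous_on UNIV (flat_exp m)"
    by (intro continuous_at_imp_continuous_on ballI) (rule DERIV_isCont[OF has_real_derivative_flat_exp])
  then show ?case
    using 0 by (auto intro: continuous_on_compose2)
next
  case (Suc n)
  note g = C_diff_SucD[OF Suc.prems]
  show ?case
  proof (rule C_diff_SucI)
    show "((\<lambda>x. flat_exp m (g x)) has_derivative
       (\<lambda>v. (flat_exp (m + 2) (g x) - real m * flat_exp (m + 1) (g x)) * frechet_derivative g (at x) v)) (at x)"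
      for x
      using has_derivative_compose[OF g(1)
          has_real_derivative_flat_exp[of m "g x", unfolded has_field_derivative_def]]
      by simp
    show "C_diff n (\<lambda>x. (flat_exp (m + 2) (g x) - real m * flat_exp (m + 1) (g x))
        * frechet_derivative g (at x) v)" for v
      by (intro C_diff_mult C_diff_diff C_diff_const Suc.IH g(2) C_diff_Suc_imp[OF Suc.prems])
  qed
qed

section \<open>Symmetry of second derivatives\<close>

lemma has_real_derivative_along:
  fixes f :: "'a::euclidean_space \<Rightarrow> real"
  assumes f: "C_diff (Suc n) f"
  shows "((\<lambda>t. f (p + t *\<^sub>R v)) has_real_derivative frechet_derivative f (at (p + t *\<^sub>R v)) v) (at t)"
proof -
  note f1 = C_diff_SucD(1)[OF f]
  have "((\<lambda>t. f (p + t *\<^sub>R v)) has_derivative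
      (\<lambda>s. frechet_derivative f (at (p + t *\<^sub>R v)) (s *\<^sub>R v))) (at t)"
    by (rule has_derivative_compose[OF _ f1]) (auto intro!: derivative_eq_intros)
  moreover have "frechet_derivative f (at (p + t *\<^sub>R v)) (s *\<^sub>R v)
      = frechet_derivative f (at (p + t *\<^sub>R v)) v * s" for s
    using linear_frechet_derivative[OF differentiableI[OF f1]]
    by (simp add: linear_cmul mult.commute)
  ultimately show ?thesis
    unfolding has_field_derivative_def by simp
qed

text \<open>Two mean value theorems: first in direction \<open>v\<close> for the difference of
  \<open>f\<close> across \<open>h *\<^sub>R w\<close>, then in direction \<open>w\<close> for the
  \<open>v\<close>-derivative. The left side is symmetric in \<open>v\<close> and \<open>w\<close>,
  the right side is not.\<close>

lemma second_difference_mvt: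
  fixes f :: "'a::euclidean_space \<Rightarrow> real"
  assumes f: "C_diff 2 f" and h: "h > 0"
  obtains a b where "0 < a" "a < h" "0 < b" "b < h"
    "f (x + h *\<^sub>R v + h *\<^sub>R w) - f (x + h *\<^sub>R v) - f (x + h *\<^sub>R w) + f x =
      h * h * frechet_derivative (\<lambda>y. frechet_derivative f (at y) v)
        (at (x + a *\<^sub>R v + b *\<^sub>R w)) w"
proof -
  have f: "C_diff (Suc (Suc 0)) f" using f by (simp add: numeral_2_eq_2)
  let ?fv = "\<lambda>y. frechet_derivative f (at y) v"
  note f1 = C_diff_SucD[OF f]
  have d: "((\<lambda>t. f (p + t *\<^sub>R v)) has_real_derivative ?fv (p + t *\<^sub>R v)) (at t)" for p t
    by (rule has_real_derivative_along[OF f])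
  have d2: "((\<lambda>t. ?fv (p + t *\<^sub>R w)) has_real_derivative
      frechet_derivative ?fv (at (p + t *\<^sub>R w)) w) (at t)" for p t
    by (rule has_real_derivative_along[OF f1(2)])
  have "\<exists>a. 0 < a \<and> a < h \<and>
    (\<lambda>t. f ((x + h *\<^sub>R w) + t *\<^sub>R v) - f (x + t *\<^sub>R v)) h - (\<lambda>t. f ((x + h *\<^sub>R w) + t *\<^sub>R v) - f (x + t *\<^sub>R v)) 0
      = (h - 0) * (?fv ((x + h *\<^sub>R w) + a *\<^sub>R v) - ?fv (x + a *\<^sub>R v))"
    using h by (intro MVT2) (auto intro!: derivative_intros d)
  then obtain a where a: "0 < a" "a < h" and
    "f ((x + h *\<^sub>R w) + h *\<^sub>R v) - f (x + h *\<^sub>R v) - (f (x + h *\<^sub>R w) - f x)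
      = h * (?fv ((x + h *\<^sub>R w) + a *\<^sub>R v) - ?fv (x + a *\<^sub>R v))"
    by auto
  moreover have "\<exists>b. 0 < b \<and> b < h \<and> (\<lambda>t. ?fv ((x + a *\<^sub>R v) + t *\<^sub>R w)) h - (\<lambda>t. ?fv ((x + a *\<^sub>R v) + t *\<^sub>R w)) 0
     = (h - 0) * frechet_derivative ?fv (at ((x + a *\<^sub>R v) + b *\<^sub>R w)) w"
    using h by (intro MVT2) (auto intro!: d2)
  then obtain b where b: "0 < b" "b < h" and
    "?fv ((x + a *\<^sub>R v) + h *\<^sub>R w) - ?fv (x + a *\<^sub>R v)
     = h * frechet_derivative ?fv (at ((x + a *\<^sub>R v) + b *\<^sub>R w)) w"
    by auto
  ultimately show ?thesis
    using a b by (intro that[of a b]) (auto simp: algebra_simps)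
qed

text \<open>Schwarz's theorem. The second difference quotient \<open>q\<close> is symmetric in the
  two directions, and by continuity both iterated derivatives are its limit along h = 1 / (n +
  1).\<close>

lemma frechet_derivative_commute:
  fixes f :: "'a::euclidean_space \<Rightarrow> real"
  assumes f: "C_diff 2 f"
  shows "frechet_derivative (\<lambda>y. frechet_derivative f (at y) v) (at x) w =
    frechet_derivative (\<lambda>y. frechet_derivative f (at y) w) (at x) v"
proof -
  let ?D = "\<lambda>v w x. frechet_derivative (\<lambda>y. frechet_derivative f (at y) v) (at x) w"
  define q where "q = (\<lambda>h. (f (x + h *\<^sub>R v + h *\<^sub>R w) - f (x + h *\<^sub>R v) - f (x + h *\<^sub>R w) + f x) / (h * h))"
  have f': "C_diff (Suc (Suc 0)) f" using f by (simp add: numeral_2_eq_2)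
  have cont: "isCont (?D v w) x" for v w
    using C_diff_SucD(2)[OF C_diff_SucD(2)[OF f']] by (auto simp: continuous_on_eq_continuous_at)
  have lim: "(\<lambda>n. q (inverse (real (Suc n)))) \<longlonglongrightarrow> ?D v w x"
    if "\<And>h. h > 0 \<Longrightarrow> \<exists>a b. 0 < a \<and> a < h \<and> 0 < b \<and> b < h \<and> q h = ?D v w (x + a *\<^sub>R v + b *\<^sub>R w)" for v w
  proof -
    have "\<exists>a b. 0 < a \<and> a < inverse (real (Suc n)) \<and> 0 < b \<and> b < inverse (real (Suc n)) \<and> 
        q (inverse (real (Suc n))) = ?D v w (x + a *\<^sub>R v + b *\<^sub>R w)" for n
      by (rule that) simp
    then obtain a b where ab: "\<And>n. 0 < a n \<and> a n < inverse (real (Suc n)) \<and> 0 < b n \<and> 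
        b n < inverse (real (Suc n)) \<and> q (inverse (real (Suc n))) = ?D v w (x + a n *\<^sub>R v + b n *\<^sub>R w)"
      by metis
    have "a \<longlonglongrightarrow> 0" "b \<longlonglongrightarrow> 0"
      using ab by (auto intro!: tendsto_sandwich[OF _ _ tendsto_const LIMSEQ_inverse_real_of_nat]
          eventuallyI less_imp_le)
    then have "(\<lambda>n. x + a n *\<^sub>R v + b n *\<^sub>R w) \<longlonglongrightarrow> x + 0 *\<^sub>R v + 0 *\<^sub>R w"
      by (intro tendsto_intros)
    then have "(\<lambda>n. ?D v w (x + a n *\<^sub>R v + b n *\<^sub>R w)) \<longlonglongrightarrow> ?D v w x"
      using cont[of v w] by (intro isCont_tendsto_compose[where g = "?D v w"]) auto
    then show ?thesis using ab by simp
  qed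
  have "(\<lambda>n. q (inverse (real (Suc n)))) \<longlonglongrightarrow> ?D v w x"
  proof (rule lim)
    fix h :: real assume h: "h > 0"
    obtain a b where "0 < a" "a < h" "0 < b" "b < h"
      "f (x + h *\<^sub>R v + h *\<^sub>R w) - f (x + h *\<^sub>R v) - f (x + h *\<^sub>R w) + f x =
        h * h * ?D v w (x + a *\<^sub>R v + b *\<^sub>R w)"
      using second_difference_mvt[OF f h] by metis
    then show "\<exists>a b. 0 < a \<and> a < h \<and> 0 < b \<and> b < h \<and> q h = ?D v w (x + a *\<^sub>R v + b *\<^sub>R w)"
      using h unfolding q_def by (intro exI[of _ a] exI[of _ b]) auto
  qed
  moreover have "(\<lambda>n. q (inverse (real (Suc n)))) \<longlonglongrightarrow> ?D w v x"
  proof (rule lim)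
    fix h :: real assume h: "h > 0"
    obtain a b where "0 < a" "a < h" "0 < b" "b < h"
      "f (x + h *\<^sub>R w + h *\<^sub>R v) - f (x + h *\<^sub>R w) - f (x + h *\<^sub>R v) + f x =
        h * h * ?D w v (x + a *\<^sub>R w + b *\<^sub>R v)"
      using second_difference_mvt[OF f h] by metis
    then show "\<exists>a b. 0 < a \<and> a < h \<and> 0 < b \<and> b < h \<and> q h = ?D w v (x + a *\<^sub>R w + b *\<^sub>R v)"
      using h unfolding q_def 
      by (intro exI[of _ a] exI[of _ b]) (auto simp: algebra_simps)
  qed
  ultimately show ?thesis by (rule LIMSEQ_unique)
qed

section \<open>Integrals of derivatives\<close>

lemma integrable_continuous_compact_support:
  fixes f :: "'a::euclidean_space \<Rightarrow> real"
  assumes f: "continuous_on UNIV f" and K: "compact K" "\<And>x. x \<notin> K \<Longrightarrow> f x = 0"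
  shows "integrable lborel f"
proof -
  have "bounded (f ` K)"
    by (intro compact_imp_bounded compact_continuous_image K continuous_on_subset[OF f]) auto
  then obtain C where C: "\<And>x. x \<in> K \<Longrightarrow> norm (f x) \<le> C" by (auto simp: bounded_iff)
  have "integrable lborel (indicator K :: 'a \<Rightarrow> real)"
    using K(1) by (simp add: integrable_indicator_iff emeasure_compact_finite[simplified]
        compact_imp_closed borel_compact)
  moreover have "f \<in> borel_measurable borel"
    using f by (rule borel_measurable_continuous_onI)
  ultimately show ?thesis
    by (intro Bochner_Integration.integrable_bound[where f = "\<lambda>x. C * indicator K x" and g = f])
      (use C K(2) in \<open>auto split: split_indicator intro: order_trans[OF _ abs_ge_self]\<close>)
qed

text \<open>By translation invariance of Lebesgue measure every difference quotient has integral 0;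
  dominated convergence passes this to the derivative. It takes the place of the divergence
  theorem.\<close>

lemma integral_directional_derivative:
  fixes f :: "'a::euclidean_space \<Rightarrow> real"
  assumes f: "C_diff 1 f" and K: "compact K" "\<And>x. x \<notin> K \<Longrightarrow> f x = 0"
  shows "integrable lborel (\<lambda>x. frechet_derivative f (at x) v)"
    and "(LINT x|lborel. frechet_derivative f (at x) v) = 0"
proof -
  let ?f' = "\<lambda>x. frechet_derivative f (at x) v"
  have f: "C_diff (Suc 0) f" using f by simp
  note f1 = C_diff_SucD(1)[OF f]
  have cont: "continuous_on UNIV f" "continuous_on UNIV ?f'"
    using C_diff_continuous[OF f] C_diff_SucD(2)[OF f] by auto
  \<comment> \<open>The points from which \<open>K\<close> is reached along \<open>v\<close> in time
    at most 1. This one compact set contains the supports of all quotients with step at most 1, so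
    it carries the dominating function.\<close>
  define K' where "K' = (\<lambda>(x, t). x - t *\<^sub>R v) ` (K \<times> {0..1})"
  have cK': "compact K'" unfolding K'_def
    by (intro compact_continuous_image compact_Times K)
      (auto intro!: continuous_intros simp: case_prod_unfold)
  have inK': "x \<in> K'" if "x + t *\<^sub>R v \<in> K" "0 \<le> t" "t \<le> 1" for x t
    using that unfolding K'_def by (intro image_eqI[of _ _ "(x + t *\<^sub>R v, t)"]) auto
  have supp: "?f' x = 0" if "x \<notin> K'" for x
  proof -
    have "open (- K')" using cK' by (simp add: compact_imp_closed open_Compl)
    moreover have "f y = 0" if "y \<in> - K'" for y
      using inK'[of y 0] that K(2) by force
    ultimately have "(f has_derivative (\<lambda>_. 0)) (at x)"
      using that by (intro has_derivative_transform_within_open[OF has_derivative_const[of 0]]) auto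
    then have "frechet_derivative f (at x) = (\<lambda>_. 0)" by (rule frechet_derivative_at[symmetric])
    then show ?thesis by simp
  qed
  obtain C where C: "\<And>x. x \<in> K' \<Longrightarrow> norm (?f' x) \<le> C" and "C \<ge> 0"
  proof -
    have "bounded (?f' ` K')"
      by (intro compact_imp_bounded compact_continuous_image cK' continuous_on_subset[OF cont(2)]) auto
    then obtain C where "\<And>x. x \<in> K' \<Longrightarrow> norm (?f' x) \<le> C" by (auto simp: bounded_iff)
    then show ?thesis by (intro that[of "max C 0"]) force+
  qed
  have bound: "norm (?f' x) \<le> C" for x
    using C supp \<open>C \<ge> 0\<close> by (cases "x \<in> K'") auto
  have intK': "integrable lborel (indicator K' :: 'a \<Rightarrow> real)"
    using cK' by (simp add: integrable_indicator_iff emeasure_compact_finite[simplified] compact_imp_closed borel_compact)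
  have meas: "f \<in> borel_measurable borel" "?f' \<in> borel_measurable borel"
    using cont by (auto intro: borel_measurable_continuous_onI)
  show int': "integrable lborel ?f'"
    by (rule integrable_continuous_compact_support[OF cont(2) cK' supp])
  have int: "integrable lborel f"
    by (rule integrable_continuous_compact_support[OF cont(1) K])
  define q where "q = (\<lambda>n x. (f (x + inverse (real (Suc n)) *\<^sub>R v) - f x) / inverse (real (Suc n)))"
  have d: "((\<lambda>t. f (p + t *\<^sub>R v)) has_real_derivative ?f' (p + t *\<^sub>R v)) (at t)" for p t
    by (rule has_real_derivative_along[OF f])
  have zero: "(LINT x|lborel. q n x) = 0" for n
  proof -
    have eq: "(LINT x|lborel. f (x + c)) = (LINT x|lborel. f x)" "integrable lborel (\<lambda>x. f (x + c))" for c
    proof -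
      have *: "lborel = distr lborel borel (\<lambda>x. c + x)" for c :: 'a
        using lborel_affine[of 1 c] by (simp add: lborel_distr_plus)
      show "(LINT x|lborel. f (x + c)) = (LINT x|lborel. f x)"
        by (subst (2) *[of c]) (simp add: integral_distr meas add.commute)
      show "integrable lborel (\<lambda>x. f (x + c))"
        using int by (subst (asm) *[of c]) (simp add: integrable_distr_eq meas add.commute)
    qed
    show ?thesis unfolding q_def using int eq by simp
  qed
  have "(\<lambda>n. LINT x|lborel. q n x) \<longlonglongrightarrow> (LINT x|lborel. ?f' x)"
  proof (rule integral_dominated_convergence[where w = "\<lambda>x. C * indicator K' x"])
    show "AE x in lborel. (\<lambda>n. q n x) \<longlonglongrightarrow> ?f' x"
    proof (intro AE_I2)
      fix x
      have "((\<lambda>h. (f (x + h *\<^sub>R v) - f x) / h) \<longlongrightarrow> ?f' x) (at 0)"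
        using d[of x 0] by (simp add: DERIV_def)
      moreover have "filterlim (\<lambda>n. inverse (real (Suc n))) (at 0) sequentially"
        by (auto simp: filterlim_at simp del: of_nat_Suc intro!: LIMSEQ_inverse_real_of_nat)
      ultimately show "(\<lambda>n. q n x) \<longlonglongrightarrow> ?f' x"
        unfolding q_def by (rule filterlim_compose)
    qed
    show "AE x in lborel. norm (q n x) \<le> C * indicator K' x" for n
    proof (intro AE_I2)
      fix x
      let ?h = "inverse (real (Suc n))"
      have h: "0 < ?h" "?h \<le> 1" by (auto simp: inverse_le_1_iff)
      have "\<exists>t. 0 < t \<and> t < ?h \<and> (\<lambda>t. f (x + t *\<^sub>R v)) ?h - (\<lambda>t. f (x + t *\<^sub>R v)) 0
          = (?h - 0) * ?f' (x + t *\<^sub>R v)"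
        using h by (intro MVT2) (auto intro!: d)
      then obtain t where "f (x + ?h *\<^sub>R v) - f x = ?h * ?f' (x + t *\<^sub>R v)" by auto
      then have le: "norm (q n x) \<le> C"
        unfolding q_def using h bound by (simp add: field_simps)
      show "norm (q n x) \<le> C * indicator K' x"
      proof (cases "x \<in> K'")
        case False
        then have "x + ?h *\<^sub>R v \<notin> K" "x \<notin> K" using inK'[of x ?h] inK'[of x 0] h by auto
        then show ?thesis using False K(2) by (simp add: q_def)
      qed (use le in simp)
    qed
  qed (use meas intK' in \<open>auto simp: q_def\<close>)
  then show "(LINT x|lborel. ?f' x) = 0"
    by (simp add: zero LIMSEQ_const_iff)
qed

section \<open>Geometry of the helicoid\<close>

lemma orthonormal_frame_expand:
  assumes B: "orthonormal_frame X x B" and lin: "linear (dX X x)"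
  shows "a = (\<Sum>b\<in>B. (dX X x a \<bullet> dX X x b) *\<^sub>R b)"
proof -
  have fin: "finite B" and card: "card B = DIM('a)"
    and on: "\<And>a b. a \<in> B \<Longrightarrow> b \<in> B \<Longrightarrow> dX X x a \<bullet> dX X x b = (if a = b then 1 else 0)"
    using B by (auto simp: orthonormal_frame_def)
  have coeff: "dX X x (\<Sum>b\<in>B. c b *\<^sub>R b) \<bullet> dX X x b = c b" if "b \<in> B" for c b
  proof -
    have "dX X x (\<Sum>b\<in>B. c b *\<^sub>R b) \<bullet> dX X x b = (\<Sum>a\<in>B. if a = b then c a else 0)"
      unfolding linear_sum[OF lin] inner_sum_left
      by (intro sum.cong) (auto simp: linear_cmul[OF lin] on that)
    also have "\<dots> = c b" using fin that by simp
    finally show ?thesis .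
  qed
  \<comment> \<open>Pairing with the frame reads off coefficients, hence independence; the
    cardinality then makes \<open>B\<close> a basis of the parameter space.\<close>
  have ind: "independent B"
  proof
    assume "dependent B"
    then obtain c b where "b \<in> B" "c b \<noteq> 0" "(\<Sum>b\<in>B. c b *\<^sub>R b) = 0"
      using fin by (auto simp: dependent_finite)
    with coeff[of b c] show False by (simp add: linear_0[OF lin])
  qed
  have "span B = UNIV"
    using card_ge_dim_independent[of B UNIV] ind card by auto
  then have "a \<in> range (\<lambda>c. \<Sum>b\<in>B. c b *\<^sub>R b)"
    unfolding span_finite[OF fin] by simp
  then obtain c where c: "a = (\<Sum>b\<in>B. c b *\<^sub>R b)"
    by blast
  show ?thesis
    by (subst (1) c, rule sum.cong) (simp_all add: c coeff)
qed

text \<open>The sum is the trace of the adjoint of \<open>L\<close> composed with \<open>L\<close>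
  in the induced metric. As \<open>frame\<close> is an unspecified choice, this is what allows
  computing in an explicit frame.\<close>

lemma orthonormal_frame_sum_eq:
  fixes L :: "'a::euclidean_space \<Rightarrow> 'c::real_inner"
  assumes B: "orthonormal_frame X x B" and B': "orthonormal_frame X x B'"
    and lin: "linear (dX X x)" and L: "linear L"
  shows "(\<Sum>a\<in>B. (norm (L a))\<^sup>2) = (\<Sum>b\<in>B'. (norm (L b))\<^sup>2)"
proof -
  define g where "g a b = dX X x a \<bullet> dX X x b" for a b
  have La: "L a = (\<Sum>b\<in>B'. g a b *\<^sub>R L b)" for a
    by (subst orthonormal_frame_expand[OF B' lin, of a])
      (simp add: linear_sum[OF L] linear_cmul[OF L] g_def)
  \<comment> \<open>Parseval's identity in the frame \<open>B\<close>.\<close>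
  have gg: "(\<Sum>a\<in>B. g a b * g a c) = g b c" for b c
  proof -
    have "g b c = dX X x (\<Sum>a\<in>B. g b a *\<^sub>R a) \<bullet> dX X x c"
      using orthonormal_frame_expand[OF B lin, of b] by (simp add: g_def)
    also have "\<dots> = (\<Sum>a\<in>B. g b a * g a c)"
      by (simp add: linear_sum[OF lin] linear_cmul[OF lin] inner_sum_left g_def)
    finally show ?thesis by (simp add: g_def inner_commute)
  qed
  have "(\<Sum>a\<in>B. (norm (L a))\<^sup>2) = (\<Sum>a\<in>B. \<Sum>b\<in>B'. \<Sum>c\<in>B'. g a b * g a c * (L b \<bullet> L c))"
  proof (rule sum.cong)
    fix a
    have "(norm (L a))\<^sup>2 = (\<Sum>b\<in>B'. g a b *\<^sub>R L b) \<bullet> (\<Sum>c\<in>B'. g a c *\<^sub>R L c)"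
      by (simp only: La[symmetric] power2_norm_eq_inner)
    also have "\<dots> = (\<Sum>b\<in>B'. \<Sum>c\<in>B'. g a b * g a c * (L b \<bullet> L c))"
      by (subst inner_sum_left) (simp add: inner_sum_right mult_ac)
    finally show "(norm (L a))\<^sup>2 = (\<Sum>b\<in>B'. \<Sum>c\<in>B'. g a b * g a c * (L b \<bullet> L c))" .
  qed simp
  also have "\<dots> = (\<Sum>b\<in>B'. \<Sum>c\<in>B'. \<Sum>a\<in>B. g a b * g a c * (L b \<bullet> L c))"
    by (subst sum.swap, rule sum.cong, simp, subst sum.swap, simp)
  also have "\<dots> = (\<Sum>b\<in>B'. \<Sum>c\<in>B'. g b c * (L b \<bullet> L c))"
    by (simp add: gg flip: sum_distrib_right)
  also have "\<dots> = (\<Sum>b\<in>B'. (norm (L b))\<^sup>2)"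
  proof (rule sum.cong)
    fix b assume "b \<in> B'"
    have "(\<Sum>c\<in>B'. g b c * (L b \<bullet> L c)) = L b \<bullet> L b"
      by (subst (3) La) (simp add: inner_sum_right)
    then show "(\<Sum>c\<in>B'. g b c * (L b \<bullet> L c)) = (norm (L b))\<^sup>2"
      by (simp add: power2_norm_eq_inner)
  qed simp
  finally show ?thesis .
qed

lemma normal_part_eqI:
  assumes lin: "linear (dX X x)"
    and n: "n \<in> (tangent_space X x)\<^sup>\<bottom>" "w - n \<in> tangent_space X x"
  shows "normal_part X x w = n"
  unfolding normal_part_def
proof (rule the_equality)
  fix n' assume n': "n' \<in> (tangent_space X x)\<^sup>\<bottom> \<and> w - n' \<in> tangent_space X x"
  have "subspace (tangent_space X x)"
    unfolding tangent_space_def using lin by (intro linear_subspace_image) auto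
  then have "(w - n) - (w - n') \<in> tangent_space X x"
    using n n' by (blast intro: subspace_diff)
  then have "n' - n \<in> tangent_space X x" by simp
  moreover have "n' - n \<in> (tangent_space X x)\<^sup>\<bottom>"
    using n n' by (auto intro: subspace_diff subspace_orthogonal_comp)
  ultimately have "(n' - n) \<bullet> (n' - n) = 0"
    unfolding orthogonal_comp_def orthogonal_def by simp
  then show "n' = n" by simp
qed (use n in auto)

text \<open>A permutation other than the identity moves some basis vector, and the factor at that
  vector vanishes.\<close>

lemma gram_det_orthogonal:
  fixes X :: "'a::euclidean_space \<Rightarrow> 'b::euclidean_space"
  assumes "\<And>b c. b \<in> Basis \<Longrightarrow> c \<in> Basis \<Longrightarrow> b \<noteq> c \<Longrightarrow> dX X x b \<bullet> dX X x c = 0"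
  shows "gram_det X x = (\<Prod>b\<in>Basis. (norm (dX X x b))\<^sup>2)"
proof -
  let ?S = "{p. p permutes (Basis :: 'a set)}"
  let ?t = "\<lambda>p. of_int (sign p) * (\<Prod>b\<in>Basis. dX X x b \<bullet> dX X x (p b)) :: real"
  have "gram_det X x = (\<Sum>p\<in>{id}. ?t p)"
    unfolding gram_det_def
  proof (rule sum.mono_neutral_right)
    show "\<forall>p\<in>?S - {id}. ?t p = 0"
    proof
      fix p assume p: "p \<in> ?S - {id}"
      then obtain b where b: "p b \<noteq> b" by (auto simp: fun_eq_iff)
      then have "b \<in> Basis" using p by (auto simp: permutes_def)
      moreover have "p b \<in> Basis" using p \<open>b \<in> Basis\<close> by (auto simp: permutes_in_image)
      ultimately have "dX X x b \<bullet> dX X x (p b) = 0" using b assms by metis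
      with \<open>b \<in> Basis\<close> show "?t p = 0" by (auto intro!: prod_zero)
    qed
  qed (auto intro: finite_permutations permutes_id)
  then show ?thesis by (simp add: power2_norm_eq_inner)
qed

text \<open>Coordinates turning with the axis: the vector a + i b rotated by e^(is). The real part
  \<open>a\<close> points along the rulings, the imaginary part \<open>b\<close> is perpendicular to
  them, and rotation preserves inner products, so the geometry no longer depends on
  \<open>s\<close>.\<close>

definition twist :: "real \<Rightarrow> real^'k::finite \<Rightarrow> real^'k \<Rightarrow> complex^'k" where
  "twist s a b = (\<chi> j. (of_real (a $ j) + \<i> * of_real (b $ j)) * cis s)"

lemma twist_add: "twist s a b + twist s c d = twist s (a + c) (b + d)"
  and twist_diff: "twist s a b - twist s c d = twist s (a - c) (b - d)"
  and twist_scaleR: "r *\<^sub>R twist s a b = twist s (r *\<^sub>R a) (r *\<^sub>R b)"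
  and twist_zero [simp]: "twist s 0 0 = 0"
  by (simp_all add: twist_def vec_eq_iff complex_eq_iff algebra_simps)

lemma inner_cis_mult: "(z * cis s) \<bullet> (z' * cis s) = z \<bullet> z'"
  using sin_cos_squared_add[of s] unfolding inner_complex_def by (simp, algebra)

lemma inner_twist: "twist s a b \<bullet> twist s c d = a \<bullet> c + b \<bullet> d"
  unfolding twist_def inner_vec_def vec_lambda_beta inner_cis_mult
  by (simp add: inner_complex_def sum.distrib)

lemma twist_inverse:
  "twist s (\<chi> j. Re (z $ j * cis (- s))) (\<chi> j. Im (z $ j * cis (- s))) = z"
  unfolding twist_def vec_eq_iff vec_lambda_beta complex_eq[symmetric]
  by (simp add: mult.assoc cis_mult)

lemma helicoid_eq: "helicoid x = (twist (snd x) (fst x) 0, snd x)"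
  by (cases x) (simp add: helicoid_def twist_def vec_eq_iff cis_conv_exp)

text \<open>Turning the coordinates adds multiplication by i, which sends (a, b) to (-b, a).\<close>

lemma has_derivative_twist:
  assumes a: "(a has_derivative a') (at x)" and b: "(b has_derivative b') (at x)"
    and s: "(s has_derivative s') (at x)"
  shows "((\<lambda>x. twist (s x) (a x) (b x)) has_derivative
    (\<lambda>v. twist (s x) (a' v - s' v *\<^sub>R b x) (b' v + s' v *\<^sub>R a x))) (at x)"
proof -
  have "((\<lambda>x. (of_real (a x $ j) + \<i> * of_real (b x $ j)) * cis (s x)) has_derivative
     (\<lambda>v. (of_real (a' v $ j) + \<i> * of_real (b' v $ j)) * cis (s x)
        + (of_real (a x $ j) + \<i> * of_real (b x $ j)) * (s' v *\<^sub>R (\<i> * cis (s x))))) (at x)" for j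
    by (rule derivative_eq_intros a b s bounded_linear.has_derivative[OF bounded_linear_vec_nth] refl
        | simp add: algebra_simps fun_eq_iff)+
  then have comp: "((\<lambda>x. twist (s x) (a x) (b x) $ j) has_derivative
      (\<lambda>v. twist (s x) (a' v - s' v *\<^sub>R b x) (b' v + s' v *\<^sub>R a x) $ j)) (at x)" for j
    unfolding twist_def vec_lambda_beta
    by (rule has_derivative_eq_rhs)
      (simp add: fun_eq_iff complex_eq_iff algebra_simps)
  show ?thesis
  proof (subst has_derivative_componentwise_within, rule)
    fix i :: "complex^'b" assume "i \<in> Basis"
    then obtain j c where i: "i = axis j c" by (auto simp: Basis_vec_def)
    show "((\<lambda>x. twist (s x) (a x) (b x) \<bullet> i) has_derivative
      (\<lambda>v. twist (s x) (a' v - s' v *\<^sub>R b x) (b' v + s' v *\<^sub>R a x) \<bullet> i)) (at x)"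
      unfolding i inner_axis by (rule has_derivative_inner_left[OF comp])
  qed
qed

lemma dX_helicoid: "dX helicoid (u, s) = (\<lambda>(v, t). (twist s v (t *\<^sub>R u), t))"
proof -
  have "(helicoid has_derivative (\<lambda>w. (twist (snd (u, s)) (fst w - snd w *\<^sub>R 0) (0 + snd w *\<^sub>R fst (u, s)), snd w))) (at (u, s))"
    unfolding helicoid_eq[abs_def]
    by (intro has_derivative_Pair has_derivative_twist has_derivative_fst has_derivative_snd
        has_derivative_const has_derivative_ident)
  from frechet_derivative_at[OF this] show ?thesis
    by (simp add: dX_def fun_eq_iff)
qed

lemma dX_helicoid_inner: "dX helicoid (u, s) (v, t) \<bullet> dX helicoid (u, s) (v', t') = v \<bullet> v' + (1 + u \<bullet> u) * t * t'"
  by (simp add: dX_helicoid inner_twist algebra_simps)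

lemma linear_dX_helicoid: "linear (dX helicoid (u, s))"
  by (auto intro!: linearI simp: dX_helicoid twist_add twist_scaleR algebra_simps)

lemma normal_space_helicoid_iff:
  "(twist s p q, c) \<in> (tangent_space helicoid (u, s))\<^sup>\<bottom> \<longleftrightarrow> p = 0 \<and> c = - (q \<bullet> u)"
proof -
  have "(twist s p q, c) \<in> (tangent_space helicoid (u, s))\<^sup>\<bottom> \<longleftrightarrow>
    (\<forall>v t. v \<bullet> p + t * (u \<bullet> q + c) = 0)"
    by (auto simp: orthogonal_comp_def tangent_space_def orthogonal_def dX_helicoid inner_twist
        algebra_simps)
  also have "\<dots> \<longleftrightarrow> p \<bullet> p = 0 \<and> u \<bullet> q + c = 0"
  proof
    assume *: "\<forall>v t. v \<bullet> p + t * (u \<bullet> q + c) = 0"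
    show "p \<bullet> p = 0 \<and> u \<bullet> q + c = 0"
      using *[rule_format, of p 0] *[rule_format, of 0 1] by simp
  qed simp
  finally show ?thesis by (auto simp: inner_commute)
qed

text \<open>The component \<open>p\<close> is tangent to the rulings and drops out. What remains is
  projected off the axial tangent vector (i u e^(is), 1), of squared length 1 + |u|^2;
  \<open>\<tau>\<close> is its coefficient.\<close>

lemma normal_part_helicoid:
  defines "\<tau> \<equiv> \<lambda>u q c. (q \<bullet> u + c) / (1 + u \<bullet> u)"
  shows "normal_part helicoid (u, s) (twist s p q, c) = (twist s 0 (q - \<tau> u q c *\<^sub>R u), c - \<tau> u q c)"
proof (rule normal_part_eqI[OF linear_dX_helicoid])
  have "1 + u \<bullet> u > 0" by (simp add: add_pos_nonneg)
  then show "(twist s 0 (q - \<tau> u q c *\<^sub>R u), c - \<tau> u q c) \<in> (tangent_space helicoid (u, s))\<^sup>\<bottom>"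
    unfolding normal_space_helicoid_iff by (simp add: \<tau>_def field_simps inner_diff_left)
  show "(twist s p q, c) - (twist s 0 (q - \<tau> u q c *\<^sub>R u), c - \<tau> u q c) \<in> tangent_space helicoid (u, s)"
    unfolding tangent_space_def
    by (rule range_eqI[of _ _ "(p, \<tau> u q c)"]) (simp add: dX_helicoid twist_diff)
qed

lemma norm_normal_part_helicoid:
  "(norm (normal_part helicoid (u, s) (twist s p q, c)))\<^sup>2 = q \<bullet> q + c\<^sup>2 - (q \<bullet> u + c)\<^sup>2 / (1 + u \<bullet> u)"
proof -
  define t where "t = (q \<bullet> u + c) / (1 + u \<bullet> u)"
  have "1 + u \<bullet> u > 0" by (simp add: add_pos_nonneg)
  then have t: "t * (1 + u \<bullet> u) = q \<bullet> u + c" by (simp add: t_def)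
  have "(norm (normal_part helicoid (u, s) (twist s p q, c)))\<^sup>2
      = (q - t *\<^sub>R u) \<bullet> (q - t *\<^sub>R u) + (c - t)\<^sup>2"
    by (simp add: normal_part_helicoid norm_Pair power2_norm_eq_inner inner_twist flip: t_def)
  also have "\<dots> = q \<bullet> q + c\<^sup>2 - 2 * t * (q \<bullet> u + c) + t * (t * (1 + u \<bullet> u))"
    by (simp add: inner_diff_left inner_diff_right inner_commute[of u q] power2_eq_square algebra_simps)
  also have "\<dots> = q \<bullet> q + c\<^sup>2 - (q \<bullet> u + c) * t"
    unfolding t by (simp add: algebra_simps)
  finally show ?thesis by (simp add: t_def power2_eq_square)
qed

text \<open>The coordinate tangent vectors are already orthogonal; only the axial one, of length
  sqrt (1 + |u|^2), has to be normalised.\<close>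

definition helicoid_frame :: "real^'k::finite \<Rightarrow> ((real^'k) \<times> real) set" where
  "helicoid_frame u = insert (0, 1 / sqrt (1 + u \<bullet> u)) ((\<lambda>j. (axis j 1, 0)) ` UNIV)"

lemma sum_helicoid_frame:
  "(\<Sum>a\<in>helicoid_frame u. f a) = (\<Sum>j\<in>UNIV. f (axis j 1, 0)) + f (0, 1 / sqrt (1 + u \<bullet> u))"
proof -
  have "(\<Sum>a\<in>(\<lambda>j. (axis j 1, 0)) ` UNIV. f a) = (\<Sum>j\<in>UNIV. f (axis j 1, 0))"
    by (subst sum.reindex) (auto simp: inj_on_def axis_eq_axis)
  then show ?thesis
    unfolding helicoid_frame_def by (subst sum.insert) (auto simp: axis_eq_0_iff add.commute)
qed

lemma orthonormal_helicoid_frame: "orthonormal_frame helicoid (u, s) (helicoid_frame u)"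
proof -
  have p: "1 + u \<bullet> u > 0" by (simp add: add_pos_nonneg)
  have "card (helicoid_frame u) = (\<Sum>a\<in>helicoid_frame u. 1)" by simp
  also have "\<dots> = DIM((real^'a) \<times> real)"
    unfolding sum_helicoid_frame by simp
  finally have "card (helicoid_frame u) = DIM((real^'a) \<times> real)" .
  moreover have "dX helicoid (u, s) a \<bullet> dX helicoid (u, s) b = (if a = b then 1 else 0)"
    if "a \<in> helicoid_frame u" "b \<in> helicoid_frame u" for a b
  proof -
    define r where "r = 1 / sqrt (1 + u \<bullet> u)"
    have "(1 + u \<bullet> u) * r * r = 1" using p by (simp add: r_def)
    then show ?thesis
      using that unfolding helicoid_frame_def r_def[symmetric]
      by (auto simp: dX_helicoid_inner inner_axis_axis axis_eq_axis axis_eq_0_iff split: if_splits)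
  qed
  moreover have "finite (helicoid_frame u)" by (simp add: helicoid_frame_def)
  ultimately show ?thesis unfolding orthonormal_frame_def by blast
qed

lemma frame_helicoid: "orthonormal_frame helicoid x (frame helicoid x)"
  unfolding frame_def
  by (rule someI[of _ "helicoid_frame (fst x)"]) (use orthonormal_helicoid_frame[of "fst x" "snd x"] in simp)

lemma gram_det_helicoid: "gram_det helicoid (u, s) = 1 + u \<bullet> u"
proof -
  have "(\<Prod>b\<in>Basis. (norm (dX helicoid (u, s) b))\<^sup>2) = 1 + u \<bullet> u"
    unfolding Basis_prod_def
    by (subst prod.union_disjoint)
      (auto simp: prod.reindex inj_on_def power2_norm_eq_inner dX_helicoid_inner)
  moreover have "dX helicoid (u, s) b \<bullet> dX helicoid (u, s) c = 0"
    if "b \<in> Basis" "c \<in> Basis" "b \<noteq> c" for b c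
    using that by (auto simp: Basis_prod_def dX_helicoid_inner inner_Basis split: if_splits)
  ultimately show ?thesis by (simp add: gram_det_orthogonal)
qed

section \<open>The second variation in terms of \<open>y\<close>\<close>

definition normal_field ::
    "((real^'k::finite) \<times> real \<Rightarrow> real^'k) \<Rightarrow> (real^'k) \<times> real \<Rightarrow> (complex^'k) \<times> real" where
  "normal_field Y x = (twist (snd x) 0 (Y x), - (Y x \<bullet> fst x))"

text \<open>\<open>D j\<close> stands for the derivative of \<open>y\<close> in direction u_j and
  \<open>e\<close> for that in s, so \<open>D j \<bullet> u + y $ j\<close> is the derivative of h.
  The constant 3 is 1 from the normal connection plus 2 from the second fundamental form.\<close>

definition helicoid_density ::
    "real^'k::finite \<Rightarrow> real^'k \<Rightarrow> ('k \<Rightarrow> real^'k) \<Rightarrow> real^'k \<Rightarrow> real" where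
  "helicoid_density u y D e =
     ((\<Sum>j\<in>UNIV. (norm (D j))\<^sup>2 + (D j \<bullet> u + y $ j)\<^sup>2) + ((norm e)\<^sup>2 + (e \<bullet> u)\<^sup>2) / (1 + u \<bullet> u)
      - 3 * (norm y)\<^sup>2 / (1 + u \<bullet> u)) * sqrt (1 + u \<bullet> u)"

lemma norm_vec_power2: "(norm (x :: real^'n))\<^sup>2 = (\<Sum>j\<in>UNIV. (x $ j)\<^sup>2)"
  by (simp add: power2_norm_eq_inner inner_vec_def power2_eq_square[symmetric])

lemma normal_conn_normal_field:
  assumes Y: "(Y has_derivative Y') (at (u, s))"
  defines "y \<equiv> Y (u, s)"
  shows "normal_conn helicoid (normal_field Y) (u, s) a =
    normal_part helicoid (u, s) (twist s (- (snd a *\<^sub>R y)) (Y' a), - (Y' a \<bullet> u + y \<bullet> fst a))"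
proof -
  have "(normal_field Y has_derivative
    (\<lambda>a. (twist (snd (u, s)) (0 - snd a *\<^sub>R Y (u, s)) (Y' a + snd a *\<^sub>R 0),
        - (Y (u, s) \<bullet> fst a + Y' a \<bullet> fst (u, s))))) (at (u, s))"
    unfolding normal_field_def[abs_def]
    by (intro has_derivative_Pair has_derivative_twist has_derivative_fst has_derivative_snd
        has_derivative_minus has_derivative_inner has_derivative_const has_derivative_ident Y)
  from frechet_derivative_at[OF this, symmetric] show ?thesis
    by (simp add: normal_conn_def y_def add.commute)
qed

text \<open>Only the mixed second derivatives of the parametrization have a normal part: the rulings
  are straight, and the second derivative in s points along -u e^(is), which is tangent.\<close>

lemma second_fund_form_helicoid_inner:
  "second_fund_form helicoid (u, s) a b \<bullet> normal_field Y (u, s) =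
    (snd b *\<^sub>R fst a + snd a *\<^sub>R fst b) \<bullet> Y (u, s)"
proof -
  have "((\<lambda>x. dX helicoid x b) has_derivative
     (\<lambda>a. (twist (snd (u, s)) (0 - snd a *\<^sub>R (snd b *\<^sub>R fst (u, s))) (snd b *\<^sub>R fst a + snd a *\<^sub>R fst b), 0)))
     (at (u, s))"
  proof -
    have eq: "dX helicoid = (\<lambda>x b. (twist (snd x) (fst b) (snd b *\<^sub>R fst x), snd b))"
      by (auto simp: fun_eq_iff dX_helicoid)
    show ?thesis unfolding eq
      by (intro has_derivative_Pair has_derivative_twist has_derivative_fst has_derivative_snd
        has_derivative_scaleR_right has_derivative_const has_derivative_ident)
  qed
  from frechet_derivative_at[OF this, symmetric] show ?thesis
    by (simp add: second_fund_form_def normal_part_helicoid normal_field_def inner_twist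
        inner_diff_left inner_commute algebra_simps add_divide_distrib diff_divide_distrib)
qed

lemma sum_second_fund_form_helicoid:
  "(\<Sum>a\<in>frame helicoid (u, s). \<Sum>b\<in>frame helicoid (u, s).
      (second_fund_form helicoid (u, s) a b \<bullet> normal_field Y (u, s))\<^sup>2)
    = 2 * (norm (Y (u, s)))\<^sup>2 / (1 + u \<bullet> u)"
proof -
  define \<beta> where "\<beta> a b = (snd b *\<^sub>R fst a + snd a *\<^sub>R fst b) \<bullet> Y (u, s)" for a b :: "(real^'a) \<times> real"
  let ?F = "frame helicoid (u, s)" and ?H = "helicoid_frame u"
  have p: "1 + u \<bullet> u > 0" by (simp add: add_pos_nonneg)
  have lin: "linear (\<beta> a)" "linear (\<lambda>a. \<beta> a b)" for a b
    by (auto intro!: linearI simp: \<beta>_def inner_add_left algebra_simps)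
  have sum_eq: "(\<Sum>a\<in>?F. (f a)\<^sup>2) = (\<Sum>a\<in>?H. (f a)\<^sup>2)" if "linear f" for f :: "_ \<Rightarrow> real"
    using orthonormal_frame_sum_eq[OF frame_helicoid orthonormal_helicoid_frame linear_dX_helicoid that]
    by simp
  \<comment> \<open>By bilinearity the unspecified frame is replaced in one slot at a time.\<close>
  have "(\<Sum>a\<in>?F. \<Sum>b\<in>?F. (\<beta> a b)\<^sup>2) = (\<Sum>a\<in>?F. \<Sum>b\<in>?H. (\<beta> a b)\<^sup>2)"
    by (simp add: sum_eq lin)
  also have "\<dots> = (\<Sum>b\<in>?H. \<Sum>a\<in>?H. (\<beta> a b)\<^sup>2)"
    by (subst sum.swap) (simp add: sum_eq lin)
  \<comment> \<open>The factor 2 counts both orders of a mixed pair; the normalised axial vector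
    gives the denominator.\<close>
  also have "\<dots> = 2 * (\<Sum>j\<in>UNIV. (Y (u, s) $ j)\<^sup>2 / (1 + u \<bullet> u))"
    unfolding sum_helicoid_frame using p
    by (simp add: \<beta>_def inner_axis' power_divide)
  also have "\<dots> = 2 * (norm (Y (u, s)))\<^sup>2 / (1 + u \<bullet> u)"
    by (simp add: norm_vec_power2 flip: sum_divide_distrib)
  finally show ?thesis
    by (simp add: second_fund_form_helicoid_inner \<beta>_def)
qed

lemma sum_normal_conn_helicoid:
  assumes Y: "(Y has_derivative Y') (at (u, s))"
  defines "y \<equiv> Y (u, s)"
  shows "(\<Sum>a\<in>frame helicoid (u, s). (norm (normal_conn helicoid (normal_field Y) (u, s) a))\<^sup>2)
    = (\<Sum>j\<in>UNIV. (norm (Y' (axis j 1, 0)))\<^sup>2 + (Y' (axis j 1, 0) \<bullet> u + y $ j)\<^sup>2)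
      + ((norm (Y' (0, 1)))\<^sup>2 + (Y' (0, 1) \<bullet> u)\<^sup>2) / (1 + u \<bullet> u) - (norm y)\<^sup>2 / (1 + u \<bullet> u)"
proof -
  define L where "L = normal_conn helicoid (normal_field Y) (u, s)"
  have p: "1 + u \<bullet> u > 0" by (simp add: add_pos_nonneg)
  have Y': "linear Y'" using Y by (rule has_derivative_linear)
  have "linear L"
    by (rule linearI) (simp_all add: L_def normal_conn_normal_field[OF Y] normal_part_helicoid
        twist_add twist_scaleR linear_add[OF Y'] linear_cmul[OF Y'] inner_add_left inner_add_right
        algebra_simps add_divide_distrib diff_divide_distrib)
  then have "(\<Sum>a\<in>frame helicoid (u, s). (norm (L a))\<^sup>2) = (\<Sum>a\<in>helicoid_frame u. (norm (L a))\<^sup>2)"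
    by (rule orthonormal_frame_sum_eq[OF frame_helicoid orthonormal_helicoid_frame linear_dX_helicoid])
  \<comment> \<open>In direction u_j the ambient derivative of V has a tangential part along the
    axial unit vector, whose square is subtracted. In the axial direction the only tangential part
    is the term -y along the rulings, already removed by the projection.\<close>
  also have "\<dots> = (\<Sum>j\<in>UNIV. (norm (Y' (axis j 1, 0)))\<^sup>2 + (Y' (axis j 1, 0) \<bullet> u + y $ j)\<^sup>2
        - (y $ j)\<^sup>2 / (1 + u \<bullet> u))
      + ((norm (Y' (0, 1 / sqrt (1 + u \<bullet> u))))\<^sup>2 + (Y' (0, 1 / sqrt (1 + u \<bullet> u)) \<bullet> u)\<^sup>2)"
    unfolding sum_helicoid_frame L_def normal_conn_normal_field[OF Y] norm_normal_part_helicoid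
    by (simp add: y_def[symmetric] inner_axis dot_square_norm power2_eq_square algebra_simps)
  also have "Y' (0, 1 / sqrt (1 + u \<bullet> u)) = (1 / sqrt (1 + u \<bullet> u)) *\<^sub>R Y' (0, 1)"
    by (simp flip: linear_cmul[OF Y'])
  also have "(\<Sum>j\<in>UNIV. (norm (Y' (axis j 1, 0)))\<^sup>2 + (Y' (axis j 1, 0) \<bullet> u + y $ j)\<^sup>2
        - (y $ j)\<^sup>2 / (1 + u \<bullet> u)) =
      (\<Sum>j\<in>UNIV. (norm (Y' (axis j 1, 0)))\<^sup>2 + (Y' (axis j 1, 0) \<bullet> u + y $ j)\<^sup>2)
        - (norm y)\<^sup>2 / (1 + u \<bullet> u)"
    by (simp add: sum_subtractf norm_vec_power2[of y] sum_divide_distrib)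
  finally show ?thesis
    using p by (simp add: L_def power_mult_distrib power_divide add_divide_distrib)
qed

lemma second_variation_normal_field:
  assumes Y: "C_diff 1 Y"
  shows "second_variation helicoid (normal_field Y) = (LINT x|lborel. helicoid_density (fst x) (Y x)
     (\<lambda>j. frechet_derivative Y (at x) (axis j 1, 0)) (frechet_derivative Y (at x) (0, 1)))"
  unfolding second_variation_def
proof (rule Bochner_Integration.integral_cong[OF refl], safe)
  fix u s
  have "C_diff (Suc 0) Y" using Y by simp
  from C_diff_SucD(1)[OF this]
  have "(Y has_derivative frechet_derivative Y (at (u, s))) (at (u, s))" .
  from sum_normal_conn_helicoid[OF this]
  show "((\<Sum>a\<in>frame helicoid (u, s). (norm (normal_conn helicoid (normal_field Y) (u, s) a))\<^sup>2)
      - (\<Sum>a\<in>frame helicoid (u, s). \<Sum>b\<in>frame helicoid (u, s).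
          (second_fund_form helicoid (u, s) a b \<bullet> normal_field Y (u, s))\<^sup>2))
     * sqrt (gram_det helicoid (u, s))
    = helicoid_density (fst (u, s)) (Y (u, s))
     (\<lambda>j. frechet_derivative Y (at (u, s)) (axis j 1, 0)) (frechet_derivative Y (at (u, s)) (0, 1))"
    by (simp add: sum_second_fund_form_helicoid gram_det_helicoid helicoid_density_def)
qed

lemma normal_field_eq_0_iff [simp]: "normal_field Y x = 0 \<longleftrightarrow> Y x = 0"
proof
  assume "normal_field Y x = 0"
  then have "normal_field Y x \<bullet> normal_field Y x = 0" by simp
  then have "Y x \<bullet> Y x + (Y x \<bullet> fst x)\<^sup>2 = 0"
    by (simp add: normal_field_def inner_twist power2_eq_square)
  then show "Y x = 0" by (simp add: add_nonneg_eq_0_iff)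
qed (simp add: normal_field_def zero_prod_def)

lemma C_diff_vec_nth: "C_diff n f \<Longrightarrow> C_diff n (\<lambda>x. f x $ j)"
  by (rule C_diff_bounded_linear[OF bounded_linear_vec_nth])

lemma C_diff_vec_lambda:
  fixes f :: "'a::euclidean_space \<Rightarrow> 'k::finite \<Rightarrow> 'b::euclidean_space"
  assumes "\<And>j. C_diff n (\<lambda>x. f x j)"
  shows "C_diff n (\<lambda>x. \<chi> j. f x j)"
proof -
  have bl: "bounded_linear (\<lambda>y. axis j y :: 'b^'k)" for j
    unfolding linear_conv_bounded_linear[symmetric] by (rule linearI) (auto simp: axis_def vec_eq_iff)
  have "(\<lambda>x. \<chi> j. f x j) = (\<lambda>x. \<Sum>j\<in>UNIV. axis j (f x j))"
    by (simp add: fun_eq_iff vec_eq_iff axis_def)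
  then show ?thesis
    using assms by (auto intro!: C_diff_sum C_diff_bounded_linear[OF bl])
qed

text \<open>\<open>Y\<close> is recovered by rotating back by e^(-is) and taking imaginary parts, a
  smooth operation, so smoothness and support pass in both directions.\<close>

lemma compactly_supported_normal_field_helicoid_iff:
  fixes V :: "(real^'k::finite) \<times> real \<Rightarrow> (complex^'k) \<times> real"
  shows "compactly_supported_normal_field helicoid V \<longleftrightarrow>
    (\<exists>Y. V = normal_field Y \<and> smooth Y \<and> compact (closure {x. Y x \<noteq> 0}))"
proof (intro iffI; (elim exE conjE)?)
  fix Y :: "(real^'k) \<times> real \<Rightarrow> real^'k"
  assume V: "V = normal_field Y" and Y: "smooth Y" and c: "compact (closure {x. Y x \<noteq> 0})"
  have "C_diff n (normal_field Y)" for n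
  proof -
    have Yn: "C_diff n Y" using Y by (simp add: smooth_def)
    have "C_diff n (\<lambda>x. ((\<chi> j. (of_real 0 + \<i> * of_real (Y x $ j)) * cis (snd x)), - (Y x \<bullet> fst x)))"
      by (intro C_diff_Pair C_diff_minus C_diff_inner C_diff_vec_lambda C_diff_mult C_diff_add
          C_diff_const C_diff_cis C_diff_vec_nth Yn C_diff_linear bounded_linear_fst
          bounded_linear_snd C_diff_bounded_linear[OF bounded_linear_of_real])
    then show ?thesis by (simp add: normal_field_def[abs_def] twist_def)
  qed
  moreover have "normal_field Y x \<in> (tangent_space helicoid x)\<^sup>\<bottom>" for x
    by (cases x) (simp add: normal_field_def normal_space_helicoid_iff)
  ultimately show "compactly_supported_normal_field helicoid V"
    using c by (simp add: compactly_supported_normal_field_def V smooth_def)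
next
  assume V: "compactly_supported_normal_field helicoid V"
  define Y where "Y x = (\<chi> j. Im (fst (V x) $ j * cis (- snd x)))" for x
  have eq: "V = normal_field Y"
  proof
    fix x :: "(real^'k) \<times> real"
    obtain u s where x: "x = (u, s)" by (cases x)
    define X where "X = (\<chi> j. Re (fst (V x) $ j * cis (- snd x)))"
    have "V x = (twist s X (Y x), snd (V x))"
      using twist_inverse[of s "fst (V x)"] by (simp add: X_def Y_def x prod_eq_iff)
    moreover have "V x \<in> (tangent_space helicoid (u, s))\<^sup>\<bottom>"
      using V by (simp add: compactly_supported_normal_field_def x)
    ultimately have "X = 0 \<and> snd (V x) = - (Y x \<bullet> u)"
      using normal_space_helicoid_iff by metis
    with \<open>V x = _\<close> show "V x = normal_field Y x"
      by (simp add: normal_field_def x)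
  qed
  moreover have "C_diff n Y" for n
  proof -
    have Vn: "C_diff n V" using V by (simp add: smooth_def compactly_supported_normal_field_def)
    show ?thesis unfolding Y_def[abs_def]
      by (intro C_diff_vec_lambda C_diff_bounded_linear[OF bounded_linear_Im] C_diff_mult C_diff_cis
          C_diff_minus C_diff_linear bounded_linear_snd C_diff_vec_nth
          C_diff_bounded_linear[OF bounded_linear_fst Vn])
  qed
  ultimately show "\<exists>Y. V = normal_field Y \<and> smooth Y \<and> compact (closure {x. Y x \<noteq> 0})"
    using V by (auto simp: compactly_supported_normal_field_def smooth_def)
qed

section \<open>Stability\<close>

definition outer :: "real^'n \<Rightarrow> real^'m \<Rightarrow> real^'m^'n" where
  "outer a b = (\<chi> i j. a $ i * b $ j)"

lemma inner_outer: "M \<bullet> outer a b = a \<bullet> (M *v b)" "outer a b \<bullet> M = a \<bullet> (M *v b)"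
  by (simp_all add: outer_def inner_vec_def matrix_vector_mult_def sum_distrib_left mult_ac)

lemma outer_mult_vec: "outer a b *v c = (b \<bullet> c) *\<^sub>R a"
  by (simp add: outer_def inner_vec_def matrix_vector_mult_def vec_eq_iff sum_distrib_right
      sum_distrib_left mult_ac)

lemma transpose_outer [simp]: "transpose (outer a b) = outer b a"
  by (simp add: outer_def transpose_def vec_eq_iff mult.commute)

lemma inner_transpose: "transpose A \<bullet> transpose B = A \<bullet> (B :: real^'n^'m)"
  unfolding inner_vec_def transpose_def by (simp, rule sum.swap)

lemma transpose_add: "transpose (A + B) = transpose A + transpose (B :: real^'n^'m)"
  and transpose_diff: "transpose (A - B) = transpose A - transpose (B :: real^'n^'m)"
  by (simp_all add: transpose_def vec_eq_iff)

lemma inner_mat_1: "M \<bullet> mat 1 = trace (M :: real^'n^'n)"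
  by (simp add: inner_vec_def trace_def mat_def if_distrib cong: if_cong)

lemma inner_mult_vec_transpose: "a \<bullet> (M *v b) = (transpose M *v a) \<bullet> (b :: real^'n)"
  by (metis dot_lmul_matrix transpose_matrix_vector)

text \<open>
  A matrix annihilated on both sides by a unit vector \<open>n\<close> acts on the orthogonal complement of
  \<open>n\<close>, of dimension \<open>CARD('k) - 1\<close>.  Subtracting the trace part \<open>c (1 - n n\<^sup>T)\<close> from the
  symmetric part gives the estimate.
\<close>
lemma tangential_matrix_ineq:
  fixes N :: "real^'k^'k" and n :: "real^'k" and m \<theta> :: real
  assumes n: "n \<bullet> n = 1" and N: "n \<bullet> (N *v n) = 0" 
    and m: "m = real CARD('k) - 1" "m > 0" and \<theta>: "0 \<le> \<theta>" "\<theta> \<le> 1"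
  shows "(1 + \<theta>) * (trace N)\<^sup>2 / m \<le> N \<bullet> N + \<theta> * (N \<bullet> transpose N)"
proof -
  define c where "c = trace N / m"
  let ?T = "transpose N"
  define P where "P = mat 1 - outer n n"
  have "trace (outer n n) = 1" using n by (simp add: inner_outer flip: inner_mat_1)
  then have PP: "P \<bullet> P = m"
    by (simp add: P_def inner_diff_left inner_diff_right inner_outer outer_mult_vec n m inner_mat_1
        matrix_vector_mult_diff_rdistrib trace_I trace_sub)
  have NP: "N \<bullet> P = trace N"
    using N by (simp add: P_def inner_diff_right inner_outer inner_mat_1)
  then have TP: "?T \<bullet> P = trace N"
    using inner_transpose[of N P] by (simp add: P_def transpose_diff)
  have TT: "?T \<bullet> ?T = N \<bullet> N" by (rule inner_transpose)
  have "0 \<le> (N + ?T - (2 * c) *\<^sub>R P) \<bullet> (N + ?T - (2 * c) *\<^sub>R P)" by simp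
  also have "\<dots> = 2 * (N \<bullet> N) + 2 * (N \<bullet> ?T) - 8 * (c * trace N) + 4 * (c\<^sup>2 * m)"
    unfolding inner_diff_left inner_diff_right inner_add_left inner_add_right
      inner_scaleR_left inner_scaleR_right
    using PP NP TP TT by (simp add: inner_diff_left inner_diff_right inner_commute power2_eq_square algebra_simps)
  also have "c * trace N = (trace N)\<^sup>2 / m" by (simp add: c_def power2_eq_square)
  also have "c\<^sup>2 * m = (trace N)\<^sup>2 / m" using m(2) by (simp add: c_def power2_eq_square)
  finally have 1: "2 * ((trace N)\<^sup>2 / m) \<le> N \<bullet> N + N \<bullet> ?T" by simp
  have "0 \<le> (N - ?T) \<bullet> (N - ?T)" by simp
  also have "\<dots> = 2 * (N \<bullet> N) - 2 * (N \<bullet> ?T)"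
    using TT by (simp add: inner_diff_left inner_diff_right inner_commute)
  finally have 2: "0 \<le> N \<bullet> N - N \<bullet> ?T" by simp
  \<comment> \<open>Splitting into symmetric and antisymmetric energy. Since \<open>\<theta>\<close>
    is at most 1, the antisymmetric one has a nonnegative weight and is discarded.\<close>
  have "N \<bullet> N + \<theta> * (N \<bullet> ?T) = (1 + \<theta>) / 2 * (N \<bullet> N + N \<bullet> ?T) + (1 - \<theta>) / 2 * (N \<bullet> N - N \<bullet> ?T)"
    by (simp add: field_simps)
  also have "\<dots> \<ge> (1 + \<theta>) / 2 * (2 * ((trace N)\<^sup>2 / m)) + 0"
    using 1 2 \<theta> by (intro add_mono mult_left_mono mult_nonneg_nonneg) auto
  finally show ?thesis by simp
qed

text \<open>Here r = |u| and n = u / r; \<open>q\<close> and \<open>z\<close> are the radial and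
  tangential parts of y, \<open>x\<close> and \<open>\<alpha>\<close> those of its derivative along
  n, \<open>\<beta>\<close> is the tangential part of \<open>M *v n\<close>, and \<open>t\<close>
  the trace of the tangential block. The form decouples into the pairs (t, q), (x, q), (alpha, z),
  (beta, z), a square being completed in each; a multiple of |z|^2 is left over.\<close>

lemma stability_scalar_ineq:
  fixes r k t q x :: real and z \<alpha> \<beta> :: "'v::real_inner"
  assumes k: "k \<ge> 3"
  defines "\<sigma> \<equiv> 1 / (1 + r\<^sup>2)"
  defines "\<rho> \<equiv> r\<^sup>2 * \<sigma>"
  shows "0 \<le> \<sigma> * t\<^sup>2 / (k - 1) + x\<^sup>2 + \<alpha> \<bullet> \<alpha> + \<beta> \<bullet> \<beta> + (r * x + q)\<^sup>2 + r\<^sup>2 * (\<beta> \<bullet> \<beta>) + 2 * r * (\<beta> \<bullet> z) + z \<bullet> z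
    - 3 * \<sigma> * (q\<^sup>2 + z \<bullet> z) + \<sigma> * ((k - \<rho>) * (q\<^sup>2 * (1 + r\<^sup>2) + z \<bullet> z) + 2 * r * (q * x + \<alpha> \<bullet> z)
      + 2 * r ^ 3 * q * x + 2 * r\<^sup>2 * q\<^sup>2) + \<sigma> * r * (q * t - \<beta> \<bullet> z)"
    (is "0 \<le> ?I")
proof -
  have w: "1 + r\<^sup>2 > 0" by (simp add: add_pos_nonneg)
  have \<sigma>: "\<sigma> > 0" "\<sigma> \<le> 1" "\<sigma> * (1 + r\<^sup>2) = 1" using w by (auto simp: \<sigma>_def)
  have r2: "\<sigma> * r\<^sup>2 = 1 - \<sigma>" using \<sigma>(3) by (simp add: algebra_simps)
  have \<rho>: "\<rho> = 1 - \<sigma>" using r2 by (simp add: \<rho>_def mult.commute)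
  have k1: "k - 1 > 0" using k by simp
  \<comment> \<open>After completing the square in \<open>t\<close>, the coefficient of q^2 is at
    least k - 2 - (k - 1) / 4, positive for k >= 3.\<close>
  have A: "0 \<le> \<sigma> * t\<^sup>2 / (k - 1) + \<sigma> * r * q * t + (k - 2) * q\<^sup>2"
  proof -
    have "\<sigma> * t\<^sup>2 / (k - 1) + \<sigma> * r * q * t + (k - 2) * q\<^sup>2
      = \<sigma> / (k - 1) * (t + (k - 1) / 2 * r * q)\<^sup>2 + (k - 2 - (k - 1) / 4 * (\<sigma> * r\<^sup>2)) * q\<^sup>2"
      using k1 by (simp add: field_simps power2_eq_square)
    also have "\<dots> \<ge> 0"
    proof (intro add_nonneg_nonneg mult_nonneg_nonneg)
      have "(k - 1) / 4 * (1 - \<sigma>) \<le> (k - 1) / 4 * 1" using \<sigma> k1 by (intro mult_left_mono) auto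
      also have "\<dots> \<le> k - 2" using k by simp
      finally show "0 \<le> k - 2 - (k - 1) / 4 * (\<sigma> * r\<^sup>2)" unfolding r2 by simp
    qed (use \<sigma> k1 in auto)
    finally show ?thesis .
  qed
  have B: "0 \<le> \<sigma> * ((1 + r\<^sup>2) * x + 2 * r * q)\<^sup>2" using \<sigma> by simp
  \<comment> \<open>The Hardy square, pairing the radial derivative of the tangential part with that
    part itself.\<close>
  have C: "0 \<le> (\<alpha> + (\<sigma> * r) *\<^sub>R z) \<bullet> (\<alpha> + (\<sigma> * r) *\<^sub>R z)" by simp
  \<comment> \<open>The shift 1 - \<open>\<sigma>\<close> / 2 absorbs both products of beta with z:
    2 r from the derivative of h and -\<open>\<sigma>\<close> r from the null Lagrangian.\<close>
  have D: "0 \<le> \<sigma> * (((1 + r\<^sup>2) *\<^sub>R \<beta> + (r * (1 - \<sigma> / 2)) *\<^sub>R z) \<bullet> ((1 + r\<^sup>2) *\<^sub>R \<beta> + (r * (1 - \<sigma> / 2)) *\<^sub>R z))"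
    using \<sigma> by simp
  \<comment> \<open>The borderline term: its bracket tends to k - 3 at infinity, and for k = 3 it
    equals \<open>\<sigma>\<close> (1 - \<open>\<rho>\<close> / 4).\<close>
  have E: "0 \<le> \<sigma> * (k - 2 - \<rho> - \<rho> * \<sigma> / 4) * (z \<bullet> z)"
  proof -
    have "\<rho> * \<sigma> \<le> 1 * \<sigma>" using \<sigma> by (intro mult_right_mono) (auto simp: \<rho>)
    then have "0 \<le> k - 2 - \<rho> - \<rho> * \<sigma> / 4" using k \<sigma>(1) unfolding \<rho> by linarith
    then show ?thesis using \<sigma> by simp
  qed
  define aa az zz bb bz where ab: "aa = \<alpha> \<bullet> \<alpha>" "az = \<alpha> \<bullet> z" "zz = z \<bullet> z" "bb = \<beta> \<bullet> \<beta>" "bz = \<beta> \<bullet> z"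
  define T where "T = t\<^sup>2 / (k - 1)"
  have C': "(\<alpha> + (\<sigma> * r) *\<^sub>R z) \<bullet> (\<alpha> + (\<sigma> * r) *\<^sub>R z) = aa + 2 * \<sigma> * r * az + \<sigma> * (\<sigma> * r\<^sup>2) * zz"
    by (simp add: ab inner_add_left inner_add_right inner_commute[of z \<alpha>] power2_eq_square algebra_simps)
  have D': "\<sigma> * (((1 + r\<^sup>2) *\<^sub>R \<beta> + (r * (1 - \<sigma> / 2)) *\<^sub>R z) \<bullet> ((1 + r\<^sup>2) *\<^sub>R \<beta> + (r * (1 - \<sigma> / 2)) *\<^sub>R z))
    = (\<sigma> * (1 + r\<^sup>2)) * ((1 + r\<^sup>2) * bb + 2 * r * (1 - \<sigma> / 2) * bz) + (\<sigma> * r\<^sup>2) * (1 - \<sigma> / 2)\<^sup>2 * zz"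
    unfolding ab by (simp only: inner_add_left inner_add_right inner_commute[of z \<beta>] inner_scaleR_left 
        inner_scaleR_right power2_eq_square) algebra
  have "?I = (\<sigma> * T + \<sigma> * r * q * t + (k - 2) * q\<^sup>2) + \<sigma> * ((1 + r\<^sup>2) * x + 2 * r * q)\<^sup>2
     + (aa + 2 * \<sigma> * r * az + \<sigma> * (\<sigma> * r\<^sup>2) * zz)
     + ((\<sigma> * (1 + r\<^sup>2)) * ((1 + r\<^sup>2) * bb + 2 * r * (1 - \<sigma> / 2) * bz) + (\<sigma> * r\<^sup>2) * (1 - \<sigma> / 2)\<^sup>2 * zz)
     + \<sigma> * (k - 2 - \<rho> - \<rho> * \<sigma> / 4) * zz"
    unfolding ab[symmetric] times_divide_eq_right[symmetric] T_def[symmetric] \<rho> using r2 by algebra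
  also have "\<dots> \<ge> 0"
    using A B C D E unfolding C' D' by (simp add: T_def ab)
  finally show ?thesis .
qed

text \<open>The first line is the density without axial derivatives, the rest is the divergence of
  the correcting field, both divided by w. Decomposing along u / |u| reduces it to the scalar
  inequality and the trace inequality for the tangential block.\<close>

lemma stability_matrix_ineq:
  fixes M :: "real^'k^'k" and u y :: "real^'k"
  assumes card: "CARD('k) \<ge> 3"
  defines "k \<equiv> real CARD('k)" and "\<sigma> \<equiv> 1 / (1 + u \<bullet> u)"
  shows "0 \<le> M \<bullet> M + (M *v u + y) \<bullet> (M *v u + y) - 3 * \<sigma> * (y \<bullet> y)
    + \<sigma> * ((k - (u \<bullet> u) * \<sigma>) * (y \<bullet> y + (y \<bullet> u)\<^sup>2) + 2 * (y \<bullet> (transpose M *v u))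
      + 2 * (y \<bullet> u) * (u \<bullet> (M *v u)) + 2 * (y \<bullet> u)\<^sup>2)
    + \<sigma> * ((y \<bullet> u) * trace M - y \<bullet> (M *v u))
    - \<sigma> / (k - 2) * ((u \<bullet> u) * ((trace M)\<^sup>2 - M \<bullet> transpose M) - 2 * (u \<bullet> (M *v u)) * trace M
      + 2 * ((transpose M *v u) \<bullet> (M *v u)))"
    (is "0 \<le> ?I")
\<comment> \<open>On the axis there is no radial direction, but the form collapses to |M|^2 + (k -
  2) |y|^2.\<close>
proof (cases "u = 0")
  case True
  have "3 * (y \<bullet> y) \<le> k * (y \<bullet> y)" using card by (intro mult_right_mono) (auto simp: k_def)
  moreover have "0 \<le> M \<bullet> M" "0 \<le> y \<bullet> y" by auto
  moreover have "?I = M \<bullet> M + (k * (y \<bullet> y) - 2 * (y \<bullet> y))"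
    using True by (simp add: \<sigma>_def algebra_simps)
  ultimately show ?thesis by linarith
next
  case False
  define r where "r = norm u"
  define n where "n = (1 / r) *\<^sub>R u"
  have r: "r > 0" "u = r *\<^sub>R n" using False by (auto simp: r_def n_def)
  have nn: "n \<bullet> n = 1" using False by (simp add: n_def r_def dot_square_norm power2_eq_square)
  have uu: "u \<bullet> u = r\<^sup>2" by (simp add: r(2) nn power2_eq_square)
  have k: "k \<ge> 3" using card by (simp add: k_def)
  define x where "x = n \<bullet> (M *v n)"
  define \<alpha> where "\<alpha> = transpose M *v n - x *\<^sub>R n"
  define \<beta> where "\<beta> = M *v n - x *\<^sub>R n"
  \<comment> \<open>The tangential block: \<open>n\<close> is annihilated by \<open>N\<close> and by
    its transpose, while the outer products carry the entries \<open>x\<close>,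
    \<open>\<alpha>\<close>, \<open>\<beta>\<close>.\<close>
  define N where "N = M - (x *\<^sub>R outer n n + outer n \<alpha> + outer \<beta> n)"
  define q where "q = y \<bullet> n"
  define z where "z = y - q *\<^sub>R n"
  define t where "t = trace N"
  have Mn: "M *v n = \<beta> + x *\<^sub>R n" and Tn: "transpose M *v n = \<alpha> + x *\<^sub>R n" and y: "y = z + q *\<^sub>R n"
    by (simp_all add: \<alpha>_def \<beta>_def z_def)
  have x': "n \<bullet> (transpose M *v n) = x"
    by (simp add: x_def inner_mult_vec_transpose inner_commute)
  have orth: "\<alpha> \<bullet> n = 0" "\<beta> \<bullet> n = 0" "z \<bullet> n = 0" "n \<bullet> \<alpha> = 0" "n \<bullet> \<beta> = 0" "n \<bullet> z = 0"
    using x' by (simp_all add: \<alpha>_def \<beta>_def z_def inner_diff_left inner_diff_right nn x_def q_def inner_commute)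
  have M: "M = N + (x *\<^sub>R outer n n + outer n \<alpha> + outer \<beta> n)" by (simp add: N_def)
  have outer_left: "outer a b \<bullet> A = A \<bullet> outer a b" for a b :: "real^'k" and A by (rule inner_commute)
  have N0: "N \<bullet> outer n n = 0" "N \<bullet> outer n \<alpha> = 0" "N \<bullet> outer \<beta> n = 0"
    "N \<bullet> outer \<alpha> n = 0" "N \<bullet> outer n \<beta> = 0"
  proof -
    have Nn: "N *v n = 0"
      by (simp add: N_def matrix_vector_mult_diff_rdistrib matrix_vector_mult_add_rdistrib outer_mult_vec
          scaleR_matrix_vector_assoc[symmetric] nn orth Mn)
    have nN: "transpose N *v n = 0"
      by (simp add: N_def transpose_diff transpose_add transpose_scalar matrix_vector_mult_diff_rdistrib
          matrix_vector_mult_add_rdistrib outer_mult_vec scaleR_matrix_vector_assoc[symmetric] nn orth Tn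
          del: transpose_matrix_vector)
    show "N \<bullet> outer n n = 0" "N \<bullet> outer \<beta> n = 0" "N \<bullet> outer \<alpha> n = 0"
      by (simp_all add: inner_outer Nn)
    show "N \<bullet> outer n \<alpha> = 0" "N \<bullet> outer n \<beta> = 0"
      by (simp_all add: inner_outer inner_mult_vec_transpose nN del: transpose_matrix_vector)
  qed
  have MM: "M \<bullet> M = N \<bullet> N + x\<^sup>2 + \<alpha> \<bullet> \<alpha> + \<beta> \<bullet> \<beta>"
    unfolding M inner_add_left inner_add_right inner_scaleR_left inner_scaleR_right outer_left[of _ _ N] N0
    by (simp add: inner_outer outer_mult_vec orth nn power2_eq_square)
  have MT: "M \<bullet> transpose M = N \<bullet> transpose N + x\<^sup>2 + 2 * (\<alpha> \<bullet> \<beta>)"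
  proof -
    have "outer a b \<bullet> transpose N = N \<bullet> outer b a" for a b
      using inner_transpose[of "outer b a" N] by (simp add: inner_commute)
    then show ?thesis
      unfolding M transpose_add transpose_scalar transpose_outer inner_add_left inner_add_right
        inner_scaleR_left inner_scaleR_right
      by (simp add: N0 inner_outer(2) outer_mult_vec orth nn power2_eq_square inner_commute)
  qed
  have tr: "trace M = t + x"
    unfolding M t_def inner_mat_1[symmetric] inner_add_left
    by (simp add: inner_outer orth nn)
  have N: "n \<bullet> (N *v n) = 0" using N0(1) by (simp add: inner_outer)
  have Mu: "M *v u = r *\<^sub>R (\<beta> + x *\<^sub>R n)" "transpose M *v u = r *\<^sub>R (\<alpha> + x *\<^sub>R n)"
    unfolding r(2) matrix_vector_mult_scaleR Mn Tn by simp_all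
  define \<rho> where "\<rho> = r\<^sup>2 * \<sigma>"
  have \<sigma>: "\<sigma> = 1 / (1 + r\<^sup>2)" by (simp add: \<sigma>_def uu)
  have w: "1 + r\<^sup>2 > 0" by (simp add: add_pos_nonneg)
  have \<rho>: "0 \<le> \<rho>" "\<rho> \<le> 1" "\<sigma> = 1 - \<rho>" using w by (auto simp: \<rho>_def \<sigma> field_simps)
  \<comment> \<open>The weight of the null Lagrangian on the tangential block; it is at most 1
    because k - 2 >= 1.\<close>
  define \<theta> where "\<theta> = \<rho> / (k - 2)"
  have \<theta>: "0 \<le> \<theta>" "\<theta> \<le> 1" using \<rho> k by (auto simp: \<theta>_def field_simps)
  have key: "\<sigma> * t\<^sup>2 / (k - 1) \<le> N \<bullet> N - \<theta> * (t\<^sup>2 - N \<bullet> transpose N)"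
  proof -
    have "(1 + \<theta>) * t\<^sup>2 / (k - 1) \<le> N \<bullet> N + \<theta> * (N \<bullet> transpose N)"
      unfolding t_def using k by (intro tangential_matrix_ineq[OF nn N]) (auto simp: k_def \<theta>)
    \<comment> \<open>Since (1 + \<open>\<theta>\<close>) - \<open>\<theta>\<close> (k - 1) = 1 -
      \<open>\<rho>\<close> = \<open>\<sigma>\<close>, the coefficient of t^2 stays positive and
      just vanishes at infinity. This fixes the factor 1 / (k - 2).\<close>
    moreover have "(1 + \<theta>) * t\<^sup>2 / (k - 1) - \<theta> * t\<^sup>2 = \<sigma> * t\<^sup>2 / (k - 1)"
      unfolding \<theta>_def \<rho>(3) using k by (simp add: divide_simps) algebra
    ultimately show ?thesis by (simp add: algebra_simps)
  qed
  define ab zz az bz aa bb where d: "ab = \<alpha> \<bullet> \<beta>" "zz = z \<bullet> z" "az = \<alpha> \<bullet> z" "bz = \<beta> \<bullet> z" "aa = \<alpha> \<bullet> \<alpha>" "bb = \<beta> \<bullet> \<beta>"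
  note in_simps = inner_add_left inner_add_right orth nn d[symmetric] inner_commute[of z \<alpha>] inner_commute[of z \<beta>] inner_commute[of \<beta> \<alpha>]
  have yy: "y \<bullet> y = q\<^sup>2 + zz" "y \<bullet> u = r * q"
    unfolding y r(2) by (simp_all add: in_simps power2_eq_square)
  have Mu': "u \<bullet> (M *v u) = r\<^sup>2 * x" "y \<bullet> (M *v u) = r * (bz + q * x)"
    "y \<bullet> (transpose M *v u) = r * (az + q * x)"
    "(transpose M *v u) \<bullet> (M *v u) = r\<^sup>2 * (ab + x\<^sup>2)"
    unfolding Mu unfolding y r(2) by (simp_all add: in_simps power2_eq_square algebra_simps)
  have My: "(M *v u + y) \<bullet> (M *v u + y) = (r * x + q)\<^sup>2 + r\<^sup>2 * bb + 2 * r * bz + zz"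
    unfolding Mu unfolding y by (simp add: in_simps power2_eq_square algebra_simps)
  have "?I = (N \<bullet> N - \<theta> * (t\<^sup>2 - N \<bullet> transpose N)) + x\<^sup>2 + aa + bb + (r * x + q)\<^sup>2 + r\<^sup>2 * bb + 2 * r * bz + zz
    - 3 * \<sigma> * (q\<^sup>2 + zz) + \<sigma> * ((k - \<rho>) * (q\<^sup>2 * (1 + r\<^sup>2) + zz) + 2 * r * (q * x + az)
      + 2 * r ^ 3 * q * x + 2 * r\<^sup>2 * q\<^sup>2) + \<sigma> * r * (q * t - bz)"
  proof -
    have e: "\<theta> = \<sigma> / (k - 2) * r\<^sup>2" by (simp add: \<theta>_def \<rho>_def)
    have rho': "r\<^sup>2 * \<sigma> = \<rho>" by (simp add: \<rho>_def)
    show ?thesis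
      unfolding MM MT tr yy Mu' My uu d[symmetric] e rho'
      by (simp add: power2_eq_square power3_eq_cube algebra_simps add_divide_distrib diff_divide_distrib)
  qed
  moreover note stability_scalar_ineq[OF k, where r = r and t = t and x = x and q = q and z = z and \<alpha> = \<alpha> and \<beta> = \<beta>,
      folded d \<sigma>, folded \<rho>_def]
  ultimately show ?thesis using key by linarith
qed

section \<open>The null Lagrangian, the correcting field and their divergences\<close>

lemma trace_linear: "linear (trace :: real^'n^'n \<Rightarrow> real)"
  by (rule linearI) (simp_all add: trace_def sum.distrib sum_distrib_left)

lemma transpose_linear: "linear (transpose :: real^'n^'m \<Rightarrow> real^'m^'n)"
  by (rule linearI) (simp_all add: transpose_def vec_eq_iff)

lemma bounded_bilinear_matrix_vector_mult:
  "bounded_bilinear ((*v) :: real^'n^'m \<Rightarrow> real^'n \<Rightarrow> real^'m)"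
  unfolding bilinear_conv_bounded_bilinear[symmetric] bilinear_def
  by (auto intro!: linearI simp: matrix_vector_right_distrib matrix_vector_mult_add_rdistrib
      matrix_vector_mult_scaleR scaleR_matrix_vector_assoc)

lemma trace_bounded_linear: "bounded_linear (trace :: real^'n^'n \<Rightarrow> real)"
  using trace_linear by (simp add: linear_conv_bounded_linear)

lemma transpose_bounded_linear: "bounded_linear (transpose :: real^'n^'m \<Rightarrow> real^'m^'n)"
  using transpose_linear by (simp add: linear_conv_bounded_linear)

lemma sum_nth_mult_inner: "(\<Sum>i\<in>UNIV. u $ i * (M $ i \<bullet> a)) = u \<bullet> (M *v (a :: real^'n))"
  by (simp add: inner_vec_def matrix_vector_mult_def)

lemma sum_mult_vec_axis: "(\<Sum>i\<in>UNIV. a \<bullet> (M *v axis i 1) * b $ i) = a \<bullet> (M *v (b :: real^'n))"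
proof -
  have "a \<bullet> (M *v axis i 1) = (transpose M *v a) $ i" for i
    by (simp add: inner_mult_vec_transpose inner_axis)
  then show ?thesis
    by (simp only: inner_mult_vec_transpose) (simp add: inner_vec_def del: transpose_matrix_vector)
qed

text \<open>With \<open>M\<close> the matrix of derivatives of \<open>y\<close>, the classical field
  \<open>trace M *\<^sub>R y - transpose M *v y\<close>, that is y div y - (y . grad) y, has
  divergence (div y)^2 - tr (Dy)^2. This is its counterpart along the spheres: \<open>W\<close> is
  |u|^2 times the tangential part of \<open>y\<close>, and the last two terms make the field
  orthogonal to \<open>u\<close>.\<close>

definition tangential_field ::
    "real^'k::finite \<Rightarrow> real^'k \<Rightarrow> real^'k^'k \<Rightarrow> real^'k" where
  "tangential_field u y M =
    (let W = (u \<bullet> u) *\<^sub>R y - (y \<bullet> u) *\<^sub>R u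
     in trace M *\<^sub>R W - transpose M *v W + (y \<bullet> (M *v u)) *\<^sub>R u - (u \<bullet> (M *v u)) *\<^sub>R y)"

text \<open>Owing to this orthogonality, a radial weight can be multiplied onto the field without a
  new term in the divergence.\<close>

lemma inner_tangential_field: "u \<bullet> tangential_field u y M = 0"
  by (simp add: tangential_field_def Let_def inner_add_right inner_diff_right
      matrix_vector_mult_diff_distrib matrix_vector_mult_scaleR dot_lmul_matrix[symmetric] 
      del: transpose_matrix_vector)
    (simp add: inner_mult_vec_transpose inner_commute algebra_simps)

text \<open>The product rule with the increments \<open>v\<close>, \<open>y'\<close>,
  \<open>M'\<close> as independent variables, so that the divergence becomes pure algebra.\<close>

definition tangential_field_deriv ::
    "real^'k::finite \<Rightarrow> real^'k \<Rightarrow> real^'k^'k \<Rightarrow> real^'k \<Rightarrow> real^'k \<Rightarrow> real^'k^'k \<Rightarrow> real^'k" where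
  "tangential_field_deriv u y M v y' M' =
    (let W = (u \<bullet> u) *\<^sub>R y - (y \<bullet> u) *\<^sub>R u;
         W' = (2 * (u \<bullet> v)) *\<^sub>R y + (u \<bullet> u) *\<^sub>R y' - (y' \<bullet> u + y \<bullet> v) *\<^sub>R u - (y \<bullet> u) *\<^sub>R v
     in trace M' *\<^sub>R W + trace M *\<^sub>R W' - transpose M' *v W - transpose M *v W'
        + (y' \<bullet> (M *v u) + y \<bullet> (M' *v u) + y \<bullet> (M *v v)) *\<^sub>R u + (y \<bullet> (M *v u)) *\<^sub>R v
        - (v \<bullet> (M *v u) + u \<bullet> (M' *v u) + u \<bullet> (M *v v)) *\<^sub>R y - (u \<bullet> (M *v u)) *\<^sub>R y')"

lemma has_derivative_tangential_field:
  assumes u: "(u has_derivative u') (at x)" and y: "(y has_derivative y') (at x)"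
    and M: "(M has_derivative M') (at x)"
  shows "((\<lambda>x. tangential_field (u x) (y x) (M x)) has_derivative
    (\<lambda>v. tangential_field_deriv (u x) (y x) (M x) (u' v) (y' v) (M' v))) (at x)"
proof -
  note dm = bounded_bilinear.FDERIV[OF bounded_bilinear_matrix_vector_mult]
  note [derivative_intros] = u y M
    bounded_linear.has_derivative[OF trace_bounded_linear]
    bounded_linear.has_derivative[OF transpose_bounded_linear]
  have Mu: "((\<lambda>x. M x *v u x) has_derivative (\<lambda>v. M x *v u' v + M' v *v u x)) (at x)"
    by (rule dm[OF M u])
  define W where "W x = (u x \<bullet> u x) *\<^sub>R y x - (y x \<bullet> u x) *\<^sub>R u x" for x
  define W' where "W' v = (2 * (u x \<bullet> u' v)) *\<^sub>R y x + (u x \<bullet> u x) *\<^sub>R y' v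
     - (y' v \<bullet> u x + y x \<bullet> u' v) *\<^sub>R u x - (y x \<bullet> u x) *\<^sub>R u' v" for v
  have W: "(W has_derivative W') (at x)"
    unfolding W_def[abs_def] W'_def[abs_def]
    by (auto intro!: derivative_eq_intros simp: inner_commute algebra_simps)
  have MW: "((\<lambda>x. transpose (M x) *v W x) has_derivative
      (\<lambda>v. transpose (M x) *v W' v + transpose (M' v) *v W x)) (at x)"
    by (rule dm[OF bounded_linear.has_derivative[OF transpose_bounded_linear M] W])
  note [derivative_intros] = Mu W MW
  show ?thesis
    unfolding tangential_field_def tangential_field_deriv_def Let_def
      W_def[symmetric] W'_def[symmetric]
    by (auto intro!: derivative_eq_intros simp: algebra_simps simp del: transpose_matrix_vector)
qed

text \<open>The second derivatives \<open>H\<close> cancel by symmetry, since the coefficients of the field are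
  antisymmetric.\<close>
lemma divergence_tangential_field:
  fixes u y :: "real^'k" and M :: "real^'k^'k" and H :: "'k \<Rightarrow> real^'k^'k"
  assumes H: "\<And>i j. H i $ j = H j $ i"
  shows "(\<Sum>i\<in>UNIV. tangential_field_deriv u y M (axis i 1) (M $ i) (H i) $ i) =
    (u \<bullet> u) * ((trace M)\<^sup>2 - M \<bullet> transpose M) - 2 * (u \<bullet> (M *v u)) * trace M
      + 2 * ((transpose M *v u) \<bullet> (M *v u))
      - (real CARD('k) - 2) * ((y \<bullet> u) * trace M - y \<bullet> (M *v u))"
proof -
  define W where "W = (u \<bullet> u) *\<^sub>R y - (y \<bullet> u) *\<^sub>R u"
  define W' where "W' i = (2 * u $ i) *\<^sub>R y + (u \<bullet> u) *\<^sub>R (M $ i) - ((M $ i) \<bullet> u + y $ i) *\<^sub>R u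
     - (y \<bullet> u) *\<^sub>R axis i 1" for i
  have W'_eq: "(2 * (u \<bullet> axis i 1)) *\<^sub>R y + (u \<bullet> u) *\<^sub>R (M $ i) - ((M $ i) \<bullet> u + y \<bullet> axis i 1) *\<^sub>R u
     - (y \<bullet> u) *\<^sub>R axis i 1 = W' i" for i
    by (simp add: W'_def inner_axis)
  have nth_eq: "tangential_field_deriv u y M (axis i 1) (M $ i) (H i) $ i =
     (trace (H i) * W $ i - (transpose (H i) *v W) $ i)
     + ((y \<bullet> (H i *v u)) * u $ i - (u \<bullet> (H i *v u)) * y $ i)
     + trace M * (W' i $ i) - (transpose M *v W' i) $ i
     + u $ i * (M $ i \<bullet> (M *v u)) + y \<bullet> (M *v axis i 1) * u $ i + y \<bullet> (M *v u)
     - (M *v u) $ i * y $ i - u \<bullet> (M *v axis i 1) * y $ i - (u \<bullet> (M *v u)) * M $ i $ i" for i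
    unfolding tangential_field_deriv_def Let_def W_def[symmetric] W'_eq
    by (simp add: inner_axis' algebra_simps del: transpose_matrix_vector)
  have 1: "(\<Sum>i\<in>UNIV. trace (H i) * W $ i - (transpose (H i) *v W) $ i) = 0"
  proof -
    have "(\<Sum>i\<in>UNIV. (transpose (H i) *v W) $ i) = (\<Sum>i\<in>UNIV. \<Sum>j\<in>UNIV. H i $ j $ i * W $ j)"
      by (simp add: matrix_vector_mult_def transpose_def del: transpose_matrix_vector)
    also have "\<dots> = (\<Sum>j\<in>UNIV. \<Sum>i\<in>UNIV. H j $ i $ i * W $ j)"
      by (subst sum.swap) (simp add: H)
    also have "\<dots> = (\<Sum>i\<in>UNIV. trace (H i) * W $ i)"
      by (simp add: trace_def sum_distrib_right)
    finally show ?thesis by (simp add: sum_subtractf)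
  qed
  have 2: "(\<Sum>i\<in>UNIV. (y \<bullet> (H i *v u)) * u $ i - (u \<bullet> (H i *v u)) * y $ i) = 0"
  proof -
    have e: "(\<Sum>i\<in>UNIV. (a \<bullet> (H i *v u)) * b $ i) = (\<Sum>i\<in>UNIV. \<Sum>j\<in>UNIV. a $ j * b $ i * (H i $ j \<bullet> u))" for a b
      by (simp add: inner_vec_def matrix_vector_mult_def sum_distrib_right sum_distrib_left mult_ac)
    have "(\<Sum>i\<in>UNIV. (y \<bullet> (H i *v u)) * u $ i) = (\<Sum>i\<in>UNIV. (u \<bullet> (H i *v u)) * y $ i)"
      unfolding e by (subst sum.swap) (simp add: H mult.commute)
    then show ?thesis by (simp add: sum_subtractf)
  qed
  have 3: "(\<Sum>i\<in>UNIV. W' i $ i) = (y \<bullet> u) + (u \<bullet> u) * trace M - u \<bullet> (M *v u) - real CARD('k) * (y \<bullet> u)"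
  proof -
    have "(\<Sum>i\<in>UNIV. W' i $ i) = 2 * (\<Sum>i\<in>UNIV. u $ i * y $ i) + (u \<bullet> u) * (\<Sum>i\<in>UNIV. M $ i $ i)
       - (\<Sum>i\<in>UNIV. u $ i * (M $ i \<bullet> u)) - (\<Sum>i\<in>UNIV. u $ i * y $ i) - (\<Sum>i\<in>(UNIV::'k set). y \<bullet> u)"
      unfolding W'_def
      by (simp add: sum.distrib sum_subtractf sum_distrib_left algebra_simps axis_def)
    then show ?thesis unfolding sum_nth_mult_inner
      by (simp add: trace_def inner_vec_def[of y u] mult.commute)
  qed
  have 4: "(\<Sum>i\<in>UNIV. (transpose M *v W' i) $ i) = 2 * (y \<bullet> (M *v u)) + (u \<bullet> u) * (M \<bullet> transpose M)
     - ((M *v u + y) \<bullet> (transpose M *v u)) - (y \<bullet> u) * trace M"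
  proof -
    have a: "(\<Sum>i\<in>UNIV. u $ i * (transpose M *v y) $ i) = y \<bullet> (M *v u)"
      unfolding inner_mult_vec_transpose[of y]
      by (simp add: inner_vec_def mult.commute del: transpose_matrix_vector)
    have b: "(\<Sum>i\<in>UNIV. (transpose M *v (M $ i)) $ i) = M \<bullet> transpose M"
      by (simp add: inner_vec_def matrix_vector_mult_def transpose_def mult.commute del: transpose_matrix_vector)
    have c: "(\<Sum>i\<in>UNIV. (M $ i \<bullet> u + y $ i) * (transpose M *v u) $ i) = (M *v u + y) \<bullet> (transpose M *v u)"
      by (simp add: inner_vec_def matrix_vector_mult_def del: transpose_matrix_vector)
    have d: "(\<Sum>i\<in>UNIV. (transpose M *v axis i 1) $ i) = trace M"
      by (simp add: matrix_vector_mult_basis column_def transpose_def trace_def del: transpose_matrix_vector)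
    have "(\<Sum>i\<in>UNIV. (transpose M *v W' i) $ i) = 2 * (\<Sum>i\<in>UNIV. u $ i * (transpose M *v y) $ i)
      + (u \<bullet> u) * (\<Sum>i\<in>UNIV. (transpose M *v (M $ i)) $ i)
      - (\<Sum>i\<in>UNIV. (M $ i \<bullet> u + y $ i) * (transpose M *v u) $ i)
      - (y \<bullet> u) * (\<Sum>i\<in>UNIV. (transpose M *v axis i 1) $ i)"
      unfolding W'_def
      by (simp add: matrix_vector_right_distrib matrix_vector_mult_diff_distrib matrix_vector_mult_scaleR
          sum.distrib sum_subtractf sum_distrib_left mult.assoc del: transpose_matrix_vector)
    then show ?thesis unfolding a b c d .
  qed
  have 5: "(\<Sum>i\<in>UNIV. (M *v u) $ i * y $ i) = y \<bullet> (M *v u)"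
    by (simp add: inner_vec_def mult.commute)
  have "(\<Sum>i\<in>UNIV. tangential_field_deriv u y M (axis i 1) (M $ i) (H i) $ i) =
     0 + 0 + trace M * (\<Sum>i\<in>UNIV. W' i $ i) - (\<Sum>i\<in>UNIV. (transpose M *v W' i) $ i)
     + u \<bullet> (M *v (M *v u)) + y \<bullet> (M *v u) + real CARD('k) * (y \<bullet> (M *v u))
     - y \<bullet> (M *v u) - u \<bullet> (M *v y) - (u \<bullet> (M *v u)) * trace M"
    unfolding nth_eq sum.distrib sum_subtractf 1[unfolded sum_subtractf] 2[unfolded sum_subtractf] 
      sum_nth_mult_inner sum_mult_vec_axis
    by (simp add: 5 del: transpose_matrix_vector flip: sum_distrib_left trace_def)
  also have "\<dots> = (u \<bullet> u) * ((trace M)\<^sup>2 - M \<bullet> transpose M) - 2 * (u \<bullet> (M *v u)) * trace M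
      + 2 * ((transpose M *v u) \<bullet> (M *v u))
      - (real CARD('k) - 2) * ((y \<bullet> u) * trace M - y \<bullet> (M *v u))"
    unfolding 3 4 
    by (simp add: inner_add_left inner_mult_vec_transpose[of u] inner_commute[of y "transpose M *v u"]
        inner_commute[of "M *v u"]
        power2_eq_square algebra_simps del: transpose_matrix_vector)
  finally show ?thesis .
qed

text \<open>Row \<open>j\<close> is the derivative in direction u_j, so this is the transpose of the
  usual Jacobian: \<open>transpose M *v u\<close> is the derivative of y along u.\<close>

definition spatial_jacobian ::
    "((real^'k::finite) \<times> real \<Rightarrow> real^'k) \<Rightarrow> (real^'k) \<times> real \<Rightarrow> real^'k^'k" where
  "spatial_jacobian Y x = (\<chi> j. frechet_derivative Y (at x) (axis j 1, 0))"

lemma C_diff_spatial_jacobian: "C_diff (Suc n) Y \<Longrightarrow> C_diff n (spatial_jacobian Y)"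
  unfolding spatial_jacobian_def[abs_def] by (intro C_diff_vec_lambda C_diff_SucD(2))

lemma frechet_derivative_vec_nth:
  assumes "(f has_derivative f') (at x)"
  shows "frechet_derivative (\<lambda>x. f x $ i) (at x) = (\<lambda>v. f' v $ i)"
  using frechet_derivative_at[OF bounded_linear.has_derivative[OF bounded_linear_vec_nth assms]] by simp

text \<open>Schwarz's theorem applied to each real component; it supplies the symmetry assumed in
  \<open>divergence_tangential_field\<close>.\<close>

lemma frechet_derivative_spatial_jacobian_sym:
  fixes Y :: "(real^'k::finite) \<times> real \<Rightarrow> real^'k"
  assumes Y: "C_diff 2 Y"
  shows "frechet_derivative (spatial_jacobian Y) (at x) (axis i 1, 0) $ j
    = frechet_derivative (spatial_jacobian Y) (at x) (axis j 1, 0) $ i"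
proof -
  have Y2: "C_diff (Suc (Suc 0)) Y" using Y by (simp add: numeral_2_eq_2)
  note J = C_diff_SucD(1)[OF C_diff_spatial_jacobian[OF Y2]]
  have "frechet_derivative (spatial_jacobian Y) (at x) (axis i 1, 0) $ j $ l
    = frechet_derivative (\<lambda>y. frechet_derivative (\<lambda>x. Y x $ l) (at y) (axis j 1, 0)) (at x) (axis i 1, 0)" for i j l
  proof -
    have d: "((\<lambda>x. spatial_jacobian Y x $ j $ l) has_derivative
        (\<lambda>v. frechet_derivative (spatial_jacobian Y) (at x) v $ j $ l)) (at x)"
      by (intro bounded_linear.has_derivative[OF bounded_linear_vec_nth] J)
    have eq: "(\<lambda>y. spatial_jacobian Y y $ j $ l) = (\<lambda>y. frechet_derivative (\<lambda>x. Y x $ l) (at y) (axis j 1, 0))"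
      by (simp add: fun_eq_iff spatial_jacobian_def frechet_derivative_vec_nth[OF C_diff_SucD(1)[OF Y2]])
    show ?thesis
      using fun_cong[OF frechet_derivative_at[OF d[unfolded eq]], of "(axis i 1, 0)"] by simp
  qed
  moreover have "C_diff 2 (\<lambda>x. Y x $ l)" for l by (rule C_diff_vec_nth[OF Y])
  ultimately show ?thesis
    by (simp add: vec_eq_iff frechet_derivative_commute)
qed

text \<open>
  The first summand is \<open>|V|\<^sup>2 u / w\<close>.  The second one contributes a null Lagrangian in the
  derivatives of \<open>y\<close> tangential to the spheres around the axis; it produces the angular energy
  which is indispensable for \<open>k = 3\<close>.
\<close>
definition stability_field ::
    "((real^'k::finite) \<times> real \<Rightarrow> real^'k) \<Rightarrow> (real^'k) \<times> real \<Rightarrow> real^'k" where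
  "stability_field Y x =
    ((1 + fst x \<bullet> fst x) powr (- (1/2))) *\<^sub>R
      ((Y x \<bullet> Y x + (Y x \<bullet> fst x)\<^sup>2) *\<^sub>R fst x
       - (1 / (real CARD('k) - 2)) *\<^sub>R tangential_field (fst x) (Y x) (spatial_jacobian Y x))"

lemma C_diff_matrix_vector_mult:
  fixes M :: "'a::euclidean_space \<Rightarrow> real^'n^'m"
  shows "C_diff n M \<Longrightarrow> C_diff n v \<Longrightarrow> C_diff n (\<lambda>x. M x *v v x)"
  by (rule C_diff_bilinear[OF bounded_bilinear_matrix_vector_mult])

lemma C_diff_stability_field:
  assumes "C_diff (Suc n) Y"
  shows "C_diff n (stability_field Y)"
  unfolding stability_field_def[abs_def] tangential_field_def Let_def
  by (intro C_diff_add C_diff_diff C_diff_scaleR C_diff_powr C_diff_const C_diff_inner C_diff_power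
      C_diff_linear[OF bounded_linear_fst] C_diff_Suc_imp[OF assms] C_diff_spatial_jacobian[OF assms]
      C_diff_matrix_vector_mult C_diff_bounded_linear[OF trace_bounded_linear]
      C_diff_bounded_linear[OF transpose_bounded_linear])
    (simp add: add_pos_nonneg)

lemma divergence_stability_field:
  fixes Y :: "(real^'k::finite) \<times> real \<Rightarrow> real^'k"
  assumes Y: "C_diff 2 Y" and card: "CARD('k) \<ge> 3"
  defines "k \<equiv> real CARD('k)"
  shows "(\<Sum>i\<in>UNIV. frechet_derivative (stability_field Y) (at (u, s)) (axis i 1, 0) $ i) =
    (let y = Y (u, s); M = spatial_jacobian Y (u, s); \<sigma> = 1 / (1 + u \<bullet> u)
     in sqrt (1 + u \<bullet> u) *
      (\<sigma> * ((k - (u \<bullet> u) * \<sigma>) * (y \<bullet> y + (y \<bullet> u)\<^sup>2) + 2 * (y \<bullet> (transpose M *v u))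
        + 2 * (y \<bullet> u) * (u \<bullet> (M *v u)) + 2 * (y \<bullet> u)\<^sup>2)
      + \<sigma> * ((y \<bullet> u) * trace M - y \<bullet> (M *v u))
      - \<sigma> / (k - 2) * ((u \<bullet> u) * ((trace M)\<^sup>2 - M \<bullet> transpose M) - 2 * (u \<bullet> (M *v u)) * trace M
        + 2 * ((transpose M *v u) \<bullet> (M *v u)))))"
proof -
  define y M where "y = Y (u, s)" and "M = spatial_jacobian Y (u, s)"
  define \<sigma> g where "\<sigma> = 1 / (1 + u \<bullet> u)" and "g = (1 + u \<bullet> u) powr (- (1/2))"
  define H where "H i = frechet_derivative (spatial_jacobian Y) (at (u, s)) (axis i 1, 0)" for i
  let ?Y' = "frechet_derivative Y (at (u, s))" and ?J' = "frechet_derivative (spatial_jacobian Y) (at (u, s))"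
  have Y2: "C_diff (Suc (Suc 0)) Y" using Y by (simp add: numeral_2_eq_2)
  have dY: "(Y has_derivative ?Y') (at (u, s))" by (rule C_diff_SucD(1)[OF Y2])
  have dJ: "(spatial_jacobian Y has_derivative ?J') (at (u, s))"
    by (rule C_diff_SucD(1)[OF C_diff_spatial_jacobian[OF Y2]])
  have pos: "1 + u \<bullet> u > 0" by (simp add: add_pos_nonneg)
  have dg: "((\<lambda>x. (1 + fst x \<bullet> fst x) powr (- (1/2))) has_derivative (\<lambda>v. - (g * \<sigma> * (u \<bullet> fst v)))) (at (u, s))"
  proof -
    have "((\<lambda>x. 1 + fst x \<bullet> fst x) has_derivative (\<lambda>v. 2 * (u \<bullet> fst v))) (at (u, s))"
      by (auto intro!: derivative_eq_intros simp: inner_commute)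
    from has_derivative_powr[OF this has_derivative_const[of "- (1/2)"]] show ?thesis
      using pos by (simp add: g_def \<sigma>_def)
  qed
  define P where "P = y \<bullet> y + (y \<bullet> u)\<^sup>2"
  define P' where "P' v = 2 * (y \<bullet> ?Y' v) + 2 * (y \<bullet> u) * (?Y' v \<bullet> u + y \<bullet> fst v)" for v
  have dP: "((\<lambda>x. Y x \<bullet> Y x + (Y x \<bullet> fst x)\<^sup>2) has_derivative P') (at (u, s))"
    unfolding P'_def[abs_def]
    by (auto intro!: derivative_eq_intros dY simp: y_def inner_commute algebra_simps power2_eq_square)
  define T where "T = tangential_field u y M"
  define T' where "T' v = tangential_field_deriv u y M (fst v) (?Y' v) (?J' v)" for v
  have dT: "((\<lambda>x. tangential_field (fst x) (Y x) (spatial_jacobian Y x)) has_derivative T') (at (u, s))"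
    using has_derivative_tangential_field[OF has_derivative_fst[OF has_derivative_ident] dY dJ]
    by (simp add: T'_def[abs_def] y_def M_def)
  define F' where "F' v = g *\<^sub>R ((P *\<^sub>R fst v + P' v *\<^sub>R u) - (1 / (k - 2)) *\<^sub>R T' v)
      + (- (g * \<sigma> * (u \<bullet> fst v))) *\<^sub>R (P *\<^sub>R u - (1 / (k - 2)) *\<^sub>R T)" for v
  have "(stability_field Y has_derivative F') (at (u, s))"
    unfolding stability_field_def[abs_def] k_def[symmetric] F'_def[abs_def]
    using has_derivative_scaleR[OF dg has_derivative_diff[OF has_derivative_scaleR[OF dP has_derivative_fst[OF has_derivative_ident]]
          has_derivative_scaleR_right[OF dT, of "1 / (k - 2)"]]]
    by (simp add: g_def P_def T_def y_def M_def)
  then have "frechet_derivative (stability_field Y) (at (u, s)) = F'"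
    by (rule frechet_derivative_at[symmetric])
  then have "(\<Sum>i\<in>UNIV. frechet_derivative (stability_field Y) (at (u, s)) (axis i 1, 0) $ i)
    = (\<Sum>i\<in>UNIV. F' (axis i 1, 0) $ i)" by simp
  also have "\<dots> = g * (k * P + (\<Sum>i\<in>UNIV. P' (axis i 1, 0) * u $ i) - 1 / (k - 2) * (\<Sum>i\<in>UNIV. T' (axis i 1, 0) $ i))
     - g * \<sigma> * (P * (u \<bullet> u) - 1 / (k - 2) * (u \<bullet> T))"
    unfolding F'_def
    by (simp add: sum.distrib sum_subtractf inner_axis algebra_simps k_def inner_vec_def[of u] 
        flip: sum_distrib_left sum_divide_distrib)
  \<comment> \<open>The derivative of the radial weight meets the tangential field only through this
    product.\<close>
  also have "u \<bullet> T = 0" unfolding T_def by (rule inner_tangential_field)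
  also have "(\<Sum>i\<in>UNIV. T' (axis i 1, 0) $ i) =
    (u \<bullet> u) * ((trace M)\<^sup>2 - M \<bullet> transpose M) - 2 * (u \<bullet> (M *v u)) * trace M
      + 2 * ((transpose M *v u) \<bullet> (M *v u)) - (k - 2) * ((y \<bullet> u) * trace M - y \<bullet> (M *v u))"
  proof -
    have "H i $ j = H j $ i" for i j
      unfolding H_def by (rule frechet_derivative_spatial_jacobian_sym[OF Y])
    from divergence_tangential_field[of H u y M, OF this] show ?thesis
      by (simp add: T'_def H_def M_def spatial_jacobian_def k_def)
  qed
  also have "(\<Sum>i\<in>UNIV. P' (axis i 1, 0) * u $ i) =
     2 * (y \<bullet> (transpose M *v u)) + 2 * (y \<bullet> u) * (u \<bullet> (M *v u)) + 2 * (y \<bullet> u)\<^sup>2"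
  proof -
    have "P' (axis i 1, 0) * u $ i = 2 * (u $ i * (M $ i \<bullet> y)) + 2 * (y \<bullet> u) * (u $ i * (M $ i \<bullet> u))
       + 2 * (y \<bullet> u) * (y $ i * u $ i)" for i
      by (simp add: P'_def M_def spatial_jacobian_def inner_axis inner_commute algebra_simps)
    then have "(\<Sum>i\<in>UNIV. P' (axis i 1, 0) * u $ i) = 2 * (\<Sum>i\<in>UNIV. u $ i * (M $ i \<bullet> y))
      + 2 * (y \<bullet> u) * (\<Sum>i\<in>UNIV. u $ i * (M $ i \<bullet> u)) + 2 * (y \<bullet> u) * (y \<bullet> u)"
      by (simp add: sum.distrib inner_vec_def[of y u] flip: sum_distrib_left)
    also have "\<dots> = 2 * (y \<bullet> (transpose M *v u)) + 2 * (y \<bullet> u) * (u \<bullet> (M *v u)) + 2 * (y \<bullet> u)\<^sup>2"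
      unfolding sum_nth_mult_inner
      by (simp add: inner_mult_vec_transpose[of u M y] inner_commute power2_eq_square del: transpose_matrix_vector)
    finally show ?thesis .
  qed
  finally have eq: "(\<Sum>i\<in>UNIV. frechet_derivative (stability_field Y) (at (u, s)) (axis i 1, 0) $ i) =
    g * (k * P + (2 * (y \<bullet> (transpose M *v u)) + 2 * (y \<bullet> u) * (u \<bullet> (M *v u)) + 2 * (y \<bullet> u)\<^sup>2)
      - 1 / (k - 2) * ((u \<bullet> u) * ((trace M)\<^sup>2 - M \<bullet> transpose M) - 2 * (u \<bullet> (M *v u)) * trace M
        + 2 * ((transpose M *v u) \<bullet> (M *v u)) - (k - 2) * ((y \<bullet> u) * trace M - y \<bullet> (M *v u))))
    - g * \<sigma> * (P * (u \<bullet> u) - 1 / (k - 2) * 0)" .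
  have gs: "g = sqrt (1 + u \<bullet> u) * \<sigma>"
    using pos by (simp add: g_def \<sigma>_def powr_minus powr_half_sqrt field_simps)
  have k2: "k - 2 > 0" using card by (simp add: k_def)
  show ?thesis
    unfolding eq Let_def y_def[symmetric] M_def[symmetric] \<sigma>_def[symmetric] P_def gs
    using k2 by (simp add: field_simps del: transpose_matrix_vector)
qed

text \<open>The density is bounded below by minus the divergence of \<open>stability_field\<close>,
  and each summand of that divergence is a directional derivative of a compactly supported function,
  with integral 0.\<close>

lemma second_variation_helicoid_nonneg:
  fixes Y :: "(real^'k::finite) \<times> real \<Rightarrow> real^'k"
  assumes card: "CARD('k) \<ge> 3" and Y: "smooth Y" and c: "compact (closure {x. Y x \<noteq> 0})"
  shows "second_variation helicoid (normal_field Y) \<ge> 0"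
proof -
  have Y2: "C_diff 2 Y" and Y1: "C_diff 1 Y" using Y by (auto simp: smooth_def simp del: C_diff.simps)
  have Y2': "C_diff (Suc 1) Y" using Y2 by (simp add: numeral_2_eq_2)
  define f where "f x = helicoid_density (fst x) (Y x)
     (\<lambda>j. frechet_derivative Y (at x) (axis j 1, 0)) (frechet_derivative Y (at x) (0, 1))" for x
  define dv where "dv x = (\<Sum>i\<in>UNIV. frechet_derivative (stability_field Y) (at x) (axis i 1, 0) $ i)" for x
  have sv: "second_variation helicoid (normal_field Y) = (LINT x|lborel. f x)"
    unfolding f_def by (rule second_variation_normal_field[OF Y1])
  have int: "integrable lborel (\<lambda>x. frechet_derivative (stability_field Y) (at x) (axis i 1, 0) $ i)"
    and int0: "(LINT x|lborel. frechet_derivative (stability_field Y) (at x) (axis i 1, 0) $ i) = 0" for i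
  proof -
    have C: "C_diff 1 (stability_field Y)" by (rule C_diff_stability_field[OF Y2'])
    then have "C_diff (Suc 0) (stability_field Y)" by simp
    note eq = frechet_derivative_vec_nth[OF C_diff_SucD(1)[OF this]]
    have C': "C_diff 1 (\<lambda>x. stability_field Y x $ i)" by (rule C_diff_vec_nth[OF C])
    have z: "stability_field Y x $ i = 0" if "x \<notin> closure {x. Y x \<noteq> 0}" for x
    proof -
      have "Y x = 0" using that closure_subset[of "{x. Y x \<noteq> 0}"] by auto
      then show ?thesis by (simp add: stability_field_def tangential_field_def)
    qed
    show "integrable lborel (\<lambda>x. frechet_derivative (stability_field Y) (at x) (axis i 1, 0) $ i)"
      using integral_directional_derivative(1)[OF C' c z, of "(axis i 1, 0)"] by (simp add: eq)
    show "(LINT x|lborel. frechet_derivative (stability_field Y) (at x) (axis i 1, 0) $ i) = 0"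
      using integral_directional_derivative(2)[OF C' c z, of "(axis i 1, 0)"] by (simp add: eq)
  qed
  have dv: "integrable lborel dv" "(LINT x|lborel. dv x) = 0"
    unfolding dv_def[abs_def] using int int0 by (auto simp: integral_sum)
  have le: "- dv x \<le> f x" for x
  proof -
    obtain u s where x: "x = (u, s)" by (cases x)
    define y M where "y = Y (u, s)" and "M = spatial_jacobian Y (u, s)"
    define e where "e = frechet_derivative Y (at (u, s)) (0, 1)"
    define \<sigma> where "\<sigma> = 1 / (1 + u \<bullet> u)"
    have pos: "1 + u \<bullet> u > 0" by (simp add: add_pos_nonneg)
    have "f x = helicoid_density u y (\<lambda>j. M $ j) e"
      by (simp add: f_def x y_def M_def spatial_jacobian_def e_def)
    also have "\<dots> = sqrt (1 + u \<bullet> u) * (M \<bullet> M + (M *v u + y) \<bullet> (M *v u + y) - 3 * \<sigma> * (y \<bullet> y)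
        + \<sigma> * ((norm e)\<^sup>2 + (e \<bullet> u)\<^sup>2))"
    proof -
      have "(M *v u) $ j = M $ j \<bullet> u" for j by (simp add: matrix_vector_mult_def inner_vec_def)
      then have "(\<Sum>j\<in>UNIV. (M $ j \<bullet> u + y $ j)\<^sup>2) = (M *v u + y) \<bullet> (M *v u + y)"
        by (simp add: inner_vec_def[of "M *v u + y"] power2_eq_square)
      moreover have "(\<Sum>j\<in>UNIV. (norm (M $ j))\<^sup>2) = M \<bullet> M"
        by (simp add: inner_vec_def[of M M] power2_norm_eq_inner)
      ultimately have "(\<Sum>j\<in>UNIV. (norm (M $ j))\<^sup>2 + (M $ j \<bullet> u + y $ j)\<^sup>2) = M \<bullet> M + (M *v u + y) \<bullet> (M *v u + y)"
        by (simp add: sum.distrib)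
      then show ?thesis
        unfolding helicoid_density_def by (simp add: \<sigma>_def power2_norm_eq_inner[of y])
    qed
    finally have f: "f x = \<dots>" .
    \<comment> \<open>The axial derivatives contribute a nonnegative term and are given away
      here.\<close>
    have "0 \<le> \<sigma> * ((norm e)\<^sup>2 + (e \<bullet> u)\<^sup>2)" using pos by (simp add: \<sigma>_def)
    with stability_matrix_ineq[OF card, of M u y, folded \<sigma>_def]
    have "0 \<le> sqrt (1 + u \<bullet> u) * ((M \<bullet> M + (M *v u + y) \<bullet> (M *v u + y) - 3 * \<sigma> * (y \<bullet> y)
        + \<sigma> * ((norm e)\<^sup>2 + (e \<bullet> u)\<^sup>2)) + 
      (\<sigma> * ((real CARD('k) - (u \<bullet> u) * \<sigma>) * (y \<bullet> y + (y \<bullet> u)\<^sup>2) + 2 * (y \<bullet> (transpose M *v u))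
        + 2 * (y \<bullet> u) * (u \<bullet> (M *v u)) + 2 * (y \<bullet> u)\<^sup>2)
      + \<sigma> * ((y \<bullet> u) * trace M - y \<bullet> (M *v u))
      - \<sigma> / (real CARD('k) - 2) * ((u \<bullet> u) * ((trace M)\<^sup>2 - M \<bullet> transpose M) - 2 * (u \<bullet> (M *v u)) * trace M
        + 2 * ((transpose M *v u) \<bullet> (M *v u)))))"
      using pos by (intro mult_nonneg_nonneg) auto
    also have "\<dots> = f x + dv x"
      unfolding f[unfolded x] dv_def x divergence_stability_field[OF Y2 card] Let_def y_def[symmetric] M_def[symmetric] \<sigma>_def[symmetric]
      by (simp only: distrib_left)
    finally show ?thesis by simp
  qed
  show ?thesis
  proof (cases "integrable lborel f")
    case True
    have "(LINT x|lborel. - dv x) \<le> (LINT x|lborel. f x)"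
      using True dv le by (intro integral_mono) auto
    then show ?thesis using dv sv by simp
  next
    \<comment> \<open>The Bochner integral of a nonintegrable function is 0 by convention.\<close>
    case False
    then show ?thesis by (simp add: sv not_integrable_integral_eq)
  qed
qed

section \<open>Instability\<close>

lemma C_diff_compose_linear:
  assumes L: "bounded_linear L"
  shows "C_diff n f \<Longrightarrow> C_diff n (\<lambda>x. f (L x))"
proof (induction n arbitrary: f)
  case 0
  then show ?case
    using bounded_linear.continuous_on[OF L continuous_on_id]
    by (auto intro: continuous_on_compose2)
next
  case (Suc n)
  note f = C_diff_SucD[OF Suc.prems]
  show ?case
    by (rule C_diff_SucI[where f' = "\<lambda>x v. frechet_derivative f (at (L x)) (L v)"])
      (auto intro: has_derivative_compose[OF bounded_linear_imp_has_derivative[OF L] f(1)] Suc.IH f(2))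
qed

text \<open>Supported in [-2, 2] without a plateau: on [-1, 1] the lower bound exp (-1/3) plays that
  role.\<close>

definition bump :: "real \<Rightarrow> real" where "bump t = flat_exp 0 (4 - t\<^sup>2)"

definition bump_deriv :: "real \<Rightarrow> real" where "bump_deriv t = flat_exp 2 (4 - t\<^sup>2) * (- 2 * t)"

lemma has_derivative_bump:
  assumes "(g has_derivative g') (at x)"
  shows "((\<lambda>x. bump (g x)) has_derivative (\<lambda>v. bump_deriv (g x) * g' v)) (at x)"
proof -
  have "((\<lambda>x. 4 - (g x)\<^sup>2) has_derivative (\<lambda>v. - 2 * g x * g' v)) (at x)"
    by (auto intro!: derivative_eq_intros assms)
  from has_derivative_compose[OF this
      has_real_derivative_flat_exp[of 0, unfolded has_field_derivative_def]]
  show ?thesis by (simp add: bump_def bump_deriv_def mult.assoc flip: numeral_2_eq_2)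
qed

lemma C_diff_bump:
  fixes g :: "'a::euclidean_space \<Rightarrow> real"
  shows "C_diff n g \<Longrightarrow> C_diff n (\<lambda>x. bump (g x))"
  unfolding bump_def by (intro C_diff_flat_exp C_diff_diff C_diff_const C_diff_power)

lemma continuous_flat_exp: "continuous_on UNIV (flat_exp m)"
  using C_diff_flat_exp[OF C_diff_ident, of 0 m] by simp

lemma continuous_on_bump [continuous_intros]:
  "continuous_on S g \<Longrightarrow> continuous_on S (\<lambda>x. bump (g x))"
  unfolding bump_def
  by (intro continuous_on_compose2[OF continuous_flat_exp]) (auto intro!: continuous_intros)

lemma continuous_on_bump_deriv [continuous_intros]:
  "continuous_on S g \<Longrightarrow> continuous_on S (\<lambda>x. bump_deriv (g x))"
  unfolding bump_deriv_def
  by (intro continuous_on_mult continuous_on_compose2[OF continuous_flat_exp])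
    (auto intro!: continuous_intros)

lemma bump_eq_0: "\<bar>t\<bar> \<ge> 2 \<Longrightarrow> bump t = 0" "\<bar>t\<bar> \<ge> 2 \<Longrightarrow> bump_deriv t = 0"
  using abs_le_square_iff[of 2 t] by (auto simp: bump_def bump_deriv_def flat_exp_def)

lemma bump_nonneg: "0 \<le> bump t" and bump_le_1: "bump t \<le> 1"
  by (auto simp: bump_def flat_exp_def)

lemma bump_ge: "\<bar>t\<bar> \<le> 1 \<Longrightarrow> exp (- (1/3)) \<le> bump t"
proof -
  assume "\<bar>t\<bar> \<le> 1"
  then have t: "t\<^sup>2 \<le> 1" by (simp add: abs_square_le_1)
  then have "inverse (4 - t\<^sup>2) \<le> inverse 3" by (intro le_imp_inverse_le) auto
  then have "- (1/3) \<le> - inverse (4 - t\<^sup>2)" by (simp add: inverse_eq_divide)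
  then have "exp (- (1/3)) \<le> exp (- inverse (4 - t\<^sup>2))" by (simp only: exp_le_cancel_iff)
  with t show ?thesis by (simp add: bump_def flat_exp_def)
qed

lemma bump_deriv_bounded: obtains C where "C > 0" "\<And>t. \<bar>bump_deriv t\<bar> \<le> C"
proof -
  have "bounded (bump_deriv ` {-2..2})"
    by (intro compact_imp_bounded compact_continuous_image continuous_on_bump_deriv continuous_on_id) auto
  then obtain C where C: "\<forall>t\<in>{-2..2}. \<bar>bump_deriv t\<bar> \<le> C" by (auto simp: bounded_iff)
  have "\<bar>bump_deriv t\<bar> \<le> max C 1" for t
  proof (cases "\<bar>t\<bar> \<ge> 2")
    case False
    then have "t \<in> {-2..2}" by auto
    with C show ?thesis by (auto simp: le_max_iff_disj)
  qed (simp add: bump_eq_0)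
  then show ?thesis by (intro that[of "max C 1"]) auto
qed

lemma integral_lborel_times:
  fixes f :: "'a::euclidean_space \<Rightarrow> real" and g :: "'b::euclidean_space \<Rightarrow> real"
  assumes f: "continuous_on UNIV f" "compact K" "\<And>x. x \<notin> K \<Longrightarrow> f x = 0"
    and g: "continuous_on UNIV g" "compact L" "\<And>x. x \<notin> L \<Longrightarrow> g x = 0"
  shows "integrable lborel (\<lambda>x. f (fst x) * g (snd x))"
    and "(LINT x|lborel. f (fst x) * g (snd x)) = (LINT x|lborel. f x) * (LINT x|lborel. g x)"
proof -
  show int: "integrable lborel (\<lambda>x. f (fst x) * g (snd x))"
  proof (rule integrable_continuous_compact_support)
    show "continuous_on UNIV (\<lambda>x. f (fst x) * g (snd x))"
      by (intro continuous_on_mult continuous_on_compose2[OF f(1)] continuous_on_compose2[OF g(1)])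
        (auto intro!: continuous_intros)
    show "compact (K \<times> L)" by (intro compact_Times f g)
    show "f (fst x) * g (snd x) = 0" if "x \<notin> K \<times> L" for x
      using that f(3)[of "fst x"] g(3)[of "snd x"] by (cases x) auto
  qed
  have "(LINT x|lborel. f (fst x) * g (snd x)) = (LINT x|(lborel \<Otimes>\<^sub>M lborel). f (fst x) * g (snd x))"
    by (simp add: lborel_prod)
  also have "\<dots> = (LINT x|lborel. LINT y|lborel. f x * g y)"
    using lborel_pair.integral_fst'[of "\<lambda>x. f (fst x) * g (snd x)"] int
    by (simp add: lborel_prod)
  finally show "(LINT x|lborel. f (fst x) * g (snd x)) = (LINT x|lborel. f x) * (LINT x|lborel. g x)"
    by simp
qed

text \<open>The density is quadratic and has no product of axial with other derivatives, so a field
  that separates u from s gives a sum of two separated terms.\<close>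

lemma helicoid_density_scaleR:
  "helicoid_density u (b *\<^sub>R y) (\<lambda>j. b *\<^sub>R D j) (c *\<^sub>R y)
    = helicoid_density u y D 0 * b\<^sup>2 + helicoid_density u 0 (\<lambda>_. 0) y * c\<^sup>2"
proof -
  have "(\<Sum>j\<in>UNIV. (norm (b *\<^sub>R D j))\<^sup>2 + ((b *\<^sub>R D j) \<bullet> u + (b *\<^sub>R y) $ j)\<^sup>2)
    = b\<^sup>2 * (\<Sum>j\<in>UNIV. (norm (D j))\<^sup>2 + (D j \<bullet> u + y $ j)\<^sup>2)"
    by (simp add: sum_distrib_left power_mult_distrib flip: distrib_left)
  then show ?thesis
    by (simp add: helicoid_density_def power_mult_distrib algebra_simps add_divide_distrib
        diff_divide_distrib)
qed

text \<open>Stretching the test field along the axis of the helicoid makes the axial derivatives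
  negligible.\<close>
lemma helicoid_unstable:
  fixes Y :: "real^'k::finite \<Rightarrow> real^'k"
  defines "f \<equiv> \<lambda>u. helicoid_density u (Y u) (\<lambda>j. frechet_derivative Y (at u) (axis j 1)) 0"
  assumes Y: "smooth Y" and R: "\<And>u. norm u \<ge> R \<Longrightarrow> Y u = 0"
    and g: "integrable lborel g" "\<And>u. f u \<le> g u" "(LINT u|lborel. g u) < 0"
  shows "\<not> stable (helicoid :: (real^'k) \<times> real \<Rightarrow> (complex^'k) \<times> real)"
proof -
  define h where "h u = helicoid_density u 0 (\<lambda>_. 0) (Y u)" for u
  define a where "a = (LINT t|lborel. (bump t)\<^sup>2)"
  define b where "b = (LINT t|lborel. (bump_deriv t)\<^sup>2)"
  have Yn: "C_diff n Y" for n using Y by (simp add: smooth_def)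
  have Y1: "C_diff (Suc 0) Y" by (rule Yn)
  note dY = C_diff_SucD[OF Y1]
  have contY: "continuous_on UNIV Y" by (rule C_diff_continuous[OF Yn[of 0]])
  have pos: "1 + u \<bullet> u \<noteq> 0" "1 + u \<bullet> u > 0" for u :: "real^'k"
    using inner_ge_zero[of u] by linarith+
  have f_cont: "continuous_on UNIV f"
    unfolding f_def helicoid_density_def using dY(2) contY pos
    by (auto intro!: continuous_intros)
  have h_cont: "continuous_on UNIV h"
    unfolding h_def helicoid_density_def using contY pos
    by (auto intro!: continuous_intros)
  have f0: "f u = 0" if "u \<notin> cball 0 R" for u
  proof -
    have "frechet_derivative Y (at u) = (\<lambda>_. 0)"
    proof (rule frechet_derivative_at[symmetric], rule has_derivative_transform_within_open)
      show "((\<lambda>_. 0) has_derivative (\<lambda>_. 0)) (at u)" by simp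
      show "open (- cball 0 R)" by auto
    qed (use that R in auto)
    then show ?thesis using that R[of u] by (simp add: f_def helicoid_density_def)
  qed
  have "(LINT u|lborel. f u) \<le> (LINT u|lborel. g u)"
    by (intro integral_mono g(1,2) integrable_continuous_compact_support[OF f_cont compact_cball f0])
  with g(3) have neg: "(LINT u|lborel. f u) < 0" by simp
  have h0: "h u = 0" if "u \<notin> cball 0 R" for u
    using that R[of u] by (simp add: h_def helicoid_density_def)
  have a: "a > 0"
  proof -
    have "0 < (exp (- (1/3)))\<^sup>2 * (2::real)" by simp
    also have "\<dots> = (LINT t|lborel. (exp (- (1/3)))\<^sup>2 * indicator {-1..1::real} t)"
      by simp
    also have "\<dots> \<le> a"
      unfolding a_def
    proof (rule integral_mono)
      show "integrable lborel (\<lambda>t. (bump t)\<^sup>2)"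
        by (rule integrable_continuous_compact_support[of _ "{-2..2}"])
          (auto intro!: continuous_intros bump_eq_0)
      show "(exp (- (1/3)))\<^sup>2 * indicator {-1..1} t \<le> (bump t)\<^sup>2" for t :: real
        using bump_ge[of t] by (auto split: split_indicator intro!: power_mono)
    qed auto
    finally show ?thesis .
  qed
  have b: "b \<ge> 0" unfolding b_def by (rule integral_nonneg_AE) auto
  have h_nonneg: "(LINT u|lborel. h u) \<ge> 0"
    by (rule integral_nonneg_AE) (auto simp: h_def helicoid_density_def pos less_imp_le)
  \<comment> \<open>The second variation will be S a F + (b / S) H, with F < 0 and H the integrals
    of \<open>f\<close> and \<open>h\<close>. It is negative once S^2 exceeds the quotient under the
    root; adding 1 makes this strict.\<close>
  define S where "S = sqrt (b * (LINT u|lborel. h u) / (a * - (LINT u|lborel. f u))) + 1"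
  have S: "S > 0" "b * (LINT u|lborel. h u) / (a * - (LINT u|lborel. f u)) < S\<^sup>2"
  proof -
    define q where "q = b * (LINT u|lborel. h u) / (a * - (LINT u|lborel. f u))"
    have "q \<ge> 0" unfolding q_def using a b h_nonneg neg
      by (intro divide_nonneg_pos mult_nonneg_nonneg mult_pos_pos) auto
    then show "S > 0" "q < S\<^sup>2" 
      unfolding S_def q_def[symmetric] by (auto simp: power2_sum add_pos_nonneg add_nonneg_pos intro: add_nonneg_pos)
  qed
  define Z where "Z x = bump (snd x / S) *\<^sub>R Y (fst x)" for x :: "(real^'k) \<times> real"
  have "smooth Z"
    unfolding smooth_def Z_def[abs_def]
    by (intro allI C_diff_scaleR C_diff_bump C_diff_compose_linear[OF bounded_linear_fst Yn]
        C_diff_bounded_linear[OF bounded_linear_divide C_diff_linear[OF bounded_linear_snd]])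
  moreover have "compact (closure {x. Z x \<noteq> 0})"
  proof -
    have "{x. Z x \<noteq> 0} \<subseteq> cball 0 R \<times> {- 2 * S..2 * S}"
    proof
      fix x assume "x \<in> {x. Z x \<noteq> 0}"
      then have "Y (fst x) \<noteq> 0" "bump (snd x / S) \<noteq> 0" by (auto simp: Z_def)
      then have "norm (fst x) < R" "\<bar>snd x / S\<bar> < 2"
        using R[of "fst x"] bump_eq_0(1)[of "snd x / S"] by (auto simp: not_le[symmetric])
      then show "x \<in> cball 0 R \<times> {- 2 * S..2 * S}"
        using S(1) by (cases x) (auto simp: field_simps)
    qed
    moreover have "bounded (cball (0 :: real^'k) R \<times> {- 2 * S..2 * S})"
      by (intro bounded_Times) auto
    ultimately show ?thesis
      by (auto simp: compact_closure intro: bounded_subset)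
  qed
  ultimately have V: "compactly_supported_normal_field helicoid (normal_field Z)"
    unfolding compactly_supported_normal_field_helicoid_iff by blast
  have dens: "helicoid_density (fst x) (Z x) (\<lambda>j. frechet_derivative Z (at x) (axis j 1, 0))
       (frechet_derivative Z (at x) (0, 1))
     = f (fst x) * (bump (snd x / S))\<^sup>2 + h (fst x) * (bump_deriv (snd x / S) / S)\<^sup>2" for x
  proof -
    have "(Z has_derivative (\<lambda>v. bump (snd x / S) *\<^sub>R frechet_derivative Y (at (fst x)) (fst v)
        + (bump_deriv (snd x / S) * (snd v / S)) *\<^sub>R Y (fst x))) (at x)"
      unfolding Z_def[abs_def]
      by (intro has_derivative_scaleR has_derivative_bump has_derivative_compose[OF _ dY(1)])
        (use S(1) in \<open>auto intro!: derivative_eq_intros\<close>)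
    from frechet_derivative_at[OF this, symmetric] show ?thesis
      using helicoid_density_scaleR[of "fst x" "bump (snd x / S)" "Y (fst x)"
          "\<lambda>j. frechet_derivative Y (at (fst x)) (axis j 1)" "bump_deriv (snd x / S) / S"]
        linear_0[OF linear_frechet_derivative[OF differentiableI[OF dY(1)]], of "fst x"]
      by (simp add: f_def h_def Z_def)
  qed
  have Sa: "(LINT t|lborel. (bump (t / S))\<^sup>2) = S * a" "(LINT t|lborel. (bump_deriv (t / S) / S)\<^sup>2) = b / S"
    unfolding a_def b_def
    by (subst lborel_integral_real_affine[of S _ 0]; use S(1) in \<open>simp add: power_divide power2_eq_square\<close>)+
  have supp: "bump (t / S) = 0 \<and> bump_deriv (t / S) = 0" if "t \<notin> {-2 * S..2 * S}" for t
    using that S(1) by (intro conjI bump_eq_0) (auto simp: abs_if field_simps split: if_splits)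
  note prod1 = integral_lborel_times[OF f_cont compact_cball[of 0 R] f0, where g = "\<lambda>t. (bump (t / S))\<^sup>2" and L = "{-2 * S..2 * S}"]
  note prod2 = integral_lborel_times[OF h_cont compact_cball[of 0 R] h0, where g = "\<lambda>t. (bump_deriv (t / S) / S)\<^sup>2" and L = "{-2 * S..2 * S}"]
  have cont: "continuous_on UNIV (\<lambda>t. (bump (t / S))\<^sup>2)" "continuous_on UNIV (\<lambda>t. (bump_deriv (t / S) / S)\<^sup>2)"
  proof -
    have "S \<noteq> 0" using S(1) by simp
    then show "continuous_on UNIV (\<lambda>t. (bump (t / S))\<^sup>2)"
      "continuous_on UNIV (\<lambda>t. (bump_deriv (t / S) / S)\<^sup>2)"
      by (auto intro!: continuous_intros)
  qed
  have "C_diff 1 Z" using \<open>smooth Z\<close> unfolding smooth_def by blast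
  from second_variation_normal_field[OF this]
  have "second_variation helicoid (normal_field Z) = (LINT x|lborel. f (fst x) * (bump (snd x / S))\<^sup>2
      + h (fst x) * (bump_deriv (snd x / S) / S)\<^sup>2)"
    unfolding dens .
  also have "\<dots> = (LINT u|lborel. f u) * (S * a) + (LINT u|lborel. h u) * (b / S)"
    using prod1 prod2 cont supp by (simp add: Sa)
  also have "\<dots> < 0"
  proof -
    have "a * - (LINT u|lborel. f u) > 0" using a neg by (simp add: mult_pos_neg)
    from S(2)[unfolded pos_divide_less_eq[OF this]]
    have "b * (LINT u|lborel. h u) < S\<^sup>2 * (a * - (LINT u|lborel. f u))" .
    then show ?thesis using S(1) by (simp add: field_simps power2_eq_square)
  qed
  finally show ?thesis using V unfolding stable_def by (auto simp: not_le)
qed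

text \<open>
  With \<open>c = 1 + |u|\<^sup>2\<close> and \<open>d = DIM('a)\<close>, the function \<open>c\<^sup>-\<^sup>d\<^sup>/\<^sup>2\<close> is scale invariant at infinity, so its
  integral over \<open>c < e\<^sup>m\<close> is comparable to \<open>m\<close>.  The step functions below bound it from
  above and, for \<open>d = 2\<close>, from below.
\<close>
definition upper_step :: "nat \<Rightarrow> 'a::euclidean_space \<Rightarrow> real" where
  "upper_step m u = (\<Sum>n<m. exp (- (real DIM('a) * real n / 2)) * indicator (ball 0 (exp (real (n + 1) / 2))) u)"

lemma upper_step_nonneg: "upper_step m u \<ge> 0"
  unfolding upper_step_def by (intro sum_nonneg) auto

lemma ball_0_iff: "u \<in> ball 0 r \<longleftrightarrow> u \<bullet> u < r\<^sup>2" if "r \<ge> 0"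
  using that by (auto simp: power2_norm_eq_inner[symmetric] intro: power_strict_mono dest: power2_less_imp_less)

text \<open>On the layer e^m <= c < e^(m+1) the new ball contains the point and its weight is the
  largest value of c^(-d/2) there.\<close>

lemma upper_step_ge:
  fixes u :: "'a::euclidean_space"
  defines "c \<equiv> 1 + u \<bullet> u"
  assumes "c < exp (real m)"
  shows "c powr (- (real DIM('a) / 2)) \<le> upper_step m u"
  using assms(2)
proof (induction m)
  case 0
  then show ?case using inner_ge_zero[of u] by (simp add: c_def)
next
  case (Suc m)
  have step: "upper_step (Suc m) u = upper_step m u
      + exp (- (real DIM('a) * real m / 2)) * indicator (ball 0 (exp (real (m + 1) / 2))) u"
    by (simp add: upper_step_def)
  show ?case
  proof (cases "c < exp (real m)")
    case True
    then show ?thesis unfolding step by (intro add_increasing2 Suc.IH) auto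
  next
    case False
    have "(exp (real (m + 1) / 2))\<^sup>2 = exp (real (Suc m))"
      by (simp add: power2_eq_square exp_add[symmetric])
    then have "u \<in> ball 0 (exp (real (m + 1) / 2))"
      using Suc.prems by (subst ball_0_iff) (auto simp: c_def)
    moreover have "c powr (- (real DIM('a) / 2)) \<le> exp (real m) powr (- (real DIM('a) / 2))"
      using False by (intro powr_mono2') auto
    moreover have "exp (real m) powr (- (real DIM('a) / 2)) = exp (- (real DIM('a) * real m / 2))"
      by (simp add: powr_def)
    ultimately show ?thesis unfolding step using upper_step_nonneg[of m u] by simp
  qed
qed

lemma integrable_upper_step [intro]: "integrable lborel (upper_step m)"
  unfolding upper_step_def[abs_def]
  by (intro Bochner_Integration.integrable_sum integrable_mult_right)
    (simp add: integrable_indicator_iff emeasure_lborel_ball_finite[simplified])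

text \<open>The volume of each ball cancels the decay of its weight, so all \<open>m\<close> scales
  contribute equally.\<close>

lemma integral_upper_step:
  "(LINT u|lborel. upper_step m (u :: 'a::euclidean_space)) =
     real m * (unit_ball_vol (real DIM('a)) * exp (real DIM('a) / 2))"
proof -
  have "(LINT u|lborel. upper_step m (u :: 'a)) =
    (\<Sum>n<m. exp (- (real DIM('a) * real n / 2)) * measure lborel (ball (0::'a) (exp (real (n + 1) / 2))))"
    unfolding upper_step_def
    by (subst Bochner_Integration.integral_sum)
      (auto intro!: integrable_mult_right simp: integrable_indicator_iff emeasure_lborel_ball_finite[simplified])
  also have "\<dots> = (\<Sum>n<m. unit_ball_vol (real DIM('a)) * exp (real DIM('a) / 2))"
  proof (rule sum.cong[OF refl])
    fix n
    have "exp (real (n + 1) / 2) ^ DIM('a) = exp (real DIM('a) * (real (n + 1) / 2))"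
      by (rule exp_of_nat_mult[symmetric])
    also have "exp (- (real DIM('a) * real n / 2)) * \<dots> = exp (real DIM('a) / 2)"
      by (simp add: exp_add[symmetric] field_simps)
    finally show "exp (- (real DIM('a) * real n / 2)) * measure lborel (ball (0::'a) (exp (real (n + 1) / 2)))
      = unit_ball_vol (real DIM('a)) * exp (real DIM('a) / 2)"
      by (simp add: content_ball mult.left_commute)
  qed
  finally show ?thesis by simp
qed

definition annulus :: "nat \<Rightarrow> 'a::euclidean_space set" where
  "annulus n = {u. exp (real n) \<le> 1 + u \<bullet> u \<and> 1 + u \<bullet> u < exp (real (Suc n))}"

lemma annulus_eq:
  "annulus n = ball 0 (sqrt (exp (real (Suc n)) - 1)) - ball 0 (sqrt (exp (real n) - 1))"
  unfolding annulus_def set_eq_iff Diff_iff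
  by (subst (1 2) ball_0_iff) (auto simp del: mem_ball)

lemma annulus_sets:
  "(annulus n :: 'a::euclidean_space set) \<in> sets lborel"
  "emeasure lborel (annulus n :: 'a set) < top"
proof -
  show "(annulus n :: 'a set) \<in> sets lborel" unfolding annulus_eq by simp
  have "emeasure lborel (annulus n :: 'a set) \<le> emeasure lborel (ball 0 (sqrt (exp (real (Suc n)) - 1)) :: 'a set)"
    unfolding annulus_eq by (intro emeasure_mono) auto
  then show "emeasure lborel (annulus n :: 'a set) < top"
    by (rule le_less_trans) (rule emeasure_lborel_ball_finite[simplified])
qed

lemma content_annulus:
  assumes "DIM('a::euclidean_space) = 2"
  shows "measure lborel (annulus n :: 'a set) = unit_ball_vol 2 * (exp (real (Suc n)) - exp (real n))"
proof -
  have "measure lborel (annulus n :: 'a set) = measure lborel (ball (0::'a) (sqrt (exp (real (Suc n)) - 1)))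
      - measure lborel (ball (0::'a) (sqrt (exp (real n) - 1)))"
    unfolding annulus_eq
    by (rule measure_Diff) (auto intro!: subset_ball simp: less_imp_neq[OF emeasure_lborel_ball_finite[simplified]])
  then show ?thesis
    by (simp add: content_ball assms algebra_simps)
qed

text \<open>The weight is the value of 1 / c at the outer edge of its annulus. The sum starts at
  \<open>annulus 1\<close>, where c >= e > 2, so the function vanishes on the unit ball.\<close>

definition lower_step :: "nat \<Rightarrow> 'a::euclidean_space \<Rightarrow> real" where
  "lower_step m u = (\<Sum>n<m. exp (- real (n + 2)) * indicator (annulus (n + 1)) u)"

lemma lower_step_eq_0: "u \<bullet> u \<le> 1 \<or> exp (real (m + 1)) \<le> 1 + u \<bullet> u \<Longrightarrow> lower_step m u = 0"
proof -
  assume *: "u \<bullet> u \<le> 1 \<or> exp (real (m + 1)) \<le> 1 + u \<bullet> u"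
  have "u \<notin> annulus (n + 1)" if "n < m" for n
  proof -
    have "2 < exp (1 :: real)" using exp_lower_Taylor_quadratic[of 1] by simp
    moreover have "exp 1 \<le> exp (real (n + 1))" by simp
    moreover have "exp (real (Suc (n + 1))) \<le> exp (real (m + 1))" using that by simp
    moreover have False if "exp (real (n + 1)) \<le> 1 + u \<bullet> u" "1 + u \<bullet> u < exp (real (Suc (n + 1)))"
      using * that calculation by (elim disjE) linarith+
    ultimately show ?thesis unfolding annulus_def by blast
  qed
  then show ?thesis unfolding lower_step_def by (intro sum.neutral) auto
qed

lemma lower_step_le: "lower_step m u \<le> 1 / (1 + u \<bullet> u)"
proof (induction m)
  case 0
  then show ?case by (simp add: lower_step_def)
next
  case (Suc m)
  have step: "lower_step (Suc m) u = lower_step m u + exp (- real (m + 2)) * indicator (annulus (m + 1)) u"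
    by (simp add: lower_step_def)
  show ?case
  proof (cases "u \<in> annulus (m + 1)")
    case True
    then have c: "exp (real (m + 1)) \<le> 1 + u \<bullet> u" "1 + u \<bullet> u < exp (real (m + 2))"
      by (auto simp: annulus_def)
    have "lower_step (Suc m) u = 1 / exp (real (m + 2))"
      unfolding step using lower_step_eq_0[of u m] c(1) True
      by (simp only: exp_minus inverse_eq_divide) simp
    also have "\<dots> \<le> 1 / (1 + u \<bullet> u)"
      using c(2) by (intro divide_left_mono) (auto intro!: mult_pos_pos add_pos_nonneg)
    finally show ?thesis .
  qed (use Suc step in auto)
qed

lemma integrable_lower_step [intro]: "integrable lborel (lower_step m)"
  unfolding lower_step_def[abs_def]
  by (intro Bochner_Integration.integrable_sum integrable_mult_right)
    (use annulus_sets in \<open>auto simp: integrable_indicator_iff\<close>)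

lemma integral_lower_step:
  assumes "DIM('a::euclidean_space) = 2"
  shows "(LINT u|lborel. lower_step m (u :: 'a)) = real m * (unit_ball_vol 2 * (1 - exp (-1)))"
proof -
  have "(LINT u|lborel. lower_step m (u :: 'a)) = (\<Sum>n<m. exp (- real (n + 2)) * measure lborel (annulus (n + 1) :: 'a set))"
    unfolding lower_step_def using annulus_sets
    by (subst Bochner_Integration.integral_sum)
      (auto intro!: integrable_mult_right simp: integrable_indicator_iff)
  also have "\<dots> = (\<Sum>n<m. unit_ball_vol 2 * (1 - exp (-1)))"
  proof (rule sum.cong[OF refl])
    fix n
    have "exp (- real (n + 2)) * (exp (real (Suc (n + 1))) - exp (real (n + 1))) = 1 - exp (-1)"
      by (simp add: right_diff_distrib exp_add[symmetric])
    then show "exp (- real (n + 2)) * measure lborel (annulus (n + 1) :: 'a set) = unit_ball_vol 2 * (1 - exp (-1))"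
      unfolding content_annulus[OF assms] by (simp add: mult.left_commute)
  qed
  finally show ?thesis by simp
qed

text \<open>As 1 + |u|^2 = w^2, the exponents p = 1/2 and p = 3/4 give 1 / w and w^(-3/2). Cutting
  off in the logarithm makes each derivative of the cutoff cost a factor \<open>\<epsilon>\<close>
  at every scale.\<close>

definition log_cutoff :: "real \<Rightarrow> real \<Rightarrow> 'a::euclidean_space \<Rightarrow> real" where
  "log_cutoff \<epsilon> p u = bump (\<epsilon> * ln (1 + u \<bullet> u)) * (1 + u \<bullet> u) powr (- p)"

lemma C_diff_log_cutoff: "C_diff n (log_cutoff \<epsilon> p)"
  unfolding log_cutoff_def[abs_def]
  by (intro C_diff_mult C_diff_bump C_diff_ln C_diff_powr C_diff_add C_diff_const C_diff_inner C_diff_ident)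
    (auto intro: add_pos_nonneg)

lemma has_derivative_log_cutoff:
  fixes u :: "'a::euclidean_space"
  defines "c \<equiv> 1 + u \<bullet> u"
  shows "(log_cutoff \<epsilon> p has_derivative
    (\<lambda>v. 2 * (u \<bullet> v) * (\<epsilon> * bump_deriv (\<epsilon> * ln c) - p * bump (\<epsilon> * ln c)) * c powr (- p - 1))) (at u)"
proof -
  have c: "c > 0" by (simp add: c_def add_pos_nonneg)
  have dc: "((\<lambda>u. 1 + u \<bullet> u) has_derivative (\<lambda>v. 2 * (u \<bullet> v))) (at u)"
    by (auto intro!: derivative_eq_intros simp: inner_commute)
  have "((\<lambda>u. \<epsilon> * ln (1 + u \<bullet> u)) has_derivative (\<lambda>v. \<epsilon> * (2 * (u \<bullet> v) / c))) (at u)"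
    using c by (auto intro!: derivative_eq_intros simp: inner_commute c_def divide_inverse)
  note d1 = has_derivative_bump[OF this]
  have d2: "((\<lambda>u. (1 + u \<bullet> u) powr (- p)) has_derivative (\<lambda>v. c powr (- p) * (2 * (u \<bullet> v) * (- p) / c))) (at u)"
    using has_derivative_powr[OF dc has_derivative_const[of "- p"]] c by (simp add: c_def)
  have "c powr (- p) = c * c powr (- p - 1)" using c by (simp add: powr_diff)
  then show ?thesis
    unfolding log_cutoff_def[abs_def] using c
    by (intro has_derivative_eq_rhs[OF has_derivative_mult[OF d1 d2]])
      (auto simp: fun_eq_iff c_def[symmetric] field_simps)
qed

lemma log_cutoff_eq_0:
  fixes u :: "'a::euclidean_space" and N :: nat
  assumes "N > 0" "norm u \<ge> exp (real N)"
  shows "log_cutoff (1 / real N) p u = 0"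
proof -
  have "exp (real (2 * N)) = (exp (real N))\<^sup>2" by (simp add: exp_of_nat_mult[symmetric] power2_eq_square exp_add[symmetric])
  also have "\<dots> \<le> (norm u)\<^sup>2" using assms(2) by (intro power_mono) auto
  also have "\<dots> \<le> 1 + u \<bullet> u" by (simp add: power2_norm_eq_inner)
  finally have "real (2 * N) \<le> ln (1 + u \<bullet> u)"
    by (subst ln_ge_iff) (auto intro: add_pos_nonneg)
  then have "2 \<le> 1 / real N * ln (1 + u \<bullet> u)" using assms(1) by (simp add: field_simps)
  then show ?thesis unfolding log_cutoff_def using bump_eq_0(1)[of "1 / real N * ln (1 + u \<bullet> u)"] by simp
qed

text \<open>For k = 1 this is the cutoff times a unit normal, so the density is the classical one of
  a surface, |grad phi|^2 - |A|^2 phi^2 with |A|^2 = 2 / c^2, times the area weight sqrt c; products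
  of phi with its derivative cancel.\<close>

lemma helicoid_density_log_cutoff_1:
  fixes u :: "real^'k::finite" and i :: 'k and \<epsilon> :: real
  assumes UNIV: "UNIV = {i}"
  defines "c \<equiv> 1 + u \<bullet> u" and "Y \<equiv> \<lambda>u. log_cutoff \<epsilon> (1/2) u *\<^sub>R axis i 1"
  shows "helicoid_density u (Y u) (\<lambda>j. frechet_derivative Y (at u) (axis j 1)) 0
    = (4 * \<epsilon>\<^sup>2 * (u \<bullet> u) * (bump_deriv (\<epsilon> * ln c))\<^sup>2 - 2 * (bump (\<epsilon> * ln c))\<^sup>2) * c powr (-3/2)"
proof -
  \<comment> \<open>All fractional powers of \<open>c\<close> are written as polynomials in
    \<open>c\<close> times \<open>P\<close>, and c^3 P^2 = 1 removes the surplus.\<close>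
  define \<phi> \<phi>' P where "\<phi> = bump (\<epsilon> * ln c)" and "\<phi>' = bump_deriv (\<epsilon> * ln c)" and "P = c powr (-3/2)"
  define x where "x = u $ i"
  have c: "c > 0" by (simp add: c_def add_pos_nonneg)
  have uu: "u \<bullet> u = x\<^sup>2" by (simp add: inner_vec_def UNIV x_def power2_eq_square)
  have cx: "c = 1 + x\<^sup>2" by (simp add: c_def uu)
  have P1: "c powr (- (1/2)) = c * P" 
    using powr_add[of c 1 "-3/2"] c by (simp add: P_def)
  have P2: "sqrt c = c\<^sup>2 * P"
    using powr_add[of c 2 "-3/2"] c by (simp add: P_def powr_half_sqrt[symmetric])
  have P3: "c ^ 3 * P\<^sup>2 = 1"
  proof -
    have "P\<^sup>2 = c powr (-3)" by (simp add: P_def power2_eq_square powr_add[symmetric])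
    also have "\<dots> = 1 / c ^ 3" using c by (simp add: powr_minus divide_inverse powr_numeral)
    finally show ?thesis using c by simp
  qed
  define E where "E = \<epsilon> * \<phi>' - \<phi> / 2"
  have Yu: "Y u = (\<phi> * (c * P)) *\<^sub>R axis i 1"
    by (simp add: Y_def log_cutoff_def \<phi>_def c_def[symmetric] P1)
  have "(Y has_derivative (\<lambda>v. (2 * (u \<bullet> v) * E * P) *\<^sub>R axis i 1)) (at u)"
    unfolding Y_def
    using has_derivative_scaleR_left[OF has_derivative_log_cutoff[of \<epsilon> "1/2" u]]
    by (simp add: c_def[symmetric] \<phi>_def[symmetric] \<phi>'_def[symmetric] E_def P_def)
  from frechet_derivative_at[OF this, symmetric]
  have D: "frechet_derivative Y (at u) (axis j 1) = (2 * u $ j * E * P) *\<^sub>R axis i 1" for j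
    by (simp add: inner_axis)
  have "helicoid_density u (Y u) (\<lambda>j. frechet_derivative Y (at u) (axis j 1)) 0
     = ((2 * x * E * P)\<^sup>2 + (2 * x * E * P * x + \<phi> * (c * P))\<^sup>2 - 3 * (\<phi> * (c * P))\<^sup>2 / c) * sqrt c"
    unfolding helicoid_density_def D Yu c_def[symmetric] UNIV
    by (simp add: inner_axis' x_def power_mult_distrib)
  also have "3 * (\<phi> * (c * P))\<^sup>2 / c = 3 * \<phi>\<^sup>2 * c * P\<^sup>2"
    using c by (simp add: power_mult_distrib power2_eq_square)
  also have "((2 * x * E * P)\<^sup>2 + (2 * x * E * P * x + \<phi> * (c * P))\<^sup>2 - 3 * \<phi>\<^sup>2 * c * P\<^sup>2) * sqrt c
     = (c ^ 3 * P\<^sup>2) * (4 * \<epsilon>\<^sup>2 * x\<^sup>2 * \<phi>'\<^sup>2 - 2 * \<phi>\<^sup>2) * P"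
    unfolding P2 unfolding E_def cx by (simp add: power2_eq_square power3_eq_cube field_simps)
  finally show ?thesis
    unfolding P3 by (simp add: uu \<phi>_def \<phi>'_def P_def)
qed

text \<open>The rotation field is orthogonal to \<open>u\<close>, so h = 0. Where the cutoff is
  constant and \<open>\<rho>\<close> tends to 1, the coefficient of phi^2 / c is 9/4 - 3 + 2 - 3 =
  -7/4, which is Hardy 1/4 plus angular energy 1 minus 3.\<close>

lemma helicoid_density_log_cutoff_2:
  fixes u :: "real^'k::finite" and i j :: 'k and \<epsilon> :: real
  assumes UNIV: "UNIV = {i, j}" and ij: "i \<noteq> j"
  defines "c \<equiv> 1 + u \<bullet> u" and "J \<equiv> \<lambda>v. (- (v $ j)) *\<^sub>R axis i 1 + (v $ i) *\<^sub>R axis j 1"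
  defines "Y \<equiv> \<lambda>u. log_cutoff \<epsilon> (3/4) u *\<^sub>R J u" and "\<rho> \<equiv> (u \<bullet> u) / c"
  defines "E \<equiv> \<epsilon> * bump_deriv (\<epsilon> * ln c) - 3/4 * bump (\<epsilon> * ln c)" and "\<phi> \<equiv> bump (\<epsilon> * ln c)"
  shows "helicoid_density u (Y u) (\<lambda>j. frechet_derivative Y (at u) (axis j 1)) 0
    = (4 * \<rho>\<^sup>2 * E\<^sup>2 + 4 * \<rho> * \<phi> * E + 2 * \<phi>\<^sup>2 - 3 * \<rho> * \<phi>\<^sup>2) / c"
proof -
  define P where "P = c powr (-7/4)"
  define a b where "a = u $ i" and "b = u $ j"
  have c: "c > 0" by (simp add: c_def add_pos_nonneg)
  have uu: "u \<bullet> u = a\<^sup>2 + b\<^sup>2" using ij by (simp add: inner_vec_def UNIV a_def b_def power2_eq_square)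
  have P1: "c powr (- (3/4)) = c * P" 
    using powr_add[of c 1 "-7/4"] c by (simp add: P_def)
  have P2: "P\<^sup>2 * sqrt c = 1 / c ^ 3"
  proof -
    have "P\<^sup>2 * sqrt c = c powr (-7/4 + -7/4 + 1/2)"
      using c by (simp only: P_def power2_eq_square powr_add powr_half_sqrt less_imp_le)
    also have "-7/4 + -7/4 + 1/2 = (- 3 :: real)" by simp
    also have "c powr - 3 = 1 / c ^ 3" using c by (simp add: powr_minus divide_inverse powr_numeral)
    finally show ?thesis .
  qed
  have J: "bounded_linear J"
    unfolding J_def by (intro bounded_linear_intros bounded_linear_minus bounded_linear_vec_nth)
  have Yu: "Y u = (\<phi> * (c * P)) *\<^sub>R J u"
    by (simp add: Y_def log_cutoff_def \<phi>_def c_def[symmetric] P1)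
  have "(Y has_derivative (\<lambda>v. log_cutoff \<epsilon> (3/4) u *\<^sub>R J v + (2 * (u \<bullet> v) * E * P) *\<^sub>R J u)) (at u)"
    unfolding Y_def
    using has_derivative_scaleR[OF has_derivative_log_cutoff[of \<epsilon> "3/4" u] bounded_linear_imp_has_derivative[OF J]]
    by (simp add: c_def[symmetric] E_def P_def)
  from frechet_derivative_at[OF this, symmetric]
  have D: "frechet_derivative Y (at u) (axis l 1) = (\<phi> * (c * P)) *\<^sub>R J (axis l 1) + (2 * u $ l * E * P) *\<^sub>R J u" for l
    by (simp add: inner_axis log_cutoff_def \<phi>_def c_def[symmetric] P1)
  have Jc: "J u $ i = - b" "J u $ j = a"
    using ij by (simp_all add: J_def a_def b_def axis_def)
  have Ju: "J u \<bullet> u = 0" "(norm (J u))\<^sup>2 = u \<bullet> u"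
    unfolding power2_norm_eq_inner using ij
    by (simp_all add: inner_vec_def UNIV Jc a_def[symmetric] b_def[symmetric])
  have Ji: "J (axis i 1) = axis j 1" "J (axis j 1) = - axis i 1"
    using ij by (simp_all add: J_def axis_def)
  have Jp: "J u \<bullet> axis j 1 = a" "J u \<bullet> axis i 1 = - b" "axis j 1 \<bullet> J u = a" "axis i 1 \<bullet> J u = - b"
    using Jc by (simp_all add: inner_axis inner_axis')
  have norm_sum: "(norm (x + y))\<^sup>2 = (norm x)\<^sup>2 + 2 * (x \<bullet> y) + (norm y)\<^sup>2" for x y :: "real^'k"
    by (simp add: power2_norm_eq_inner inner_add_left inner_add_right inner_commute)
  have "helicoid_density u (Y u) (\<lambda>j. frechet_derivative Y (at u) (axis j 1)) 0
     = (((\<phi> * (c * P))\<^sup>2 + 2 * (\<phi> * (c * P)) * (2 * a * E * P) * a + (2 * a * E * P)\<^sup>2 * (u \<bullet> u))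
       + ((\<phi> * (c * P))\<^sup>2 + 2 * (\<phi> * (c * P)) * (2 * b * E * P) * b + (2 * b * E * P)\<^sup>2 * (u \<bullet> u))
       - 3 * ((\<phi> * (c * P))\<^sup>2 * (u \<bullet> u)) / c) * sqrt c"
    unfolding helicoid_density_def D Yu c_def[symmetric] UNIV norm_sum
    using ij by (simp add: Ji Jc Ju Jp inner_add_left power_mult_distrib inner_axis' a_def[symmetric] b_def[symmetric])
  also have "\<dots> = (4 * (u \<bullet> u)\<^sup>2 * E\<^sup>2 + 4 * c * \<phi> * E * (u \<bullet> u) + 2 * c\<^sup>2 * \<phi>\<^sup>2 - 3 * c * \<phi>\<^sup>2 * (u \<bullet> u)) * (P\<^sup>2 * sqrt c)"
    using c unfolding uu by (simp add: power2_eq_square field_simps)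
  also have "\<dots> = (4 * \<rho>\<^sup>2 * E\<^sup>2 + 4 * \<rho> * \<phi> * E + 2 * \<phi>\<^sup>2 - 3 * \<rho> * \<phi>\<^sup>2) / c"
    unfolding P2 \<rho>_def using c by (simp add: power2_eq_square power3_eq_cube field_simps)
  finally show ?thesis .
qed

lemma cutoff_support:
  fixes c :: real and N :: nat
  assumes "N > 0" "c > 0"
  shows "exp (real (2 * N)) \<le> c \<Longrightarrow> bump (1 / real N * ln c) = 0 \<and> bump_deriv (1 / real N * ln c) = 0"
    and "1 \<le> c \<Longrightarrow> c \<le> exp (real N) \<Longrightarrow> exp (- (1/3)) \<le> bump (1 / real N * ln c)"
proof -
  assume "exp (real (2 * N)) \<le> c"
  then have "real (2 * N) \<le> ln c" using assms by (subst ln_ge_iff)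
  then have "2 \<le> \<bar>1 / real N * ln c\<bar>" using assms(1) by (simp add: field_simps)
  then show "bump (1 / real N * ln c) = 0 \<and> bump_deriv (1 / real N * ln c) = 0"
    by (simp add: bump_eq_0)
next
  assume "1 \<le> c" "c \<le> exp (real N)"
  then have "0 \<le> ln c" "ln c \<le> real N" using assms by (auto simp: ln_le_cancel_iff[symmetric, of c "exp _"])
  then have "\<bar>1 / real N * ln c\<bar> \<le> 1" using assms(1) by (simp add: field_simps)
  then show "exp (- (1/3)) \<le> bump (1 / real N * ln c)" by (rule bump_ge)
qed

text \<open>The gain near the axis does not depend on the cutoff. The gradient term is epsilon^2
  times an integral of order N, hence O(1 / N).\<close>

lemma helicoid_unstable_1:
  assumes "CARD('k::finite) = 1"
  shows "\<not> stable (helicoid :: (real^'k) \<times> real \<Rightarrow> (complex^'k) \<times> real)"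
proof -
  obtain i :: 'k where UNIV: "UNIV = {i}" using assms by (rule card_1_singletonE)
  have dim: "DIM(real^'k) = 1" using assms by simp
  obtain C where C: "C > 0" "\<And>t. \<bar>bump_deriv t\<bar> \<le> C" by (rule bump_deriv_bounded) blast
  define e0 :: real where "e0 = exp (- (1/3))"
  have e0: "e0 > 0" by (simp add: e0_def)
  \<comment> \<open>Solves 8 C^2 exp (1/2) / N < e0^2 / 2, the two sides being the integrals of the
    parts of \<open>g\<close> up to the volume of the unit ball.\<close>
  define N :: nat where "N = nat \<lceil>16 * C\<^sup>2 * exp (1/2) / e0\<^sup>2\<rceil> + 1"
  have "real N > 16 * C\<^sup>2 * exp (1/2) / e0\<^sup>2"
    unfolding N_def by linarith
  then have N: "N > 0" "16 * C\<^sup>2 * exp (1/2) < e0\<^sup>2 * real N"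
    using e0 by (auto simp: N_def pos_divide_less_eq mult.commute)
  define \<epsilon> where "\<epsilon> = 1 / real N"
  define Y where "Y = (\<lambda>u :: real^'k. log_cutoff \<epsilon> (1/2) u *\<^sub>R axis i (1::real))"
  \<comment> \<open>On the unit ball c < 2, so c^(-3/2) >= 1/4, and twice e0^2 / 4 is kept from the
    negative term.\<close>
  define g where "g u = 4 * \<epsilon>\<^sup>2 * C\<^sup>2 * upper_step (2 * N) u - e0\<^sup>2 / 2 * indicator (ball 0 1) u" for u :: "real^'k"
  show ?thesis
  proof (rule helicoid_unstable)
    show "smooth Y"
      unfolding smooth_def Y_def by (intro allI C_diff_scaleR C_diff_log_cutoff C_diff_const)
    show "Y u = 0" if "norm u \<ge> exp (real N)" for u
      using log_cutoff_eq_0[OF N(1) that] by (simp add: Y_def \<epsilon>_def)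
    have ball_int: "integrable lborel (indicator (ball 0 1) :: real^'k \<Rightarrow> real)"
      by (simp add: integrable_indicator_iff emeasure_lborel_ball_finite[simplified])
    then show "integrable lborel g"
      unfolding g_def[abs_def] by (intro Bochner_Integration.integrable_diff integrable_mult_right integrable_upper_step)
    have "(LINT u|lborel. g u) = 4 * \<epsilon>\<^sup>2 * C\<^sup>2 * (real (2 * N) * (unit_ball_vol 1 * exp (1/2))) - e0\<^sup>2 / 2 * unit_ball_vol 1"
      unfolding g_def using ball_int integrable_upper_step[of "2 * N", where 'a = "real^'k"]
      by (subst Bochner_Integration.integral_diff) (auto simp: integral_upper_step dim content_ball assms)
    also have "\<dots> = unit_ball_vol 1 / (2 * real N) * (16 * C\<^sup>2 * exp (1/2) - e0\<^sup>2 * real N)"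
      using N(1) by (simp add: \<epsilon>_def power2_eq_square field_simps)
    also have "\<dots> < 0" using N by (intro mult_pos_neg) auto
    finally show "(LINT u|lborel. g u) < 0" .
    show "helicoid_density u (Y u) (\<lambda>j. frechet_derivative Y (at u) (axis j 1)) 0 \<le> g u" for u
    proof -
      define c where "c = 1 + u \<bullet> u"
      define \<phi> \<phi>' where "\<phi> = bump (\<epsilon> * ln c)" and "\<phi>' = bump_deriv (\<epsilon> * ln c)"
      have c: "c \<ge> 1" "c > 0" "u \<bullet> u \<le> c" by (simp_all add: c_def add_pos_nonneg)
      have eq: "helicoid_density u (Y u) (\<lambda>j. frechet_derivative Y (at u) (axis j 1)) 0
        = 4 * \<epsilon>\<^sup>2 * \<phi>'\<^sup>2 * ((u \<bullet> u) * c powr (-3/2)) - 2 * (\<phi>\<^sup>2 * c powr (-3/2))"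
        unfolding Y_def helicoid_density_log_cutoff_1[OF UNIV] c_def[symmetric] \<phi>_def \<phi>'_def
        by (simp add: algebra_simps)
      have 1: "4 * \<epsilon>\<^sup>2 * \<phi>'\<^sup>2 * ((u \<bullet> u) * c powr (-3/2)) \<le> 4 * \<epsilon>\<^sup>2 * C\<^sup>2 * upper_step (2 * N) u"
      proof (cases "c < exp (real (2 * N))")
        case True
        have "c * c powr (-3/2) = c powr (-1/2)"
          using powr_add[of c 1 "-3/2"] c by simp
        then have "(u \<bullet> u) * c powr (-3/2) \<le> c powr (-1/2)"
          using mult_right_mono[OF c(3), of "c powr (-3/2)"] by simp
        also have "\<dots> \<le> upper_step (2 * N) u"
          using upper_step_ge[of u "2 * N"] True by (simp add: c_def assms)
        finally have "(u \<bullet> u) * c powr (-3/2) \<le> upper_step (2 * N) u" .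
        moreover have "\<phi>'\<^sup>2 \<le> C\<^sup>2" using C by (simp add: \<phi>'_def abs_le_square_iff[symmetric])
        ultimately show ?thesis by (intro mult_mono) auto
      next
        case False
        then have "\<phi>' = 0" using cutoff_support(1)[OF N(1) c(2)] by (simp add: \<phi>'_def \<epsilon>_def)
        then show ?thesis using upper_step_nonneg[of "2 * N" u] by simp
      qed
      have 2: "e0\<^sup>2 / 2 * indicator (ball 0 1) u \<le> 2 * (\<phi>\<^sup>2 * c powr (-3/2))"
      proof (cases "u \<in> ball 0 1")
        case True
        then have "u \<bullet> u < 1\<^sup>2" by (subst ball_0_iff[symmetric]) auto
        then have c2: "c \<le> 2" by (simp add: c_def)
        also have "2 \<le> exp (1 :: real)" using exp_ge_add_one_self[of 1] by simp
        also have "\<dots> \<le> exp (real N)" using N(1) by simp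
        finally have "e0 \<le> \<phi>"
          using cutoff_support(2)[OF N(1) c(2)] c(1) by (simp add: e0_def \<phi>_def \<epsilon>_def)
        then have "e0\<^sup>2 \<le> \<phi>\<^sup>2" using e0 by (intro power_mono) auto
        moreover have "1/4 \<le> c powr (-3/2)"
        proof -
          have "1/4 = (2::real) powr (-2)" by (simp add: powr_minus powr_numeral)
          also have "\<dots> \<le> 2 powr (-3/2)" by (intro powr_mono) auto
          also have "\<dots> \<le> c powr (-3/2)" using c c2 by (intro powr_mono2') auto
          finally show ?thesis .
        qed
        ultimately have "e0\<^sup>2 * (1/4) \<le> \<phi>\<^sup>2 * c powr (-3/2)" by (intro mult_mono) auto
        then show ?thesis using True by simp
      qed auto
      show ?thesis unfolding eq g_def using 1 2 by linarith
    qed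
  qed
qed

text \<open>Negative mass accumulates at every scale, of order N in total, while the unit ball and
  the derivatives of the cutoff contribute a bounded amount.\<close>

lemma helicoid_unstable_2:
  assumes "CARD('k::finite) = 2"
  shows "\<not> stable (helicoid :: (real^'k) \<times> real \<Rightarrow> (complex^'k) \<times> real)"
proof -
  obtain i j :: 'k where UNIV: "UNIV = {i, j}" and ij: "i \<noteq> j"
    using assms by (auto simp: card_2_iff)
  have dim: "DIM(real^'k) = 2" using assms by simp
  obtain C where C: "C > 0" "\<And>t. \<bar>bump_deriv t\<bar> \<le> C" by (rule bump_deriv_bounded) blast
  define e0 :: real where "e0 = exp (- (1/3))"
  have e0: "e0 > 0" by (simp add: e0_def)
  define K where "K = 4 * C + 4 * C\<^sup>2"
  define d where "d = 2/5 * e0\<^sup>2 * (1 - exp (-1 :: real))"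
  have d: "d > 0" unfolding d_def using e0 by (intro mult_pos_pos) auto
  \<comment> \<open>Up to the volume of the unit disc, the positive part of the integral of
    \<open>g\<close> is 2 + 2 K e for every N, and the N - 1 annuli give -d (N - 1).\<close>
  define N :: nat where "N = nat \<lceil>(2 + 2 * K * exp 1) / d\<rceil> + 2"
  have N: "N > 0" by (simp add: N_def)
  have "(2 + 2 * K * exp 1) / d < real (N - 1)"
    unfolding N_def by simp linarith
  then have N_less: "2 + 2 * K * exp 1 < d * real (N - 1)"
    using d by (simp add: pos_divide_less_eq mult.commute)
  define \<epsilon> where "\<epsilon> = 1 / real N"
  have \<epsilon>: "0 \<le> \<epsilon>" "\<epsilon> \<le> 1" using N by (auto simp: \<epsilon>_def)
  define J where "J = (\<lambda>v :: real^'k. (- (v $ j)) *\<^sub>R axis i 1 + (v $ i) *\<^sub>R axis j (1::real))"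
  define Y where "Y = (\<lambda>u :: real^'k. log_cutoff \<epsilon> (3/4) u *\<^sub>R J u)"
  define g where "g u = 2 * indicator (ball 0 1) u + \<epsilon> * K * upper_step (2 * N) u
      - 2/5 * e0\<^sup>2 * lower_step (N - 1) u" for u :: "real^'k"
  show ?thesis
  proof (rule helicoid_unstable)
    have J: "bounded_linear J"
      unfolding J_def by (intro bounded_linear_intros bounded_linear_minus bounded_linear_vec_nth)
    show "smooth Y"
      unfolding smooth_def Y_def by (intro allI C_diff_scaleR C_diff_log_cutoff C_diff_linear[OF J])
    show "Y u = 0" if "norm u \<ge> exp (real N)" for u
      using log_cutoff_eq_0[OF N that] by (simp add: Y_def \<epsilon>_def)
    have int: "integrable lborel (indicator (ball 0 1) :: real^'k \<Rightarrow> real)"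
      by (simp add: integrable_indicator_iff emeasure_lborel_ball_finite[simplified])
    note int = int integrable_upper_step[of "2 * N", where 'a = "real^'k"]
      integrable_lower_step[of "N - 1", where 'a = "real^'k"]
    then show "integrable lborel g"
      unfolding g_def[abs_def]
      by (intro Bochner_Integration.integrable_diff Bochner_Integration.integrable_add integrable_mult_right)
    have "(LINT u|lborel. g u) = 2 * unit_ball_vol 2
        + \<epsilon> * K * (real (2 * N) * (unit_ball_vol 2 * exp 1))
        - 2/5 * e0\<^sup>2 * (real (N - 1) * (unit_ball_vol 2 * (1 - exp (-1))))"
    proof -
      have "(LINT u|lborel. g u) = 2 * (LINT u|lborel. indicator (ball 0 1) (u :: real^'k))
        + \<epsilon> * K * (LINT u|lborel. upper_step (2 * N) (u :: real^'k))
        - 2/5 * e0\<^sup>2 * (LINT u|lborel. lower_step (N - 1) (u :: real^'k))"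
        unfolding g_def using int by simp
      then show ?thesis
        unfolding integral_upper_step integral_lower_step[OF dim] dim
        by (simp add: content_ball assms)
    qed
    also have "\<dots> = unit_ball_vol 2 * (2 + 2 * K * exp 1 - d * real (N - 1))"
      using N by (simp add: \<epsilon>_def d_def algebra_simps add_divide_distrib diff_divide_distrib)
    also have "\<dots> < 0" using N_less by (intro mult_pos_neg) auto
    finally show "(LINT u|lborel. g u) < 0" .
    show "helicoid_density u (Y u) (\<lambda>j. frechet_derivative Y (at u) (axis j 1)) 0 \<le> g u" for u
    proof -
      define c where "c = 1 + u \<bullet> u"
      define \<rho> where "\<rho> = (u \<bullet> u) / c"
      define \<phi> \<phi>' where "\<phi> = bump (\<epsilon> * ln c)" and "\<phi>' = bump_deriv (\<epsilon> * ln c)"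
      \<comment> \<open>Expanding \<open>E\<close> in the density: \<open>q\<close> collects the
        terms in phi^2, and epsilon times \<open>r\<close> all terms containing the derivative of
        the cutoff.\<close>
      define q where "q = 2 - 6 * \<rho> + 9/4 * \<rho>\<^sup>2"
      define r where "r = \<phi> * \<phi>' * (4 * \<rho> - 6 * \<rho>\<^sup>2) + 4 * \<epsilon> * \<rho>\<^sup>2 * \<phi>'\<^sup>2"
      have c: "c \<ge> 1" "c > 0" by (simp_all add: c_def add_pos_nonneg)
      have \<rho>: "0 \<le> \<rho>" "\<rho> \<le> 1" using c by (simp_all add: \<rho>_def c_def)
      have \<phi>: "0 \<le> \<phi>" "\<phi> \<le> 1" "\<bar>\<phi>'\<bar> \<le> C"
        by (simp_all add: \<phi>_def \<phi>'_def bump_nonneg bump_le_1 C)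
      have eq: "helicoid_density u (Y u) (\<lambda>j. frechet_derivative Y (at u) (axis j 1)) 0
        = \<phi>\<^sup>2 * q / c + \<epsilon> * (r / c)"
        unfolding Y_def J_def helicoid_density_log_cutoff_2[OF UNIV ij] c_def[symmetric]
          \<rho>_def[symmetric] \<phi>_def[symmetric] \<phi>'_def[symmetric] q_def r_def
        using c by (simp add: field_simps power2_eq_square)
      have 1: "\<epsilon> * (r / c) \<le> \<epsilon> * K * upper_step (2 * N) u"
      proof (cases "c < exp (real (2 * N))")
        case True
        have "\<rho>\<^sup>2 \<le> 1" using \<rho> by (simp add: power_le_one)
        have "\<phi> * \<phi>' * (4 * \<rho> - 6 * \<rho>\<^sup>2) \<le> \<bar>\<phi> * \<phi>' * (4 * \<rho> - 6 * \<rho>\<^sup>2)\<bar>" by simp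
        also have "\<dots> = \<phi> * \<bar>\<phi>'\<bar> * \<bar>4 * \<rho> - 6 * \<rho>\<^sup>2\<bar>" using \<phi> by (simp add: abs_mult)
        also have "\<dots> \<le> 1 * C * 4"
        proof (intro mult_mono)
          have "\<rho>\<^sup>2 \<le> \<rho>" using \<rho> by (simp add: power2_eq_square mult_left_le)
          moreover have "0 \<le> \<rho>\<^sup>2" by simp
          ultimately show "\<bar>4 * \<rho> - 6 * \<rho>\<^sup>2\<bar> \<le> 4" using \<rho> by linarith
        qed (use \<phi> C(1) in auto)
        finally have "\<phi> * \<phi>' * (4 * \<rho> - 6 * \<rho>\<^sup>2) \<le> 4 * C" by simp
        moreover have "\<epsilon> * \<rho>\<^sup>2 * \<phi>'\<^sup>2 \<le> 1 * 1 * C\<^sup>2"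
          using \<epsilon> \<open>\<rho>\<^sup>2 \<le> 1\<close> \<phi>(3) C(1)
          by (intro mult_mono) (auto simp: abs_le_square_iff[symmetric])
        ultimately have rK: "r \<le> K" by (simp add: r_def K_def)
        have "1 / c = c powr (-1)" using c by (simp add: powr_minus divide_inverse)
        also have "\<dots> \<le> upper_step (2 * N) u"
          using upper_step_ge[of u "2 * N"] True by (simp add: c_def assms)
        finally have up: "1 / c \<le> upper_step (2 * N) u" .
        have "K \<ge> 0" using C(1) by (simp add: K_def)
        have "r / c \<le> K * (1 / c)" using rK c by (simp add: divide_right_mono)
        also have "\<dots> \<le> K * upper_step (2 * N) u" using up \<open>K \<ge> 0\<close> by (rule mult_left_mono)
        finally show ?thesis unfolding mult.assoc using \<epsilon>(1) by (rule mult_left_mono)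
      next
        case False
        then have "\<phi> = 0" "\<phi>' = 0" using cutoff_support(1)[OF N c(2)] by (simp_all add: \<phi>_def \<phi>'_def \<epsilon>_def)
        then show ?thesis using upper_step_nonneg[of "2 * N" u] C(1) \<epsilon> by (simp add: r_def K_def)
      qed
      have 2: "\<phi>\<^sup>2 * q / c \<le> 2 * indicator (ball 0 1) u - 2/5 * e0\<^sup>2 * lower_step (N - 1) u"
      proof (cases "u \<in> ball 0 1")
        case True
        then have "u \<bullet> u < 1\<^sup>2" by (subst ball_0_iff[symmetric]) auto
        then have low: "lower_step (N - 1) u = 0" by (intro lower_step_eq_0) auto
        have "\<rho>\<^sup>2 \<le> \<rho>" using \<rho> by (simp add: power2_eq_square mult_left_le)
        then have "q \<le> 2" using \<rho> by (simp add: q_def)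
        moreover have "\<phi>\<^sup>2 \<le> 1" using \<phi> by (simp add: power_le_one)
        ultimately have "\<phi>\<^sup>2 * q \<le> 1 * 2"
          using mult_left_mono[of q 2 "\<phi>\<^sup>2"] by simp
        then have "\<phi>\<^sup>2 * q / c \<le> 2" using c by (simp add: divide_le_eq)
        then show ?thesis using True low by simp
      next
        case False
        then have "\<not> u \<bullet> u < 1\<^sup>2" by (subst ball_0_iff[symmetric]) auto
        then have "c \<ge> 2" by (simp add: c_def)
        then have "\<rho> \<ge> 1/2" by (simp add: \<rho>_def c_def field_simps)
        \<comment> \<open>The chord of the square over [1/2, 1] bounds \<open>q\<close> by 7/8 -
          21/8 \<open>\<rho>\<close>, at most -7/16 < -2/5.\<close>
        then have "0 \<le> (\<rho> - 1/2) * (1 - \<rho>)" using \<rho> by simp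
        also have "\<dots> = 3/2 * \<rho> - 1/2 - \<rho>\<^sup>2" by (simp add: power2_eq_square field_simps)
        finally have "q \<le> - 2/5" unfolding q_def using \<open>\<rho> \<ge> 1/2\<close> by linarith
        then have "\<phi>\<^sup>2 * q / c \<le> \<phi>\<^sup>2 * (- 2/5) / c"
          using c by (intro divide_right_mono mult_left_mono) auto
        also have "\<dots> \<le> - 2/5 * (e0\<^sup>2 * lower_step (N - 1) u)"
        proof -
          have "e0\<^sup>2 * lower_step (N - 1) u \<le> \<phi>\<^sup>2 * (1 / c)"
          proof (cases "c \<le> exp (real N)")
            case True
            then have "e0 \<le> \<phi>"
              using cutoff_support(2)[OF N c(2)] c(1) by (simp add: e0_def \<phi>_def \<epsilon>_def)
            then have "e0\<^sup>2 \<le> \<phi>\<^sup>2" using e0 by (intro power_mono) auto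
            moreover have "lower_step (N - 1) u \<le> 1 / c" unfolding c_def by (rule lower_step_le)
            moreover have "0 \<le> lower_step (N - 1) u"
              unfolding lower_step_def by (intro sum_nonneg) auto
            ultimately show ?thesis by (intro mult_mono) auto
          next
            case False
            \<comment> \<open>The index N - 1 makes the step function end at c = e^N, up to which
              the lower bound of the cutoff holds.\<close>
            then have "lower_step (N - 1) u = 0"
              using N by (intro lower_step_eq_0) (simp add: c_def)
            then show ?thesis using c by simp
          qed
          then show ?thesis by simp
        qed
        finally show ?thesis using False by simp
      qed
      show ?thesis unfolding eq g_def using 1 2 by linarith
    qed
  qed
qed

theorem theorem1p1:
  shows "stable (helicoid :: (real^'k::finite) \<times> real \<Rightarrow> (complex^'k) \<times> real) \<longleftrightarrow> CARD('k) \<ge> 3"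
proof
  assume stable: "stable (helicoid :: (real^'k::finite) \<times> real \<Rightarrow> (complex^'k) \<times> real)"
  have "CARD('k) > 0" by (simp add: card_gt_0_iff)
  moreover have "CARD('k) \<noteq> 1" "CARD('k) \<noteq> 2"
    using stable helicoid_unstable_1 helicoid_unstable_2 by blast+
  ultimately show "CARD('k) \<ge> 3" by linarith
next
  assume "CARD('k) \<ge> 3"
  then show "stable (helicoid :: (real^'k::finite) \<times> real \<Rightarrow> (complex^'k) \<times> real)"
    using second_variation_helicoid_nonneg
    unfolding stable_def compactly_supported_normal_field_helicoid_iff by blast
qed

end
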